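(* Let $p$ be a uniformly bounded probability density on $\mathbb{R}_+$ of the form $p(x)=c\exp\big(-(g(x)-q(x))\big)$ satisfying the standing assumptions given in the context, with $h:=g'\in\mathfrak{R}$. Let $a_n\to\infty$ as $n\to\infty$, let $t=t_n$ be determined by $m(t)=a_n$, and put $s=s(t)$, $\mu_3=\mu_3(t)$. Let $$\pi^{a_n}(x)=\frac{e^{tx}p(x)}{\Phi(t)},\qquad \bar\pi^{a_n}(x)=s\,\pi^{a_n}(sx+a_n),$$ let $\bar\pi^{a_n}_n$ be the $n$-fold convolution of $\bar\pi^{a_n}$ with itself, and let $$\rho_n(x):=\sqrt n\,\bar\pi^{a_n}_n(\sqrt n\,x).$$ Then, as $n\to\infty$, uniformly in $x$, $$\rho_n(x)=\phi(x)\Big(1+\frac{\mu_3}{6\sqrt n\,s^3}\big(x^3-3x\big)\Big)+o\Big(\frac{1}{\sqrt n}\Big),$$ where $\phi$ is the standard normal density.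
   Context: Standing assumptions on $p$: $p(x)=c\exp(-(g(x)-q(x)))$ for $x\in\mathbb{R}_+$ (and $p=0$ on $(-\infty,0)$), $p$ is uniformly bounded, and $c>0$ is a normalizing constant. Put $h:=g'$. The function $g$ is positive with $g(x)/x\to\infty$ as $x\to\infty$. There is a constant $\vartheta>0$ such that, for all large $x$, $\sup_{|v-x|<\vartheta x}|q(v)|\le \frac{1}{x\sqrt{h(x)}}$. Class $R_0$: functions $l$ representable as $l(x)=\exp\big(\int_1^x\frac{\epsilon(u)}{u}du\big)$, $x\ge1$, with $\epsilon$ twice differentiable and $\epsilon(x)\to0$ as $x\to\infty$. Class $R_\beta$ ($\beta>0$): $h\in R_\beta$ if for $x$ large enough $h(x)=x^\beta l(x)$ with $l\in R_0$ whose $\epsilon$ satisfies $\limsup_{x\to\infty}x|\epsilon'(x)|<\infty$ and $\limsup_{x\to\infty}x^2|\epsilon''(x)|<\infty$. Class $\widetilde{R_0}$: functions $l\in R_0$ with $l(x)\to\infty$ as $x\to\infty$, $\lim_{x\to\infty}\frac{x\epsilon'(x)}{\epsilon(x)}=0$, $\lim_{x\to\infty}\frac{x^2\epsilon''(x)}{\epsilon(x)}=0$, and $\liminf_{x\to\infty}x^{\eta}\epsilon(x)>0$ for some $\eta\in(0,1/8)$. Class $R_\infty$: $h\in R_\infty$ if $h$ is increasing and strictly monotone and its inverse function $\psi(u)=h^{\leftarrow}(u)=\inf\{x:h(x)\ge u\}$ belongs to $\widetilde{R_0}$. $\mathfrak{R}:=R_\beta\cup R_\infty$ (i.e. $h\in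 R_\beta$ for some $\beta>0$, or $h\in R_\infty$). Notation: $\Phi(t)=\int_0^\infty e^{tx}p(x)\,dx$, $m(t)=\frac{d}{dt}\log\Phi(t)$, $s^2(t)=\frac{d}{dt}m(t)$ (with $s(t)>0$), $\mu_3(t)=\frac{d^3}{dt^3}\log\Phi(t)$; these are the mean, variance and third centered moment of the density $e^{tx}p(x)/\Phi(t)$. The equation $m(t)=a_n$ has a unique solution $t$ (for $n$ large). *)

theory Defs
  imports "HOL-Probability.Probability"
begin

text \<open>
  The half line is \<open>{0..}\<close>; \<open>h = g'\<close> is only considered on its interior \<open>{0<..}\<close>.
  In \<open>R0_rep l \<epsilon> \<epsilon>1 \<epsilon>2\<close> the functions \<open>\<epsilon>1\<close> and \<open>\<epsilon>2\<close> are the first and second derivatives of \<open>\<epsilon>\<close>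
  on \<open>{1..}\<close> (one-sided at \<open>1\<close>).
\<close>

definition R0_rep ::
  "(real \<Rightarrow> real) \<Rightarrow> (real \<Rightarrow> real) \<Rightarrow> (real \<Rightarrow> real) \<Rightarrow> (real \<Rightarrow> real) \<Rightarrow> bool" where
  "R0_rep l \<epsilon> \<epsilon>1 \<epsilon>2 \<longleftrightarrow>
     (\<forall>x\<ge>1. (\<epsilon> has_real_derivative \<epsilon>1 x) (at x within {1..})) \<and>
     (\<forall>x\<ge>1. (\<epsilon>1 has_real_derivative \<epsilon>2 x) (at x within {1..})) \<and>
     (\<epsilon> \<longlongrightarrow> 0) at_top \<and>
     (\<forall>x\<ge>1. l x = exp (integral {1..x} (\<lambda>u. \<epsilon> u / u)))"

definition class_R :: "real \<Rightarrow> (real \<Rightarrow> real) set" where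
  "class_R \<beta> = {h. \<exists>l \<epsilon> \<epsilon>1 \<epsilon>2. R0_rep l \<epsilon> \<epsilon>1 \<epsilon>2 \<and>
     Limsup at_top (\<lambda>x. ereal (x * \<bar>\<epsilon>1 x\<bar>)) < \<infinity> \<and>
     Limsup at_top (\<lambda>x. ereal (x\<^sup>2 * \<bar>\<epsilon>2 x\<bar>)) < \<infinity> \<and>
     (\<forall>\<^sub>F x in at_top. h x = x powr \<beta> * l x)}"

definition class_R0_tilde :: "(real \<Rightarrow> real) set" where
  "class_R0_tilde = {l. \<exists>\<epsilon> \<epsilon>1 \<epsilon>2. R0_rep l \<epsilon> \<epsilon>1 \<epsilon>2 \<and>
     filterlim l at_top at_top \<and>
     ((\<lambda>x. x * \<epsilon>1 x / \<epsilon> x) \<longlongrightarrow> 0) at_top \<and>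
     ((\<lambda>x. x\<^sup>2 * \<epsilon>2 x / \<epsilon> x) \<longlongrightarrow> 0) at_top \<and>
     (\<exists>\<eta>. 0 < \<eta> \<and> \<eta> < 1/8 \<and> Liminf at_top (\<lambda>x. ereal (x powr \<eta> * \<epsilon> x)) > 0)}"

definition gen_inverse :: "(real \<Rightarrow> real) \<Rightarrow> real \<Rightarrow> real" where
  "gen_inverse h u = Inf {x. 0 < x \<and> h x \<ge> u}"

text \<open>
  If \<open>h\<close> is bounded above, \<open>gen_inverse h\<close> is eventually the constant \<open>Inf {}\<close>, hence not in
  \<open>class_R0_tilde\<close>, whose members tend to infinity.
\<close>

definition class_R_infinity :: "(real \<Rightarrow> real) set" where
  "class_R_infinity = {h. strict_mono_on {0<..} h \<and> gen_inverse h \<in> class_R0_tilde}"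

definition class_RR :: "(real \<Rightarrow> real) set" where
  "class_RR = (\<Union>\<beta>\<in>{0<..}. class_R \<beta>) \<union> class_R_infinity"

definition mgf :: "(real \<Rightarrow> real) \<Rightarrow> real \<Rightarrow> real" where
  "mgf p t = (LBINT x:{0..}. exp (t * x) * p x)"

definition tilt_mean :: "(real \<Rightarrow> real) \<Rightarrow> real \<Rightarrow> real" where
  "tilt_mean p = deriv (\<lambda>t. ln (mgf p t))"

definition tilt_sd :: "(real \<Rightarrow> real) \<Rightarrow> real \<Rightarrow> real" where
  "tilt_sd p t = sqrt (deriv (tilt_mean p) t)"

definition tilt_mu3 :: "(real \<Rightarrow> real) \<Rightarrow> real \<Rightarrow> real" where
  "tilt_mu3 p = (deriv ^^ 3) (\<lambda>t. ln (mgf p t))"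

definition tilted :: "(real \<Rightarrow> real) \<Rightarrow> real \<Rightarrow> real \<Rightarrow> real" where
  "tilted p t x = exp (t * x) * p x / mgf p t"

text \<open>The centring \<open>a\<close> is a separate argument; it is used with \<open>tilt_mean p t = a\<close>.\<close>

definition normalized_tilted :: "(real \<Rightarrow> real) \<Rightarrow> real \<Rightarrow> real \<Rightarrow> real \<Rightarrow> real" where
  "normalized_tilted p a t x = tilt_sd p t * tilted p t (tilt_sd p t * x + a)"

definition conv :: "(real \<Rightarrow> real) \<Rightarrow> (real \<Rightarrow> real) \<Rightarrow> real \<Rightarrow> real" where
  "conv f k x = (LBINT y. f (x - y) * k y)"

text \<open>
  The \<open>n\<close>-fold convolution, as a pointwise defined function, for \<open>n \<ge> 1\<close>
  (\<open>conv_power f 1 = f\<close>); the value at \<open>n = 0\<close> is a dummy.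
\<close>

definition conv_power :: "(real \<Rightarrow> real) \<Rightarrow> nat \<Rightarrow> real \<Rightarrow> real" where
  "conv_power f n = (conv f ^^ (n - 1)) f"

definition rho :: "(real \<Rightarrow> real) \<Rightarrow> real \<Rightarrow> real \<Rightarrow> nat \<Rightarrow> real \<Rightarrow> real" where
  "rho p a t n x = sqrt (real n) * conv_power (normalized_tilted p a t) n (sqrt (real n) * x)"

end

theory Submission
  imports Defs
begin

text \<open>
  The statement combines an Edgeworth expansion that is uniform over a whole class of densities with
  a proof that the normalized tilted densities stay in one such class.

  The uniform expansion is \<open>edgeworth_expansion_uniform\<close>. Fix \<open>M\<close> and \<open>B\<close> and consider all
  densities \<open>f \<le> M\<close> with mean \<open>0\<close>, variance \<open>1\<close> and fourth moment at most \<open>B\<close>. Let \<open>\<xi>\<close> be the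
  characteristic function of \<open>f\<close>. Boundedness of \<open>f\<close> makes \<open>\<xi>\<close> square integrable with
  \<open>\<integral>\<bar>\<xi>\<bar>\<^sup>2 \<le> 2\<pi>M\<close> (\<open>plancherel_bound\<close>), so \<open>\<xi>^n\<close> is integrable and the \<open>n\<close>-fold convolution is given
  at every point by Fourier inversion (\<open>conv_power_inversion\<close>). The corrected normal density is the
  inverse transform of \<open>exp (-\<theta>\<^sup>2/2) (1 - i \<gamma> \<theta>^3 / (6 \<surd>n))\<close>, where \<open>\<gamma>\<close> is the third moment, and
  the difference of two inverse transforms is at most the \<open>L\<^sup>1\<close> distance of the transforms. For
  \<open>\<bar>\<theta>\<bar> \<le> \<delta>\<surd>n\<close> that distance is \<open>O(1/n)\<close> by a Taylor expansion (\<open>edgeworth_central\<close>). For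
  \<open>\<bar>\<theta>\<bar> \<ge> \<delta>\<surd>n\<close> the bound on \<open>f\<close> prevents the mass from sitting close to an arithmetic progression,
  hence \<open>\<bar>\<xi>\<bar> \<le> \<eta> < 1\<close> off \<open>(-\<delta>, \<delta>)\<close> with \<open>\<eta>\<close> depending on \<open>M\<close> and \<open>\<delta>\<close> only
  (\<open>char_bounded_away_from_one\<close>), and the integral of \<open>\<bar>\<xi>(\<theta>/\<surd>n)\<bar>^n\<close> over this range is at most
  \<open>\<eta>^(n-2) \<surd>n 2\<pi>M\<close>, which is exponentially small.

  The tilted densities are controlled by convexity (\<open>tilted_laplace_bound\<close>). In both classes \<open>h\<close>
  is eventually nondecreasing, so \<open>g\<close> is convex on some \<open>[X, \<infinity>)\<close>, and \<open>\<bar>q\<bar> \<le> 1\<close> there. Let \<open>G\<close> be the convex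
  function that equals \<open>g\<close> on \<open>[X, \<infinity>)\<close> and its tangent at \<open>X\<close> to the left of \<open>X\<close>. Then
  \<open>p \<le> c1 exp (-G)\<close> on \<open>[0, \<infinity>)\<close> and \<open>p \<ge> c2 exp (-G)\<close> on \<open>[X, \<infinity>)\<close>, while \<open>exp (t x - G x)\<close> puts at
  least half of its mass on \<open>[X, \<infinity>)\<close> once \<open>t\<close> is large. So the tilted density is at most a constant
  times a log-concave density, and the constant is the same for all large \<open>t\<close>. A log-concave density
  with maximum \<open>H\<close> attained at \<open>x0\<close> is at most \<open>e H exp (-H \<bar>x - x0\<bar> / e)\<close>: its only scale is \<open>1/H\<close>.
  After standardization, unit variance forces this scale to be comparable to \<open>1\<close>, which gives
  \<open>M\<close> and \<open>B\<close> valid for all large \<open>t\<close> (\<open>standardized_of_laplace_bound\<close>).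

  Finally, \<open>tilt_mean p\<close> is nondecreasing and \<open>a n\<close> tends to infinity, so \<open>t n\<close> eventually exceeds any
  given bound.
\<close>

section \<open>Bounded densities and their convolutions\<close>

definition bounded_density :: "real \<Rightarrow> (real \<Rightarrow> real) \<Rightarrow> bool" where
  "bounded_density M f \<longleftrightarrow> f \<in> borel_measurable borel \<and> (\<forall>x. 0 \<le> f x \<and> f x \<le> M) \<and>
     integrable lborel f \<and> (LBINT x. f x) = 1"

definition law :: "(real \<Rightarrow> real) \<Rightarrow> real measure" where
  "law f = density lborel (\<lambda>x. ennreal (f x))"

lemma bounded_densityD:
  assumes "bounded_density M f"
  shows "f \<in> borel_measurable borel" "0 \<le> f x" "f x \<le> M" "integrable lborel f" "(LBINT x. f x) = 1"
  using assms by (auto simp: bounded_density_def)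

lemma sets_law [simp, measurable_cong]: "sets (law f) = sets borel"
  by (simp add: law_def)

lemma space_law [simp]: "space (law f) = UNIV"
  by (simp add: law_def)

lemma real_distribution_law:
  assumes "bounded_density M f" shows "real_distribution (law f)"
proof -
  note f = bounded_densityD[OF assms]
  have "(\<integral>\<^sup>+x. ennreal (f x) \<partial>lborel) = 1"
    using f by (subst nn_integral_eq_integral) auto
  then have "emeasure (law f) (space (law f)) = 1"
    using f(1) by (simp add: law_def emeasure_density)
  then interpret prob_space "law f" by (rule prob_spaceI)
  show ?thesis by unfold_locales auto
qed

lemma integral_law:
  fixes u :: "real \<Rightarrow> 'a::{banach, second_countable_topology}"
  assumes "f \<in> borel_measurable borel" "\<And>x. 0 \<le> f x" "u \<in> borel_measurable borel"
  shows "integral\<^sup>L (law f) u = (LBINT x. f x *\<^sub>R u x)"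
  unfolding law_def using assms by (subst integral_density) auto

lemma integrable_law:
  fixes u :: "real \<Rightarrow> 'a::{banach, second_countable_topology}"
  assumes "f \<in> borel_measurable borel" "\<And>x. 0 \<le> f x" "u \<in> borel_measurable borel"
  shows "integrable (law f) u \<longleftrightarrow> integrable lborel (\<lambda>x. f x *\<^sub>R u x)"
  unfolding law_def using assms by (subst integrable_density) auto

lemma char_law:
  assumes "bounded_density M f"
  shows "char (law f) z = (CLBINT x. f x *\<^sub>R iexp (z * x))"
  unfolding char_def using bounded_densityD[OF assms] by (subst integral_law) auto

lemma conv_eq_law:
  assumes "bounded_density M f" "bounded_density N k"
  shows "conv f k x = (LINT y|law k. f (x - y))"
proof -
  note [measurable] = bounded_densityD(1)[OF assms(1)]
  show ?thesis
    unfolding conv_def using bounded_densityD[OF assms(1)] bounded_densityD[OF assms(2)]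
    by (subst integral_law) (auto simp: mult.commute)
qed

text \<open>
  The pointwise convolution integral always converges because \<open>f\<close> is bounded; this identifies it, at
  the level of measures, with the convolution of the two laws.
\<close>
lemma law_conv:
  assumes F: "bounded_density M f" and K: "bounded_density N k"
  shows "bounded_density M (conv f k)" "law (conv f k) = convolution (law f) (law k)"
proof -
  note f = bounded_densityD[OF F] and k = bounded_densityD[OF K]
  note [measurable] = f(1) k(1)
  interpret f: real_distribution "law f" by (rule real_distribution_law[OF F])
  interpret k: real_distribution "law k" by (rule real_distribution_law[OF K])
  have int: "integrable (law k) (\<lambda>y. f (x - y))" for x
    by (rule k.integrable_const_bound[where B=M]) (auto simp: f)
  have nn: "(\<integral>\<^sup>+y. ennreal (f (x - y)) * ennreal (k y) \<partial>lborel) = ennreal (conv f k x)" for x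
  proof -
    have i: "integrable lborel (\<lambda>y. f (x - y) * k y)"
      using int[of x] by (subst (asm) integrable_law) (auto simp: k mult.commute)
    have "(\<integral>\<^sup>+y. ennreal (f (x - y)) * ennreal (k y) \<partial>lborel) = (\<integral>\<^sup>+y. ennreal (f (x - y) * k y) \<partial>lborel)"
      by (intro nn_integral_cong) (simp add: ennreal_mult f k)
    also have "\<dots> = ennreal (conv f k x)"
      unfolding conv_def using i by (intro nn_integral_eq_integral) (auto simp: f k)
    finally show ?thesis .
  qed
  show law: "law (conv f k) = convolution (law f) (law k)"
    unfolding law_def
    by (subst convolution_density)
      (auto simp: nn f.finite_measure_axioms[unfolded law_def] k.finite_measure_axioms[unfolded law_def])
  have m: "conv f k \<in> borel_measurable borel"
    unfolding conv_def by measurable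
  have pos: "0 \<le> conv f k x" for x
    unfolding conv_def by (intro integral_nonneg_AE) (auto simp: f k)
  have le: "conv f k x \<le> M" for x
  proof -
    have "conv f k x \<le> (LINT y|law k. M)"
      unfolding conv_eq_law[OF F K] by (intro integral_mono int) (auto simp: f)
    also have "\<dots> = M" using k.prob_space by simp
    finally show ?thesis .
  qed
  interpret fk: pair_prob_space "law f" "law k" ..
  have "prob_space (convolution (law f) (law k))"
    unfolding convolution_def by (intro fk.prob_space_distr) measurable
  then have "emeasure (law (conv f k)) UNIV = 1"
    using prob_space.emeasure_space_1 law by fastforce
  then have 1: "(\<integral>\<^sup>+x. ennreal (conv f k x) \<partial>lborel) = 1"
    using m by (simp add: law_def emeasure_density)
  then have "integrable lborel (conv f k)"
    by (intro integrableI_nn_integral_finite[where x=1]) (auto simp: m pos)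
  moreover have "(LBINT x. conv f k x) = 1"
    using 1 m pos by (simp add: integral_eq_nn_integral)
  ultimately show "bounded_density M (conv f k)"
    by (simp add: bounded_density_def m pos le)
qed

lemma char_convolution:
  assumes "real_distribution P" "real_distribution Q"
  shows "char (convolution P Q) z = char P z * char Q z"
proof -
  interpret P: real_distribution P by fact
  interpret Q: real_distribution Q by fact
  interpret PQ: pair_prob_space P Q ..
  have i: "integrable (P \<Otimes>\<^sub>M Q) (\<lambda>(x, y). iexp (z * x) * iexp (z * y))"
    by (rule PQ.P.integrable_const_bound[where B=1]) (auto simp: norm_mult)
  have "char (convolution P Q) z = (CLINT w|P \<Otimes>\<^sub>M Q. iexp (z * (fst w + snd w)))"
    unfolding char_def convolution_def by (subst integral_distr) (auto simp: case_prod_beta)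
  also have "\<dots> = (CLINT w|P \<Otimes>\<^sub>M Q. (case w of (x, y) \<Rightarrow> iexp (z * x) * iexp (z * y)))"
    by (intro Bochner_Integration.integral_cong) (auto simp: exp_add algebra_simps case_prod_beta)
  also have "\<dots> = (CLINT x|P. CLINT y|Q. iexp (z * x) * iexp (z * y))"
    using PQ.integral_fst'[OF i] by simp
  also have "\<dots> = char P z * char Q z"
    unfolding char_def by simp
  finally show ?thesis .
qed

lemma char_law_conv:
  assumes "bounded_density M f" "bounded_density N k"
  shows "char (law (conv f k)) z = char (law f) z * char (law k) z"
  using law_conv(2)[OF assms] char_convolution[OF real_distribution_law[OF assms(1)] real_distribution_law[OF assms(2)]]
  by simp

lemma conv_power_Suc:
  assumes "n \<ge> 1" shows "conv_power f (Suc n) = conv f (conv_power f n)"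
  using assms by (cases n) (auto simp: conv_power_def)

lemma conv_power_law:
  assumes F: "bounded_density M f" and n: "n \<ge> 1"
  shows "bounded_density M (conv_power f n) \<and> char (law (conv_power f n)) z = char (law f) z ^ n"
  using n
proof (induction n rule: dec_induct)
  case base
  then show ?case using F by (simp add: conv_power_def)
next
  case (step n)
  then show ?case
    using law_conv(1)[OF F, of M "conv_power f n"] char_law_conv[OF F, of M "conv_power f n"]
    by (simp add: conv_power_Suc)
qed

section \<open>Fourier inversion and the Plancherel bound\<close>

lemma gaussian_fourier:
  fixes \<sigma> x :: real
  assumes "\<sigma> > 0"
  shows "(CLBINT z. iexp (x * z) * exp (- (\<sigma> * z)\<^sup>2 / 2)) = 2 * pi * normal_density 0 \<sigma> x"
proof -
  have "exp (- (x / \<sigma>)\<^sup>2 / 2) = char std_normal_distribution (x / \<sigma>)"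
    by (simp add: char_std_normal_distribution)
  also have "\<dots> = (CLBINT y. std_normal_density y *\<^sub>R iexp (x / \<sigma> * y))"
    unfolding char_def by (subst integral_density) auto
  also have "\<dots> = (CLBINT z. \<bar>\<sigma>\<bar> *\<^sub>R (std_normal_density (\<sigma> * z) *\<^sub>R iexp (x / \<sigma> * (\<sigma> * z))))"
    using assms by (subst lborel_integral_real_affine[where c=\<sigma> and t=0])
      (auto simp flip: integral_scaleR_right)
  also have "\<dots> = (CLBINT z. of_real (\<sigma> / sqrt (2 * pi)) * (iexp (x * z) * exp (- (\<sigma> * z)\<^sup>2 / 2)))"
    using assms by (intro Bochner_Integration.integral_cong)
       (auto simp: std_normal_density_def scaleR_conv_of_real exp_of_real[symmetric])
  also have "\<dots> = of_real (\<sigma> / sqrt (2 * pi)) * (CLBINT z. iexp (x * z) * exp (- (\<sigma> * z)\<^sup>2 / 2))"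
    by (rule integral_mult_right_zero)
  finally have *: "of_real (\<sigma> / sqrt (2 * pi)) * (CLBINT z. iexp (x * z) * exp (- (\<sigma> * z)\<^sup>2 / 2))
     = complex_of_real (exp (- (x / \<sigma>)\<^sup>2 / 2))" by simp
  have "2 * pi * normal_density 0 \<sigma> x = sqrt (2 * pi) / \<sigma> * exp (- (x / \<sigma>)\<^sup>2 / 2)"
  proof -
    have "sqrt (2 * pi * \<sigma>\<^sup>2) = sqrt (2 * pi) * \<sigma>" using assms by (simp add: real_sqrt_mult)
    moreover have "2 * pi = sqrt (2 * pi) * sqrt (2 * pi)" by simp
    ultimately show ?thesis using assms
      unfolding normal_density_def by (simp add: field_simps power_divide)
  qed
  then have "complex_of_real (2 * pi * normal_density 0 \<sigma> x) =
     of_real (sqrt (2 * pi) / \<sigma>) * complex_of_real (exp (- (x / \<sigma>)\<^sup>2 / 2))"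
    by (metis of_real_mult)
  also have "\<dots> = of_real (sqrt (2 * pi) / \<sigma>) * (of_real (\<sigma> / sqrt (2 * pi)) * (CLBINT z. iexp (x * z) * exp (- (\<sigma> * z)\<^sup>2 / 2)))"
    by (simp only: *)
  also have "\<dots> = (CLBINT z. iexp (x * z) * exp (- (\<sigma> * z)\<^sup>2 / 2))"
    unfolding mult.assoc[symmetric] of_real_mult[symmetric] using assms by simp
  finally show ?thesis by simp
qed

lemma integrable_gaussian:
  fixes \<sigma> :: real assumes "\<sigma> > 0"
  shows "integrable lborel (\<lambda>z. exp (- (\<sigma> * z)\<^sup>2 / 2))"
proof -
  have "integrable lborel (\<lambda>z. sqrt (2 * pi * (1/\<sigma>)\<^sup>2) * normal_density 0 (1/\<sigma>) z)"
    using assms by simp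
  also have "(\<lambda>z. sqrt (2 * pi * (1/\<sigma>)\<^sup>2) * normal_density 0 (1/\<sigma>) z) = (\<lambda>z. exp (- (\<sigma> * z)\<^sup>2 / 2))"
    using assms by (auto simp: normal_density_def fun_eq_iff field_simps power_mult_distrib)
  finally show ?thesis .
qed

text \<open>
  Parseval's identity against a Gaussian: after Fubini, the weight turns into its own transform,
  which is a normal density up to the factor \<open>2\<pi>\<close>.
\<close>
lemma gaussian_weighted_char:
  fixes \<sigma> :: real
  assumes K: "bounded_density M k" and \<sigma>: "\<sigma> > 0"
  shows "(CLBINT z. char (law k) z * exp (- (\<sigma> * z)\<^sup>2 / 2)) = of_real (LBINT x. k x * (2 * pi * normal_density 0 \<sigma> x))"
proof -
  note k = bounded_densityD[OF K]
  interpret k: real_distribution "law k" by (rule real_distribution_law[OF K])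
  interpret P: pair_sigma_finite lborel "law k" ..
  define e where "e z = exp (- (\<sigma> * z)\<^sup>2 / 2)" for z :: real
  have [measurable]: "e \<in> borel_measurable borel" unfolding e_def by measurable
  have ei: "integrable lborel e" unfolding e_def by (rule integrable_gaussian[OF \<sigma>])
  have e0: "0 \<le> e z" for z by (simp add: e_def)
  have int: "integrable (lborel \<Otimes>\<^sub>M law k) (\<lambda>(z, x). iexp (z * x) * e z)"
  proof (rule P.Fubini_integrable)
    have "(LINT x|law k. norm (case (z, x) of (z, x) \<Rightarrow> iexp (z * x) * e z)) = e z" for z
      using k.prob_space by (simp add: norm_mult e0)
    then show "integrable lborel (\<lambda>z. LINT x|law k. norm (case (z, x) of (z, x) \<Rightarrow> iexp (z * x) * e z))"
      using ei by simp
    show "AE z in lborel. integrable (law k) (\<lambda>x. case (z, x) of (z, x) \<Rightarrow> iexp (z * x) * e z)"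
      by (intro AE_I2 k.integrable_const_bound[where B="e z" for z]) (auto simp: norm_mult e0)
  qed measurable
  have "(CLBINT z. char (law k) z * e z) = (CLBINT z. (CLINT x|law k. iexp (z * x) * e z))"
    unfolding char_def by simp
  also have "\<dots> = (CLINT x|law k. (CLBINT z. iexp (z * x) * e z))"
    using P.Fubini_integral[OF int] by simp
  also have "\<dots> = (CLINT x|law k. of_real (2 * pi * normal_density 0 \<sigma> x))"
    using gaussian_fourier[OF \<sigma>] by (simp add: e_def mult.commute)
  also have "\<dots> = of_real (LINT x|law k. 2 * pi * normal_density 0 \<sigma> x)"
    by (rule integral_complex_of_real)
  also have "(LINT x|law k. 2 * pi * normal_density 0 \<sigma> x) = (LBINT x. k x * (2 * pi * normal_density 0 \<sigma> x))"
    using k by (subst integral_law) auto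
  finally show ?thesis by (simp add: e_def)
qed

text \<open>
  The Gaussian average of \<open>k \<le> M\<close> is at most \<open>M\<close>, which bounds every Gaussian-weighted integral of a
  nonnegative characteristic function; Fatou's lemma removes the weight.
\<close>
lemma nonneg_char_integral_le:
  assumes K: "bounded_density M k"
    and r: "\<And>z. char (law k) z = of_real (r z)" "\<And>z. 0 \<le> r z"
  shows "(\<integral>\<^sup>+z. ennreal (r z) \<partial>lborel) \<le> ennreal (2 * pi * M)"
proof -
  note k = bounded_densityD[OF K]
  interpret k: real_distribution "law k" by (rule real_distribution_law[OF K])
  have r_eq: "r = (\<lambda>z. Re (char (law k) z))" using r(1) by (auto simp: fun_eq_iff)
  have rm [measurable]: "r \<in> borel_measurable borel" unfolding r_eq by measurable
  have r1: "r z \<le> 1" for z using k.cmod_char_le_1[of z] r by (simp add: abs_of_nonneg)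
  \<comment> \<open>Gaussian weights that increase to \<open>1\<close>.\<close>
  define e where "e (j::nat) z = exp (- (1 / Suc j * z)\<^sup>2 / 2)" for j and z :: real
  have [measurable]: "e j \<in> borel_measurable borel" for j unfolding e_def by measurable
  have le: "(\<integral>\<^sup>+z. ennreal (r z * e j z) \<partial>lborel) \<le> ennreal (2 * pi * M)" for j
  proof -
    define \<sigma> where "\<sigma> = 1 / real (Suc j)"
    have \<sigma>: "\<sigma> > 0" by (simp add: \<sigma>_def)
    have e: "e j z = exp (- (\<sigma> * z)\<^sup>2 / 2)" for z by (simp add: e_def \<sigma>_def)
    have int: "integrable lborel (\<lambda>z. r z * e j z)"
      by (rule Bochner_Integration.integrable_bound[OF integrable_gaussian[OF \<sigma>]])
         (use r r1 in \<open>auto simp: e mult_left_le_one_le\<close>)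
    have "complex_of_real (LBINT z. r z * e j z) = (CLBINT z. char (law k) z * e j z)"
      by (simp add: r flip: integral_complex_of_real)
    also have "\<dots> = of_real (LBINT x. k x * (2 * pi * normal_density 0 \<sigma> x))"
      unfolding e by (rule gaussian_weighted_char[OF K \<sigma>])
    finally have "(LBINT z. r z * e j z) = (LBINT x. k x * (2 * pi * normal_density 0 \<sigma> x))"
      by (simp only: of_real_eq_iff)
    also have "\<dots> \<le> (LBINT x. M * (2 * pi * normal_density 0 \<sigma> x))"
    proof (rule integral_mono)
      show "integrable lborel (\<lambda>x. M * (2 * pi * normal_density 0 \<sigma> x))" using \<sigma> by simp
      show *: "k x * (2 * pi * normal_density 0 \<sigma> x) \<le> M * (2 * pi * normal_density 0 \<sigma> x)" for x
        using k by (intro mult_right_mono) auto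
      show "integrable lborel (\<lambda>x. k x * (2 * pi * normal_density 0 \<sigma> x))"
      proof (rule Bochner_Integration.integrable_bound[OF \<open>integrable lborel (\<lambda>x. M * (2 * pi * normal_density 0 \<sigma> x))\<close>])
        have "0 \<le> k x * (2 * pi * normal_density 0 \<sigma> x)" for x using k(2) by simp
        then have "norm (k x * (2 * pi * normal_density 0 \<sigma> x)) \<le> norm (M * (2 * pi * normal_density 0 \<sigma> x))" for x
          using *[of x] by (metis abs_ge_self abs_of_nonneg order_trans real_norm_def)
        then show "AE x in lborel. norm (k x * (2 * pi * normal_density 0 \<sigma> x)) \<le> norm (M * (2 * pi * normal_density 0 \<sigma> x))"
          by (intro AE_I2)
      qed (use k(1) in measurable)
    qed
    also have "\<dots> = 2 * pi * M" using \<sigma> by simp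
    finally show ?thesis
      using int r by (subst nn_integral_eq_integral) (auto simp: e intro!: ennreal_leI)
  qed
  have lim: "(\<lambda>j. r z * e j z) \<longlonglongrightarrow> r z" for z
  proof -
    have "(\<lambda>j. r z * exp (- (1 / Suc j * z)\<^sup>2 / 2)) \<longlonglongrightarrow> r z * exp (- (0 * z)\<^sup>2 / 2)"
      by (intro tendsto_intros LIMSEQ_Suc[OF lim_1_over_n]) auto
    then show ?thesis by (simp add: e_def)
  qed
  have "(\<integral>\<^sup>+z. ennreal (r z) \<partial>lborel) = (\<integral>\<^sup>+z. liminf (\<lambda>j. ennreal (r z * e j z)) \<partial>lborel)"
    using lim_imp_Liminf[OF _ tendsto_ennrealI[OF lim]] by (intro nn_integral_cong) auto
  also have "\<dots> \<le> liminf (\<lambda>j. \<integral>\<^sup>+z. ennreal (r z * e j z) \<partial>lborel)"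
    by (intro nn_integral_liminf) measurable
  also have "\<dots> \<le> limsup (\<lambda>j. \<integral>\<^sup>+z. ennreal (r z * e j z) \<partial>lborel)"
    by (intro Liminf_le_Limsup) auto
  also have "\<dots> \<le> ennreal (2 * pi * M)"
    by (intro Limsup_bounded) (auto simp: le)
  finally show ?thesis .
qed

text \<open>
  Symmetrization: \<open>\<bar>\<xi>\<bar>\<^sup>2\<close> is the characteristic function of the difference of two independent copies,
  whose density is again bounded by \<open>M\<close>.
\<close>
lemma plancherel_bound:
  assumes F: "bounded_density M f"
  shows "integrable lborel (\<lambda>z. (norm (char (law f) z))\<^sup>2)"
    "(LBINT z. (norm (char (law f) z))\<^sup>2) \<le> 2 * pi * M"
proof -
  note f = bounded_densityD[OF F]
  note [measurable] = f(1)
  interpret f: real_distribution "law f" by (rule real_distribution_law[OF F])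
  define f' where "f' x = f (- x)" for x
  have F': "bounded_density M f'"
    unfolding bounded_density_def
  proof (intro conjI)
    show "integrable lborel f'"
      using lborel_integrable_real_affine[OF f(4), where c="-1" and t=0] by (simp add: f'_def[abs_def])
    show "(LBINT x. f' x) = 1"
      using lborel_integral_real_affine[where f=f and c="-1" and t=0] f(5) by (simp add: f'_def[abs_def])
    show "f' \<in> borel_measurable borel" unfolding f'_def[abs_def] by measurable
  qed (auto simp: f'_def f)
  have c': "char (law f') z = cnj (char (law f) z)" for z
  proof -
    have "char (law f') z = (CLBINT x. f' x *\<^sub>R iexp (z * x))"
      by (rule char_law[OF F'])
    also have "\<dots> = (CLBINT x. f x *\<^sub>R iexp (z * - x))"
      by (subst lborel_integral_real_affine[where c="-1" and t=0]) (auto simp: f'_def)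
    also have "\<dots> = (CLBINT x. cnj (f x *\<^sub>R iexp (z * x)))"
      by (intro Bochner_Integration.integral_cong) (auto simp: exp_cnj)
    also have "\<dots> = cnj (char (law f) z)"
      unfolding char_law[OF F] by (rule Bochner_Integration.integral_cnj)
    finally show ?thesis .
  qed
  have sq: "char (law (conv f f')) z = of_real ((norm (char (law f) z))\<^sup>2)" for z
    unfolding char_law_conv[OF F F'] c' by (rule complex_norm_square[symmetric])
  have le: "(\<integral>\<^sup>+z. ennreal ((norm (char (law f) z))\<^sup>2) \<partial>lborel) \<le> ennreal (2 * pi * M)"
    by (rule nonneg_char_integral_le[OF law_conv(1)[OF F F'] sq]) simp
  show i: "integrable lborel (\<lambda>z. (norm (char (law f) z))\<^sup>2)"
    using le by (intro integrableI_bounded) (auto intro: le_less_trans)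
  have "0 \<le> M" using f(2,3) order_trans by blast
  then show "(LBINT z. (norm (char (law f) z))\<^sup>2) \<le> 2 * pi * M"
    using le by (subst (asm) nn_integral_eq_integral[OF i]) auto
qed

definition inverse_fourier :: "(real \<Rightarrow> complex) \<Rightarrow> real \<Rightarrow> complex" where
  "inverse_fourier \<xi> x = (1 / (2 * pi)) * (CLBINT z. iexp (- (z * x)) * \<xi> z)"

lemma integrable_iexp_mult:
  fixes \<xi> :: "real \<Rightarrow> complex"
  assumes "integrable lborel \<xi>"
  shows "integrable lborel (\<lambda>z. iexp (- (z * x)) * \<xi> z)"
proof -
  have [measurable]: "\<xi> \<in> borel_measurable borel" using assms by (simp add: borel_measurable_integrable)
  show ?thesis
    by (rule Bochner_Integration.integrable_bound[OF assms]) (auto simp: norm_mult)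
qed

lemma isCont_inverse_fourier:
  assumes "integrable lborel \<xi>"
  shows "isCont (inverse_fourier \<xi>) x"
proof -
  have [measurable]: "\<xi> \<in> borel_measurable borel" using assms by (simp add: borel_measurable_integrable)
  have "isCont (\<lambda>x. CLBINT z. iexp (- (z * x)) * \<xi> z) x"
    unfolding continuous_at_sequentially comp_def
  proof safe
    fix X :: "nat \<Rightarrow> real" assume X: "X \<longlonglongrightarrow> x"
    show "(\<lambda>n. CLBINT z. iexp (- (z * X n)) * \<xi> z) \<longlonglongrightarrow> (CLBINT z. iexp (- (z * x)) * \<xi> z)"
      by (rule integral_dominated_convergence[where w="\<lambda>z. norm (\<xi> z)"])
        (auto simp: norm_mult assms intro!: tendsto_intros X)
  qed
  then show ?thesis
    unfolding inverse_fourier_def by (intro continuous_intros)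
qed

text \<open>
  For an integrable characteristic function the principal value in Levy's inversion formula is an
  absolutely convergent integral, and \<open>(exp (-i t a) - exp (-i t b)) / (i t)\<close> is the integral of
  \<open>exp (-i t x)\<close> over \<open>{a<..b}\<close>.
\<close>
lemma levy_interval_inversion:
  fixes a b :: real
  assumes N: "real_distribution N" and int: "integrable lborel (char N)"
    and atom: "\<And>x. measure N {x} = 0" and ab: "a \<le> b"
  shows "complex_of_real (measure N {a<..b}) = (CLBINT x. indicator {a<..b} x *\<^sub>R inverse_fourier (char N) x)"
proof -
  interpret N: real_distribution N by fact
  let ?\<phi> = "char N"
  define F where "F t = (iexp (-(t * a)) - iexp (-(t * b))) / (\<i> * complex_of_real t)" for t :: real
  have [measurable]: "F \<in> borel_measurable borel" unfolding F_def by measurable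
  have F_bd: "norm (F t) \<le> b - a" for t
  proof (cases "t = 0")
    case False
    then show ?thesis using Levy_Inversion_aux2[of "-b" "-a" t] ab by (simp add: F_def)
  qed (use ab in \<open>simp add: F_def\<close>)
  have dom: "norm (F t * ?\<phi> t) \<le> norm ((b - a) *\<^sub>R ?\<phi> t)" for t
    using F_bd ab by (simp add: norm_mult mult_right_mono)
  have lim1: "(\<lambda>T::nat. CLBINT t=-real T..real T. F t * ?\<phi> t) \<longlonglongrightarrow> (CLBINT t. F t * ?\<phi> t)"
  proof -
    have "(\<lambda>T::nat. CLBINT t. indicator {-real T<..<real T} t *\<^sub>R (F t * ?\<phi> t)) \<longlonglongrightarrow> (CLBINT t. F t * ?\<phi> t)"
    proof (rule integral_dominated_convergence[where w="\<lambda>t. norm ((b - a) *\<^sub>R ?\<phi> t)"])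
      show "integrable lborel (\<lambda>t. norm ((b - a) *\<^sub>R ?\<phi> t))" using int by simp
      show "AE t in lborel. (\<lambda>T. indicator {-real T<..<real T} t *\<^sub>R (F t * ?\<phi> t)) \<longlonglongrightarrow> F t * ?\<phi> t"
      proof (intro AE_I2 tendsto_eventually)
        fix t :: real
        obtain n :: nat where n: "\<bar>t\<bar> < n" using reals_Archimedean2 by blast
        show "\<forall>\<^sub>F T in sequentially. indicator {-real T<..<real T} t *\<^sub>R (F t * ?\<phi> t) = F t * ?\<phi> t"
          using eventually_ge_at_top[of n]
        proof eventually_elim
          case (elim T)
          then have "real n \<le> real T" by simp
          then have "t \<in> {-real T<..<real T}" using n by auto
          then show ?case by simp
        qed
      qed
      show "AE t in lborel. norm (indicator {-real T<..<real T} t *\<^sub>R (F t * ?\<phi> t)) \<le> norm ((b - a) *\<^sub>R ?\<phi> t)" for T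
        using dom by (intro AE_I2) (auto simp: indicator_def simp del: norm_scaleR)
    qed measurable
    then show ?thesis
      by (simp add: interval_lebesgue_integral_def set_lebesgue_integral_def)
  qed
  have "(\<lambda>T::nat. 1 / (2 * pi) * (CLBINT t=-real T..real T. F t * ?\<phi> t)) \<longlonglongrightarrow> complex_of_real (measure N {a<..b})"
    using N.Levy_Inversion[OF ab atom atom] by (simp add: F_def)
  moreover have "(\<lambda>T::nat. 1 / (2 * pi) * (CLBINT t=-real T..real T. F t * ?\<phi> t)) \<longlonglongrightarrow> 1 / (2 * pi) * (CLBINT t. F t * ?\<phi> t)"
    by (intro tendsto_intros lim1)
  ultimately have eq: "complex_of_real (measure N {a<..b}) = 1 / (2 * pi) * (CLBINT t. F t * ?\<phi> t)"
    by (rule LIMSEQ_unique)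
  have Feq: "(CLBINT x. indicator {a<..b} x *\<^sub>R iexp (-(t * x))) = F t" if "t \<noteq> 0" for t
  proof -
    have "(CLBINT x. indicator {a..b} x *\<^sub>R iexp (-(t * x))) = \<i> / t * iexp (- (t * b)) - \<i> / t * iexp (- (t * a))"
    proof (rule integral_FTC_atLeastAtMost[OF ab])
      show "((\<lambda>x. \<i> / t * iexp (-(t * x))) has_vector_derivative iexp (-(t * x))) (at x within {a..b})" for x
      proof -
        have "((\<lambda>w. \<i> / t * exp (- (\<i> * (t * w)))) has_field_derivative exp (- (\<i> * (t * x)))) (at (complex_of_real x))"
          using that by (auto intro!: derivative_eq_intros simp: field_simps)
        then show ?thesis
          using has_vector_derivative_real_field[of "\<lambda>w. \<i> / t * exp (- (\<i> * (t * w)))"] by simp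
      qed
      show "continuous_on {a..b} (\<lambda>x. iexp (-(t * x)))" by (intro continuous_intros)
    qed
    also have "(CLBINT x. indicator {a..b} x *\<^sub>R iexp (-(t * x))) = (CLBINT x. indicator {a<..b} x *\<^sub>R iexp (-(t * x)))"
      by (intro integral_cong_AE AE_I[where N="{a}"]) (auto simp: indicator_def)
    also have "\<i> / t * iexp (- (t * b)) - \<i> / t * iexp (- (t * a)) = F t"
      using that by (simp add: F_def field_simps)
    finally show ?thesis .
  qed
  have pint: "integrable (lborel \<Otimes>\<^sub>M lborel) (\<lambda>(t, x). indicator {a<..b} x *\<^sub>R iexp (-(t * x)) * ?\<phi> t)"
  proof (rule lborel_pair.Fubini_integrable)
    have "(\<integral>x. norm (case (t, x) of (t, x) \<Rightarrow> indicator {a<..b} x *\<^sub>R iexp (-(t * x)) * ?\<phi> t) \<partial>lborel)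
       = (LBINT x. indicator {a<..b} x * norm (?\<phi> t))" for t
      by (intro Bochner_Integration.integral_cong) (auto simp: norm_mult)
    then show "integrable lborel (\<lambda>t. \<integral>x. norm (case (t, x) of (t, x) \<Rightarrow> indicator {a<..b} x *\<^sub>R iexp (-(t * x)) * ?\<phi> t) \<partial>lborel)"
      using int by simp
    show "AE t in lborel. integrable lborel (\<lambda>x. case (t, x) of (t, x) \<Rightarrow> indicator {a<..b} x *\<^sub>R iexp (-(t * x)) * ?\<phi> t)"
    proof (intro AE_I2)
      fix t
      have "integrable lborel (\<lambda>x. indicator {a<..b} x *\<^sub>R norm (?\<phi> t))" by (simp add: ab)
      then show "integrable lborel (\<lambda>x. case (t, x) of (t, x) \<Rightarrow> indicator {a<..b} x *\<^sub>R iexp (-(t * x)) * ?\<phi> t)"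
        by (rule Bochner_Integration.integrable_bound) (auto simp: norm_mult)
    qed
  qed measurable
  have "(CLBINT t. F t * ?\<phi> t) = (CLBINT t. CLBINT x. indicator {a<..b} x *\<^sub>R iexp (-(t * x)) * ?\<phi> t)"
  proof (intro integral_cong_AE AE_I[where N="{0}"])
    have "F t * ?\<phi> t = (CLBINT x. indicator {a<..b} x *\<^sub>R iexp (-(t * x)) * ?\<phi> t)" if "t \<noteq> 0" for t
      unfolding Feq[OF that, symmetric] by (rule integral_mult_left_zero[symmetric])
    then show "{t \<in> space lborel. F t * ?\<phi> t \<noteq> (CLBINT x. indicator {a<..b} x *\<^sub>R iexp (-(t * x)) * ?\<phi> t)} \<subseteq> {0}"
      by blast
  qed auto
  also have "\<dots> = (CLBINT x. CLBINT t. indicator {a<..b} x *\<^sub>R iexp (-(t * x)) * ?\<phi> t)"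
    using lborel_pair.Fubini_integral[OF pint] by simp
  finally show ?thesis
    unfolding eq inverse_fourier_def
    by (simp flip: integral_mult_right_zero)
qed

text \<open>
  The inverse transform is continuous and has nonnegative integrals over all intervals, so it is
  nonnegative; then it is the density because the two measures agree on half-lines.
\<close>
lemma char_inversion_density:
  assumes N: "real_distribution N" and int: "integrable lborel (char N)"
    and atom: "\<And>x. measure N {x} = 0"
  shows "N = density lborel (\<lambda>x. ennreal (Re (inverse_fourier (char N) x)))"
    and "0 \<le> Re (inverse_fourier (char N) x)"
proof -
  interpret N: real_distribution N by fact
  define W where "W x = Re (inverse_fourier (char N) x)" for x
  have cont: "isCont W x" for x
    unfolding W_def by (rule bounded_linear.isCont[OF bounded_linear_Re isCont_inverse_fourier[OF int]])
  have contV: "continuous_on S (inverse_fourier (char N))" for S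
    by (intro continuous_at_imp_continuous_on ballI isCont_inverse_fourier int)
  have contW: "continuous_on S W" for S
    by (intro continuous_at_imp_continuous_on ballI cont)
  have [measurable]: "W \<in> borel_measurable borel"
    by (intro borel_measurable_continuous_onI contW)
  have Vi: "integrable lborel (\<lambda>x. indicator {a<..b} x *\<^sub>R inverse_fourier (char N) x)" for a b :: real
  proof -
    have "{a<..b} \<subseteq> {a..b}" by auto
    then show ?thesis
      using set_integrable_subset[OF borel_integrable_atLeastAtMost'[OF contV], of "{a<..b}" a b]
      by (simp add: set_integrable_def)
  qed
  have Wi: "integrable lborel (\<lambda>x. indicator {a<..b} x * W x)" for a b :: real
    using integrable_Re[OF Vi[of a b]] by (simp add: W_def)
  have meas: "measure N {a<..b} = (LBINT x. indicator {a<..b} x * W x)" if "a \<le> b" for a b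
  proof -
    have "measure N {a<..b} = Re (CLBINT x. indicator {a<..b} x *\<^sub>R inverse_fourier (char N) x)"
      using levy_interval_inversion[OF N int atom that] by (metis Re_complex_of_real)
    also have "\<dots> = (LBINT x. Re (indicator {a<..b} x *\<^sub>R inverse_fourier (char N) x))"
      using Vi by (subst integral_Re) auto
    finally show ?thesis by (simp add: W_def)
  qed
  have W0: "0 \<le> W x" for x
  proof (rule ccontr)
    assume neg: "\<not> 0 \<le> W x"
    then have "\<forall>\<^sub>F y in at x. W y < W x / 2"
      using cont[of x] by (intro order_tendstoD) (auto simp: isCont_def)
    then obtain d where d: "d > 0" "\<And>y. y \<noteq> x \<Longrightarrow> dist y x < d \<Longrightarrow> W y < W x / 2"
      unfolding eventually_at by auto
    have "0 \<le> measure N {x<..x + d/2}" by simp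
    also have "\<dots> = (LBINT y. indicator {x<..x + d/2} y * W y)" using d by (intro meas) auto
    also have "\<dots> \<le> (LBINT y. indicator {x<..x + d/2} y * (W x / 2))"
    proof (rule integral_mono)
      show "integrable lborel (\<lambda>y. indicator {x<..x + d/2} y * (W x / 2))"
        using d(1) by (intro integrable_mult_left integrable_real_indicator) auto
      show "indicator {x<..x + d/2} y * W y \<le> indicator {x<..x + d/2} y * (W x / 2)" for y
        using d(1) d(2)[of y] by (cases "y \<in> {x<..x + d/2}") (auto simp: dist_real_def)
    qed (rule Wi)
    also have "\<dots> = W x / 2 * (d/2)" using d(1) by simp
    also have "\<dots> < 0" using neg d(1) by (intro mult_neg_pos) auto
    finally show False by simp
  qed
  have em: "emeasure N {a<..b} = emeasure (density lborel (\<lambda>x. ennreal (W x))) {a<..b}" if "a \<le> b" for a b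
  proof -
    have "emeasure (density lborel (\<lambda>x. ennreal (W x))) {a<..b} = (\<integral>\<^sup>+x. ennreal (W x) * indicator {a<..b} x \<partial>lborel)"
      by (simp add: emeasure_density)
    also have "\<dots> = (\<integral>\<^sup>+x. ennreal (indicator {a<..b} x * W x) \<partial>lborel)"
      by (intro nn_integral_cong) (auto simp: indicator_def)
    also have "\<dots> = ennreal (measure N {a<..b})"
      unfolding meas[OF that] using Wi W0 by (intro nn_integral_eq_integral) auto
    finally show ?thesis by (simp add: N.emeasure_eq_measure)
  qed
  have "N = density lborel (\<lambda>x. ennreal (W x))"
  proof (rule measure_eqI_lessThan)
    fix x :: real
    have U: "{x<..} = (\<Union>n::nat. {x<..x + real n})"
    proof safe
      fix y assume "x < y"
      obtain n :: nat where "y - x \<le> real n" using real_arch_simple by blast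
      then show "y \<in> (\<Union>n::nat. {x<..x + real n})" using \<open>x < y\<close> by (auto intro!: exI[of _ n])
    qed auto
    have inc: "incseq (\<lambda>n::nat. {x<..x + real n})" by (auto simp: incseq_def)
    have "emeasure N {x<..} = (SUP n::nat. emeasure N {x<..x + real n})"
      unfolding U using inc by (subst SUP_emeasure_incseq) auto
    also have "\<dots> = (SUP n::nat. emeasure (density lborel (\<lambda>x. ennreal (W x))) {x<..x + real n})"
      by (simp add: em)
    also have "\<dots> = emeasure (density lborel (\<lambda>x. ennreal (W x))) {x<..}"
      unfolding U using inc by (subst SUP_emeasure_incseq) auto
    finally show "emeasure N {x<..} = emeasure (density lborel (\<lambda>x. ennreal (W x))) {x<..}" .
    show "emeasure N {x<..} < \<infinity>" by (simp add: N.emeasure_eq_measure)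
  qed auto
  then show "N = density lborel (\<lambda>x. ennreal (Re (inverse_fourier (char N) x)))"
    "0 \<le> Re (inverse_fourier (char N) x)"
    using W0 by (auto simp: W_def)
qed

lemma integrable_char_power:
  assumes F: "bounded_density M f" and n: "n \<ge> 2"
  shows "integrable lborel (\<lambda>z. char (law f) z ^ n)"
proof -
  interpret f: real_distribution "law f" by (rule real_distribution_law[OF F])
  show ?thesis
  proof (rule Bochner_Integration.integrable_bound[OF plancherel_bound(1)[OF F]])
    show "AE z in lborel. norm (char (law f) z ^ n) \<le> norm ((norm (char (law f) z))\<^sup>2)"
      using f.cmod_char_le_1 n by (auto simp: norm_power intro!: power_decreasing)
  qed measurable
qed

text \<open>
  The formula holds at every \<open>x\<close>, although \<open>f\<close> may be discontinuous: the inverse transform of \<open>\<xi>^(n-1)\<close> is the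
  density of the \<open>(n-1)\<close>-fold convolution only up to a null set, and the last convolution with \<open>f\<close>
  does not see null sets. This is why \<open>n \<ge> 3\<close> is assumed, so that \<open>n - 1 \<ge> 2\<close> and \<open>\<xi>^(n-1)\<close> is
  integrable.
\<close>
lemma conv_power_inversion:
  assumes F: "bounded_density M f" and n: "n \<ge> 3"
  shows "conv_power f n x = Re (inverse_fourier (\<lambda>z. char (law f) z ^ n) x)"
proof -
  note f = bounded_densityD[OF F]
  note [measurable] = f(1)
  interpret f: real_distribution "law f" by (rule real_distribution_law[OF F])
  define m where "m = n - 1"
  have m: "m \<ge> 2" "n = Suc m" using n by (auto simp: m_def)
  define k where "k = conv_power f m"
  have K: "bounded_density M k" and char_k: "char (law k) = (\<lambda>z. char (law f) z ^ m)"
    using conv_power_law[OF F, of m] m(1) by (auto simp: k_def)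
  note k = bounded_densityD[OF K]
  note [measurable] = k(1)
  interpret k: real_distribution "law k" by (rule real_distribution_law[OF K])
  define \<xi> where "\<xi> = char (law k)"
  have \<xi>i: "integrable lborel \<xi>"
    unfolding char_k \<xi>_def by (rule integrable_char_power[OF F m(1)])
  have [measurable]: "\<xi> \<in> borel_measurable borel" unfolding \<xi>_def by measurable
  have atom: "measure (law k) {x} = 0" for x
  proof -
    have "emeasure (law k) {x} = 0"
      unfolding law_def by (subst emeasure_density) (auto intro!: nn_integral_null_set)
    then show ?thesis by (simp add: measure_def)
  qed
  define W where "W y = Re (inverse_fourier \<xi> y)" for y
  have law_k: "law k = law W"
    using char_inversion_density(1)[OF k.real_distribution_axioms \<xi>i[unfolded \<xi>_def] atom]
    unfolding law_def[of W] W_def \<xi>_def .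
  have W0: "0 \<le> W y" for y
    using char_inversion_density(2)[OF k.real_distribution_axioms \<xi>i[unfolded \<xi>_def] atom]
    by (simp add: W_def \<xi>_def)
  have [measurable]: "inverse_fourier \<xi> \<in> borel_measurable borel"
    by (intro borel_measurable_continuous_onI continuous_at_imp_continuous_on ballI isCont_inverse_fourier \<xi>i)
  have [measurable]: "W \<in> borel_measurable borel" unfolding W_def by measurable
  have fx: "integrable lborel (\<lambda>y. f (x - y))"
    using lborel_integrable_real_affine[OF f(4), where c="-1" and t=x] by (simp add: algebra_simps)
  have pint: "integrable (lborel \<Otimes>\<^sub>M lborel) (\<lambda>(y, z). f (x - y) *\<^sub>R (iexp (-(z * y)) * \<xi> z))"
  proof (rule lborel_pair.Fubini_integrable)
    have "(\<integral>z. norm (case (y, z) of (y, z) \<Rightarrow> f (x - y) *\<^sub>R (iexp (-(z * y)) * \<xi> z)) \<partial>lborel)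
       = f (x - y) * (LBINT z. norm (\<xi> z))" for y
      by (simp add: norm_mult f)
    then show "integrable lborel (\<lambda>y. \<integral>z. norm (case (y, z) of (y, z) \<Rightarrow> f (x - y) *\<^sub>R (iexp (-(z * y)) * \<xi> z)) \<partial>lborel)"
      using fx by simp
    show "AE y in lborel. integrable lborel (\<lambda>z. case (y, z) of (y, z) \<Rightarrow> f (x - y) *\<^sub>R (iexp (-(z * y)) * \<xi> z))"
      using integrable_iexp_mult[OF \<xi>i] by (intro AE_I2) simp
  qed measurable
  have inner: "(CLBINT y. f (x - y) *\<^sub>R iexp (-(z * y))) = iexp (-(z * x)) * char (law f) z" for z
  proof -
    have "(CLBINT y. f (x - y) *\<^sub>R iexp (-(z * y))) = (CLBINT y. f y *\<^sub>R iexp (-(z * (x - y))))"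
      by (subst lborel_integral_real_affine[where c="-1" and t=x]) auto
    also have "\<dots> = (CLBINT y. iexp (-(z * x)) * (f y *\<^sub>R iexp (z * y)))"
      by (intro Bochner_Integration.integral_cong) (auto simp: exp_add[symmetric] algebra_simps)
    also have "\<dots> = iexp (-(z * x)) * char (law f) z"
      unfolding char_law[OF F] by (rule integral_mult_right_zero)
    finally show ?thesis .
  qed
  have "complex_of_real (1 / (2*pi)) * (CLBINT y. CLBINT z. f (x - y) *\<^sub>R (iexp (-(z * y)) * \<xi> z))
      = (CLBINT y. f (x - y) *\<^sub>R inverse_fourier \<xi> y)"
    by (simp add: inverse_fourier_def mult.left_commute flip: integral_mult_right_zero)
  moreover have "(CLBINT y. CLBINT z. f (x - y) *\<^sub>R (iexp (-(z * y)) * \<xi> z)) = (CLBINT z. CLBINT y. f (x - y) *\<^sub>R (iexp (-(z * y)) * \<xi> z))"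
    using lborel_pair.Fubini_integral[OF pint] by simp
  moreover have "(CLBINT y. f (x - y) *\<^sub>R (iexp (-(z * y)) * \<xi> z)) = iexp (-(z * x)) * (char (law f) z ^ n)" for z
  proof -
    have "(CLBINT y. f (x - y) *\<^sub>R (iexp (-(z * y)) * \<xi> z)) = (CLBINT y. f (x - y) *\<^sub>R iexp (-(z * y))) * \<xi> z"
      unfolding integral_mult_left_zero[symmetric] mult_scaleR_left ..
    also have "\<dots> = iexp (-(z * x)) * (char (law f) z ^ n)"
      unfolding inner by (simp add: \<xi>_def char_k m(2))
    finally show ?thesis .
  qed
  ultimately have eq: "(CLBINT y. f (x - y) *\<^sub>R inverse_fourier \<xi> y) = inverse_fourier (\<lambda>z. char (law f) z ^ n) x"
    by (simp add: inverse_fourier_def)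
  have bd: "norm (inverse_fourier \<xi> y) \<le> 1 / (2*pi) * (LBINT z. norm (\<xi> z))" for y
  proof -
    have "norm (CLBINT z. iexp (- (z * y)) * \<xi> z) \<le> (LBINT z. norm (\<xi> z))"
      by (rule order_trans[OF integral_norm_bound]) (simp add: norm_mult)
    then show ?thesis by (simp add: inverse_fourier_def norm_mult norm_divide divide_right_mono)
  qed
  have ii: "integrable lborel (\<lambda>y. f (x - y) *\<^sub>R inverse_fourier \<xi> y)"
  proof (rule Bochner_Integration.integrable_bound)
    show "integrable lborel (\<lambda>y. f (x - y) * (1 / (2*pi) * (LBINT z. norm (\<xi> z))))" using fx by simp
    show "AE y in lborel. norm (f (x - y) *\<^sub>R inverse_fourier \<xi> y) \<le> norm (f (x - y) * (1 / (2*pi) * (LBINT z. norm (\<xi> z))))"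
    proof (intro AE_I2)
      fix y
      have "0 \<le> (LBINT z. norm (\<xi> z))" by simp
      then show "norm (f (x - y) *\<^sub>R inverse_fourier \<xi> y) \<le> norm (f (x - y) * (1 / (2*pi) * (LBINT z. norm (\<xi> z))))"
        using mult_left_mono[OF bd[of y] f(2)[of "x - y"]] by (simp add: f(2) abs_mult)
    qed
  qed measurable
  have "conv_power f n x = conv f k x"
    using m by (simp add: k_def conv_power_Suc)
  also have "\<dots> = (LINT y|law W. f (x - y))"
    using conv_eq_law[OF F K] law_k by simp
  also have "\<dots> = (LBINT y. W y * f (x - y))"
    using W0 by (subst integral_law) auto
  also have "\<dots> = (LBINT y. Re (f (x - y) *\<^sub>R inverse_fourier \<xi> y))"
    by (simp add: W_def mult.commute)
  also have "\<dots> = Re (inverse_fourier (\<lambda>z. char (law f) z ^ n) x)"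
    using eq integral_Re[OF ii] by simp
  finally show ?thesis .
qed

section \<open>Characteristic functions away from the origin\<close>

text \<open>
  The set of \<open>x\<close> in \<open>[-2, 2]\<close> for which \<open>z x - \<alpha>\<close> is within \<open>\<beta>\<close> of a multiple of \<open>2\<pi>\<close> is covered by
  at most \<open>(2z + \<beta>)/\<pi> + 1\<close> intervals of length \<open>2\<beta>/z\<close>. The total length is small with \<open>\<beta>\<close>,
  uniformly in \<open>z \<ge> \<delta>\<close>: for large \<open>z\<close> there are more intervals, but they are shorter.
\<close>
lemma measure_near_multiples_le:
  fixes z \<alpha> \<beta> \<delta> :: real
  assumes \<delta>: "0 < \<delta>" "\<delta> \<le> z" and \<beta>: "0 < \<beta>" "\<beta> \<le> 1"
  obtains S where "S \<in> sets borel" "emeasure lborel S \<le> ennreal (\<beta> * (2 + 3 / \<delta>))"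
    "\<And>x. \<bar>x\<bar> \<le> 2 \<Longrightarrow> x \<notin> S \<Longrightarrow> cos (z * x - \<alpha>) \<le> cos \<beta>"
proof -
  have z: "z > 0" using \<delta> by simp
  define lo where "lo = \<lceil>(- 2 * z - \<beta> - \<alpha>) / (2 * pi)\<rceil>"
  define hi where "hi = \<lfloor>(2 * z + \<beta> - \<alpha>) / (2 * pi)\<rfloor>"
  define I where "I j = {(\<alpha> + 2 * pi * of_int j - \<beta>) / z..(\<alpha> + 2 * pi * of_int j + \<beta>) / z}" for j :: int
  define S where "S = (\<Union>j\<in>{lo..hi}. I j)"
  have S: "S \<in> sets borel" unfolding S_def I_def by (intro sets.finite_UN) auto
  have "real_of_int (hi - lo + 1) \<le> (2 * z + \<beta> - \<alpha>) / (2 * pi) - (- 2 * z - \<beta> - \<alpha>) / (2 * pi) + 1"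
    unfolding hi_def lo_def by (simp add: of_int_floor_le le_of_int_ceiling diff_mono)
  also have "\<dots> = (2 * z + \<beta>) / pi + 1" by (simp add: field_simps)
  finally have c: "real_of_int (hi - lo + 1) \<le> (2 * z + \<beta>) / pi + 1" .
  then have card: "real (card {lo..hi}) \<le> (2 * z + \<beta>) / pi + 1"
    using z \<beta> by (cases "hi - lo + 1 \<ge> 0") (auto intro: add_nonneg_nonneg)
  have "emeasure lborel S \<le> (\<Sum>j\<in>{lo..hi}. emeasure lborel (I j))"
    unfolding S_def by (intro emeasure_subadditive_finite) (auto simp: I_def)
  also have "\<dots> = (\<Sum>j\<in>{lo..hi}. ennreal (2 * \<beta> / z))"
  proof (intro sum.cong refl)
    fix j
    have "(\<alpha> + 2 * pi * of_int j - \<beta>) / z \<le> (\<alpha> + 2 * pi * of_int j + \<beta>) / z"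
      using z \<beta> by (intro divide_right_mono) auto
    then show "emeasure lborel (I j) = ennreal (2 * \<beta> / z)"
      unfolding I_def by (simp add: diff_divide_distrib[symmetric])
  qed
  also have "\<dots> = ennreal (real (card {lo..hi}) * (2 * \<beta> / z))"
    using z \<beta> by (simp add: ennreal_of_nat_eq_real_of_nat flip: ennreal_mult)
  also have "\<dots> \<le> ennreal (\<beta> * (2 + 3 / \<delta>))"
  proof (rule ennreal_leI)
    have pi3: "pi > 3" by (rule pi_gt3)
    have "real (card {lo..hi}) * (2 * \<beta> / z) \<le> ((2 * z + \<beta>) / pi + 1) * (2 * \<beta> / z)"
      using z \<beta> card by (intro mult_right_mono) auto
    also have "\<dots> \<le> ((2 * z + 1) / 3 + 1) * (2 * \<beta> / z)"
      using z \<beta> pi3 by (intro mult_right_mono add_mono frac_le) auto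
    also have "\<dots> = \<beta> * (4 / 3 + (8 / 3) / z)" using z by (simp add: field_simps)
    also have "\<dots> \<le> \<beta> * (2 + 3 / \<delta>)"
      using \<beta> \<delta> by (intro mult_left_mono add_mono frac_le) auto
    finally show "real (card {lo..hi}) * (2 * \<beta> / z) \<le> \<beta> * (2 + 3 / \<delta>)" .
  qed
  finally have meas: "emeasure lborel S \<le> ennreal (\<beta> * (2 + 3 / \<delta>))" .
  have "cos (z * x - \<alpha>) \<le> cos \<beta>" if x: "\<bar>x\<bar> \<le> 2" "x \<notin> S" for x
  proof -
    define v where "v = z * x - \<alpha>"
    define j where "j = round (v / (2 * pi))"
    define u where "u = v - 2 * pi * of_int j"
    have "\<bar>v / (2 * pi) - of_int j\<bar> \<le> 1 / 2"
      unfolding j_def using of_int_round_abs_le[of "v / (2 * pi)"] by (simp add: abs_minus_commute)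
    then have u: "\<bar>u\<bar> \<le> pi"
      unfolding u_def by (simp add: field_simps abs_le_iff)
    have "\<bar>u\<bar> > \<beta>"
    proof (rule ccontr)
      assume "\<not> \<bar>u\<bar> > \<beta>"
      then have ub: "\<bar>u\<bar> \<le> \<beta>" by simp
      have "\<bar>z * x\<bar> \<le> z * 2" using z x by (simp add: abs_mult)
      then have zx: "z * x \<le> 2 * z" "- 2 * z \<le> z * x" by auto
      have "of_int j \<le> (2 * z + \<beta> - \<alpha>) / (2 * pi)" "(- 2 * z - \<beta> - \<alpha>) / (2 * pi) \<le> of_int j"
        using ub zx by (auto simp: u_def v_def field_simps abs_le_iff)
      then have "j \<in> {lo..hi}"
        unfolding lo_def hi_def by (simp add: ceiling_le_iff le_floor_iff)
      moreover have "x \<in> I j"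
        using ub z unfolding I_def u_def v_def by (auto simp: field_simps abs_le_iff)
      ultimately show False using x by (auto simp: S_def)
    qed
    then have "cos \<bar>u\<bar> \<le> cos \<beta>" using u \<beta> by (intro cos_monotone_0_pi_le) auto
    moreover have "cos v = cos u"
    proof -
      have "v = u + of_int j * (2 * pi)" by (simp add: u_def)
      then show ?thesis by (simp add: cos_add sin_int_2pin cos_int_2pin mult.commute[of "of_int j"])
    qed
    ultimately show ?thesis by (simp add: v_def)
  qed
  with S meas show ?thesis by (rule that)
qed

text \<open>
  If \<open>\<alpha>\<close> is the argument of \<open>\<xi> z\<close>, then \<open>1 - \<bar>\<xi> z\<bar> = \<integral>(1 - cos (z x - \<alpha>)) f x dx\<close>. Let \<open>S\<close> be the set of
  the previous lemma. By Chebyshev's inequality \<open>[-2, 2]\<close> has mass at least \<open>3/4\<close>, and since \<open>f \<le> M\<close>,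
  \<open>S\<close> has mass at most \<open>1/2\<close> for suitable \<open>\<beta>\<close>. On the rest of \<open>[-2, 2]\<close> the integrand is at least
  \<open>(1 - cos \<beta>) f x\<close>.
\<close>
lemma char_bounded_away_from_one:
  fixes M \<delta> :: real
  assumes M: "M > 0" and \<delta>: "\<delta> > 0"
  obtains \<eta> where "0 \<le> \<eta>" "\<eta> < 1"
    "\<And>f z. bounded_density M f \<Longrightarrow> integrable lborel (\<lambda>x. f x * x\<^sup>2) \<Longrightarrow> (LBINT x. f x * x\<^sup>2) = 1 \<Longrightarrow>
       \<delta> \<le> \<bar>z\<bar> \<Longrightarrow> norm (char (law f) z) \<le> \<eta>"
proof -
  \<comment> \<open>With this choice the exceptional set \<open>S\<close> has mass at most \<open>M * (\<beta> * (2 + 3 / \<delta>)) \<le> 1/2\<close>.\<close>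
  define \<beta> where "\<beta> = min 1 (1 / (2 * M * (2 + 3 / \<delta>)))"
  have pos: "2 + 3 / \<delta> > 0" using \<delta> by (simp add: add_pos_pos)
  have \<beta>: "0 < \<beta>" "\<beta> \<le> 1" "M * (\<beta> * (2 + 3 / \<delta>)) \<le> 1 / 2"
  proof -
    have "\<beta> \<le> 1 / (2 * M * (2 + 3 / \<delta>))" by (simp add: \<beta>_def)
    then show "M * (\<beta> * (2 + 3 / \<delta>)) \<le> 1 / 2"
      using pos M by (simp add: pos_le_divide_eq mult_ac)
    show "0 < \<beta>" using pos M by (simp add: \<beta>_def)
  qed (simp add: \<beta>_def)
  define \<eta> where "\<eta> = 1 - (1 - cos \<beta>) / 4"
  have "cos \<beta> < 1"
    using cos_monotone_0_pi[of 0 \<beta>] \<beta> pi_gt3 by auto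
  then have \<eta>: "0 \<le> \<eta>" "\<eta> < 1"
    using cos_ge_minus_one[of \<beta>] by (simp_all add: \<eta>_def field_simps del: cos_ge_minus_one)
  show ?thesis
  proof (rule that[OF \<eta>])
    fix f and z :: real
    assume F: "bounded_density M f" and i2: "integrable lborel (\<lambda>x. f x * x\<^sup>2)"
      and v: "(LBINT x. f x * x\<^sup>2) = 1" and z: "\<delta> \<le> \<bar>z\<bar>"
    note f = bounded_densityD[OF F]
    note [measurable] = f(1)
    define w where "w = char (law f) z"
    define \<alpha> where "\<alpha> = Arg w"
    have w: "w = of_real (norm w) * iexp \<alpha>"
      by (simp add: \<alpha>_def) (metis rcis_cmod_Arg rcis_def cis_conv_exp)
    have ci: "integrable lborel (\<lambda>x. f x * cos (z * x - \<alpha>))"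
      by (rule Bochner_Integration.integrable_bound[OF f(4)]) (auto simp: abs_mult f intro!: mult_left_le)
    have ii: "complex_integrable lborel (\<lambda>x. f x *\<^sub>R iexp (z * x) * iexp (- \<alpha>))"
      by (rule Bochner_Integration.integrable_bound[OF f(4)]) (auto simp: norm_mult f)
    have "norm w = Re (w * iexp (- \<alpha>))"
    proof -
      have "w * iexp (- \<alpha>) = of_real (norm w) * (iexp \<alpha> * iexp (- \<alpha>))"
        by (subst (1) w) (simp add: mult.assoc)
      also have "iexp \<alpha> * iexp (- \<alpha>) = 1" by (simp flip: exp_add)
      finally show ?thesis by simp
    qed
    also have "w * iexp (- \<alpha>) = (CLBINT x. f x *\<^sub>R iexp (z * x) * iexp (- \<alpha>))"
      unfolding w_def char_law[OF F] by (rule integral_mult_left_zero[symmetric])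
    also have "Re \<dots> = (LBINT x. Re (f x *\<^sub>R iexp (z * x) * iexp (- \<alpha>)))"
      using integral_Re[OF ii] by simp
    also have "\<dots> = (LBINT x. f x * cos (z * x - \<alpha>))"
      by (intro Bochner_Integration.integral_cong) (auto simp: Re_exp Im_exp cos_diff sin_diff algebra_simps)
    finally have nw: "norm w = (LBINT x. f x * cos (z * x - \<alpha>))" .
    obtain S where S [measurable]: "S \<in> sets borel" and Sm: "emeasure lborel S \<le> ennreal (\<beta> * (2 + 3 / \<delta>))"
      and Sc: "\<And>x. \<bar>x\<bar> \<le> 2 \<Longrightarrow> x \<notin> S \<Longrightarrow> cos (\<bar>z\<bar> * x - sgn z * \<alpha>) \<le> cos \<beta>"
      using measure_near_multiples_le[OF \<delta> z \<beta>(1,2)] by metis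
    have Sc': "cos (z * x - \<alpha>) \<le> cos \<beta>" if "\<bar>x\<bar> \<le> 2" "x \<notin> S" for x
    proof (cases "z \<ge> 0")
      case True
      then show ?thesis using Sc[OF that] \<delta> z by (simp add: sgn_if split: if_splits)
    next
      case False
      then have "cos (- (z * x - \<alpha>)) \<le> cos \<beta>" using Sc[OF that] by (simp add: sgn_if)
      then show ?thesis by (simp only: cos_minus)
    qed
    have Sfin: "emeasure lborel S < \<infinity>" using Sm by (rule le_less_trans) simp
    have Si: "integrable lborel (\<lambda>x. f x * indicator S x)"
      by (rule Bochner_Integration.integrable_bound[OF f(4)]) (auto simp: f indicator_def)
    have "(LBINT x. f x * indicator S x) \<le> (LBINT x. M * indicator S x)"
      using Sfin f by (intro integral_mono Si) (auto intro!: mult_right_mono)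
    also have "\<dots> = M * measure lborel S" using S by simp
    also have "\<dots> \<le> M * (\<beta> * (2 + 3 / \<delta>))"
    proof (intro mult_left_mono)
      show "measure lborel S \<le> \<beta> * (2 + 3 / \<delta>)"
        using Sm pos \<beta> by (simp add: measure_def enn2real_leI)
    qed (use M in simp)
    also have "\<dots> \<le> 1 / 2" by (rule \<beta>)
    finally have PS: "(LBINT x. f x * indicator S x) \<le> 1 / 2" .
    \<comment> \<open>\<open>1 - x\<^sup>2/4 - indicator S x\<close> is at most \<open>1\<close>, and positive only on \<open>[-2, 2] - S\<close>.\<close>
    define u where "u x = f x - (1 - cos \<beta>) * (f x - (f x * x\<^sup>2) / 4 - f x * indicator S x)" for x
    have le: "f x * cos (z * x - \<alpha>) \<le> u x" for x
    proof -
      have "cos (z * x - \<alpha>) \<le> 1 - (1 - cos \<beta>) * (1 - x\<^sup>2 / 4 - indicator S x)"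
      proof (cases "\<bar>x\<bar> \<le> 2 \<and> x \<notin> S")
        case True
        have "(1 - cos \<beta>) * (1 - x\<^sup>2 / 4 - indicator S x) \<le> 1 - cos \<beta>"
          using True by (intro mult_left_le) auto
        then show ?thesis using Sc'[of x] True by linarith
      next
        case False
        have "1 - x\<^sup>2 / 4 - indicator S x \<le> 0"
        proof (cases "x \<in> S")
          case False
          then have "2 \<le> \<bar>x\<bar>" using \<open>\<not> (\<bar>x\<bar> \<le> 2 \<and> x \<notin> S)\<close> by auto
          then have "2\<^sup>2 \<le> \<bar>x\<bar>\<^sup>2" by (intro power_mono) auto
          then show ?thesis using False by simp
        qed simp
        then have "(1 - cos \<beta>) * (1 - x\<^sup>2 / 4 - indicator S x) \<le> 0"
          using cos_le_one[of \<beta>] by (simp add: mult_nonneg_nonpos)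
        then show ?thesis using cos_le_one[of "z * x - \<alpha>"] by linarith
      qed
      from mult_left_mono[OF this f(2)[of x]] show ?thesis
        by (simp add: u_def algebra_simps)
    qed
    have ui: "integrable lborel u" unfolding u_def
      by (intro Bochner_Integration.integrable_diff integrable_mult_right integrable_divide_zero f(4) i2 Si)
    have "norm w \<le> (LBINT x. u x)"
      unfolding nw by (rule integral_mono[OF ci ui le])
    also have "\<dots> = 1 - (1 - cos \<beta>) * (1 - 1 / 4 - (LBINT x. f x * indicator S x))"
      unfolding u_def using f(4,5) i2 Si v by simp
    also have "\<dots> \<le> 1 - (1 - cos \<beta>) * (1 / 4)"
      using PS cos_le_one[of \<beta>] by (intro diff_left_mono mult_left_mono) auto
    finally show "norm (char (law f) z) \<le> \<eta>" by (simp add: \<eta>_def w_def)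
  qed
qed

section \<open>Fourier integrals of Gaussians times powers\<close>

lemma integrable_power_gaussian:
  fixes \<sigma> :: real assumes "\<sigma> > 0"
  shows "integrable lborel (\<lambda>z. z ^ k * exp (- (\<sigma> * z)\<^sup>2 / 2))"
proof -
  have "integrable lborel (\<lambda>z. sqrt (2 * pi * (1/\<sigma>)\<^sup>2) * (normal_density 0 (1/\<sigma>) z * (z - 0) ^ k))"
    using assms by (intro integrable_mult_right integrable_normal_moment) auto
  also have "(\<lambda>z. sqrt (2 * pi * (1/\<sigma>)\<^sup>2) * (normal_density 0 (1/\<sigma>) z * (z - 0) ^ k)) = (\<lambda>z. z ^ k * exp (- (\<sigma> * z)\<^sup>2 / 2))"
    using assms by (auto simp: normal_density_def fun_eq_iff field_simps power_mult_distrib)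
  finally show ?thesis .
qed

lemma tendsto_power_gaussian:
  "((\<lambda>z::real. z ^ k * exp (- z\<^sup>2 / 2)) \<longlongrightarrow> 0) at_top"
  "((\<lambda>z::real. z ^ k * exp (- z\<^sup>2 / 2)) \<longlongrightarrow> 0) at_bot"
proof -
  show *: "((\<lambda>z::real. z ^ k * exp (- z\<^sup>2 / 2)) \<longlongrightarrow> 0) at_top" for k
  proof (rule tendsto_sandwich[OF _ _ tendsto_const tendsto_power_div_exp_0])
    show "\<forall>\<^sub>F z::real in at_top. 0 \<le> z ^ k * exp (- z\<^sup>2 / 2)"
      using eventually_ge_at_top[of 0] by eventually_elim simp
    show "\<forall>\<^sub>F z::real in at_top. z ^ k * exp (- z\<^sup>2 / 2) \<le> z ^ k / exp z"
      using eventually_ge_at_top[of 2]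
    proof eventually_elim
      case (elim z)
      then have "z * 2 \<le> z * z" by (intro mult_left_mono) auto
      then have "exp (- z\<^sup>2 / 2) \<le> exp (- z)" by (simp add: power2_eq_square)
      then show ?case using elim by (simp add: exp_minus field_simps mult_left_mono)
    qed
  qed
  have "((\<lambda>z::real. (-1) ^ k * (z ^ k * exp (- z\<^sup>2 / 2))) \<longlongrightarrow> (-1) ^ k * 0) at_top"
    by (intro tendsto_intros *)
  moreover have "(\<lambda>z::real. (-1) ^ k * (z ^ k * exp (- z\<^sup>2 / 2))) = (\<lambda>z. (- z) ^ k * exp (- (- z)\<^sup>2 / 2))"
    by (rule ext) (metis mult.assoc power2_minus power_minus)
  ultimately have "((\<lambda>z::real. (- z) ^ k * exp (- (- z)\<^sup>2 / 2)) \<longlongrightarrow> 0) at_top"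
    by simp
  then show "((\<lambda>z::real. z ^ k * exp (- z\<^sup>2 / 2)) \<longlongrightarrow> 0) at_bot"
    by (simp add: filterlim_at_bot_mirror)
qed

text \<open>
  The value is \<open>2\<pi> (-i)^k\<close> times the standard normal density times the \<open>k\<close>-th (probabilists') Hermite
  polynomial; the cases \<open>k = 0\<close> and \<open>k = 3\<close> make up the Edgeworth correction.
\<close>
definition hermite_fourier :: "nat \<Rightarrow> real \<Rightarrow> complex" where
  "hermite_fourier k x = (CLBINT z. iexp (- (z * x)) * of_real (z ^ k * exp (- z\<^sup>2 / 2)))"

lemma integrable_hermite_fourier:
  "integrable lborel (\<lambda>z. iexp (- (z * x)) * complex_of_real (z ^ k * exp (- z\<^sup>2 / 2)))"
  using integrable_power_gaussian[of 1 k] by (intro integrable_iexp_mult integrable_of_real) simp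

text \<open>
  Integration by parts: the derivative of \<open>exp (-i z x) z^k exp (-z\<^sup>2/2)\<close> integrates to \<open>0\<close>. This is the
  three-term recurrence of the Hermite polynomials.
\<close>
lemma hermite_fourier_recurrence:
  "hermite_fourier (Suc k) x = k * hermite_fourier (k - 1) x - \<i> * x * hermite_fourier k x"
proof -
  let ?h = "\<lambda>k z. iexp (- (z * x)) * complex_of_real (z ^ k * exp (- z\<^sup>2 / 2))"
  let ?d = "\<lambda>z. k * ?h (k - 1) z - \<i> * x * ?h k z - ?h (Suc k) z"
  have di: "integrable lborel ?d"
    by (intro Bochner_Integration.integrable_diff integrable_mult_right integrable_hermite_fourier)
  have "(LBINT z=-\<infinity>..\<infinity>. ?d z) = 0 - 0"
  proof (rule interval_integral_FTC_integrable)
    fix z :: real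
    show "(?h k has_vector_derivative ?d z) (at z)"
    proof -
      have "((\<lambda>w. exp (- (\<i> * (w * x))) * (w ^ k * exp (- w\<^sup>2 / 2))) has_field_derivative
        (k * (exp (- (\<i> * (z * x))) * (z ^ (k - 1) * exp (- (complex_of_real z)\<^sup>2 / 2))) - \<i> * x * (exp (- (\<i> * (z * x))) * (z ^ k * exp (- (complex_of_real z)\<^sup>2 / 2)))
          - (exp (- (\<i> * (z * x))) * (z ^ Suc k * exp (- (complex_of_real z)\<^sup>2 / 2))))) (at (complex_of_real z))"
        by (auto intro!: derivative_eq_intros simp: algebra_simps)
      from has_vector_derivative_real_field[OF this] show ?thesis
        by (simp add: exp_of_real[symmetric])
    qed
    show "isCont ?d z" by (intro isCont_diff isCont_mult continuous_const) simp_all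
  next
    have bd: "((\<lambda>z. ?h k z) \<longlongrightarrow> 0) F" if "((\<lambda>z::real. z ^ k * exp (- z\<^sup>2 / 2)) \<longlongrightarrow> 0) F" for F
    proof (rule tendsto_norm_zero_cancel)
      show "((\<lambda>z. norm (?h k z)) \<longlongrightarrow> 0) F"
        using tendsto_norm_zero[OF that] by (simp add: norm_mult norm_power abs_mult power_abs)
    qed
    show "((?h k \<circ> real_of_ereal) \<longlongrightarrow> 0) (at_right (-\<infinity>))"
      unfolding comp_def at_right_MInf filterlim_filtermap real_of_ereal.simps
      by (intro bd tendsto_power_gaussian)
    show "((?h k \<circ> real_of_ereal) \<longlongrightarrow> 0) (at_left \<infinity>)"
      unfolding comp_def at_left_PInf filterlim_filtermap real_of_ereal.simps
      by (intro bd tendsto_power_gaussian)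
    show "set_integrable lborel (einterval (- \<infinity>) \<infinity>) ?d"
      using di by (simp add: set_integrable_def)
  qed auto
  then have "(CLBINT z. ?d z) = 0"
    by (simp add: interval_lebesgue_integral_def set_lebesgue_integral_def)
  moreover have "(CLBINT z. ?d z) = k * hermite_fourier (k - 1) x - \<i> * x * hermite_fourier k x - hermite_fourier (Suc k) x"
  proof -
    have "(CLBINT z. ?d z) = (CLBINT z. k * ?h (k - 1) z - \<i> * x * ?h k z) - (CLBINT z. ?h (Suc k) z)"
      by (rule Bochner_Integration.integral_diff)
        (intro Bochner_Integration.integrable_diff integrable_mult_right integrable_hermite_fourier)+
    also have "(CLBINT z. k * ?h (k - 1) z - \<i> * x * ?h k z) = (CLBINT z. k * ?h (k - 1) z) - (CLBINT z. \<i> * x * ?h k z)"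
      by (rule Bochner_Integration.integral_diff)
        (intro integrable_mult_right integrable_hermite_fourier)+
    finally show ?thesis
      unfolding hermite_fourier_def integral_mult_right_zero .
  qed
  ultimately show ?thesis by (simp add: algebra_simps)
qed

lemma hermite_fourier_values:
  "hermite_fourier 0 x = 2 * pi * std_normal_density x"
  "hermite_fourier 3 x = \<i> * (x ^ 3 - 3 * x) * hermite_fourier 0 x"
proof -
  show "hermite_fourier 0 x = 2 * pi * std_normal_density x"
  proof -
    have "hermite_fourier 0 x = 2 * pi * std_normal_density (- x)"
      using gaussian_fourier[of 1 "- x"] unfolding hermite_fourier_def by (simp add: mult.commute)
    then show ?thesis by (simp add: normal_density_def)
  qed
  have 1: "hermite_fourier 1 x = - \<i> * x * hermite_fourier 0 x"
    using hermite_fourier_recurrence[of 0 x] by simp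
  have 2: "hermite_fourier 2 x = hermite_fourier 0 x - \<i> * x * hermite_fourier 1 x"
    using hermite_fourier_recurrence[of 1 x] by (simp add: numeral_2_eq_2)
  have 3: "hermite_fourier 3 x = 2 * hermite_fourier 1 x - \<i> * x * hermite_fourier 2 x"
    using hermite_fourier_recurrence[of 2 x] by (simp add: numeral_3_eq_3)
  show "hermite_fourier 3 x = \<i> * (x ^ 3 - 3 * x) * hermite_fourier 0 x"
    unfolding 3 2 1 by (simp add: algebra_simps power3_eq_cube)
qed

text \<open>
  The Fourier transform of the normal density with the third-order Edgeworth correction; \<open>c\<close> stands for
  \<open>\<gamma> / (6 \<surd>n)\<close>.
\<close>
definition edgeworth_transform :: "real \<Rightarrow> real \<Rightarrow> complex" where
  "edgeworth_transform c z = of_real (exp (- z\<^sup>2 / 2)) * (1 - \<i> * of_real (c * z ^ 3))"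

lemma edgeworth_transform_inverse:
  "integrable lborel (edgeworth_transform c)"
  "inverse_fourier (edgeworth_transform c) x = of_real (std_normal_density x * (1 + c * (x ^ 3 - 3 * x)))"
proof -
  have eq: "edgeworth_transform c z = of_real (z ^ 0 * exp (- z\<^sup>2 / 2)) - \<i> * of_real c * of_real (z ^ 3 * exp (- z\<^sup>2 / 2))" for z
    by (simp add: edgeworth_transform_def algebra_simps)
  show "integrable lborel (edgeworth_transform c)"
    unfolding eq[abs_def] using integrable_power_gaussian[of 1 0] integrable_power_gaussian[of 1 3]
    by (intro Bochner_Integration.integrable_diff integrable_mult_right integrable_of_real) simp_all
  have "(CLBINT z. iexp (- (z * x)) * edgeworth_transform c z)
     = (CLBINT z. iexp (- (z * x)) * of_real (z ^ 0 * exp (- z\<^sup>2 / 2)) - \<i> * of_real c * (iexp (- (z * x)) * of_real (z ^ 3 * exp (- z\<^sup>2 / 2))))"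
    unfolding eq by (simp only: right_diff_distrib mult_ac)
  also have "\<dots> = hermite_fourier 0 x - \<i> * of_real c * hermite_fourier 3 x"
    unfolding hermite_fourier_def integral_mult_right_zero[symmetric]
    by (rule Bochner_Integration.integral_diff) (intro integrable_mult_right integrable_hermite_fourier)+
  also have "\<dots> = (1 + c * (x ^ 3 - 3 * x)) * hermite_fourier 0 x"
    unfolding hermite_fourier_values(2) by (simp add: algebra_simps)
  finally show "inverse_fourier (edgeworth_transform c) x = of_real (std_normal_density x * (1 + c * (x ^ 3 - 3 * x)))"
    unfolding inverse_fourier_def hermite_fourier_values(1) by simp
qed

section \<open>Characteristic functions of standardized densities near the origin\<close>

text \<open>The class on which the Edgeworth expansion is uniform.\<close>
definition standardized :: "real \<Rightarrow> real \<Rightarrow> (real \<Rightarrow> real) \<Rightarrow> bool" where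
  "standardized M B f \<longleftrightarrow> bounded_density M f \<and> integrable lborel (\<lambda>x. f x * x ^ 4) \<and>
     (LBINT x. f x * x) = 0 \<and> (LBINT x. f x * x\<^sup>2) = 1 \<and> (LBINT x. f x * x ^ 4) \<le> B"

lemma abs_power_le_one_plus:
  fixes x :: real assumes "k \<le> n" shows "\<bar>x\<bar> ^ k \<le> 1 + \<bar>x\<bar> ^ n"
proof (cases "\<bar>x\<bar> \<le> 1")
  case True
  then have "\<bar>x\<bar> ^ k \<le> 1" by (simp add: power_le_one)
  then show ?thesis by (simp add: add_increasing2)
next
  case False
  then have "\<bar>x\<bar> ^ k \<le> \<bar>x\<bar> ^ n" using assms by (intro power_increasing) auto
  then show ?thesis by simp
qed

lemma standardized_moments:
  assumes S: "standardized M B f"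
  shows "k \<le> 4 \<Longrightarrow> integrable lborel (\<lambda>x. f x * x ^ k)"
    "0 \<le> (LBINT x. f x * x ^ 4)"  "\<bar>LBINT x. f x * x ^ 3\<bar> \<le> 1 + B"
proof -
  have F: "bounded_density M f" and i4: "integrable lborel (\<lambda>x. f x * x ^ 4)"
    and m: "(LBINT x. f x * x\<^sup>2) = 1" "(LBINT x. f x * x ^ 4) \<le> B"
    using S by (auto simp: standardized_def)
  note f = bounded_densityD[OF F]
  note [measurable] = f(1)
  show i: "integrable lborel (\<lambda>x. f x * x ^ k)" if k: "k \<le> 4" for k
  proof (rule Bochner_Integration.integrable_bound)
    show "integrable lborel (\<lambda>x. f x + f x * x ^ 4)" using f(4) i4 by simp
    have "norm (f x * x ^ k) \<le> norm (f x + f x * x ^ 4)" for x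
    proof -
      have "f x * \<bar>x\<bar> ^ k \<le> f x * (1 + \<bar>x\<bar> ^ 4)"
        by (intro mult_left_mono abs_power_le_one_plus k f)
      then show ?thesis using f(2)[of x] by (simp add: abs_mult power_abs algebra_simps)
    qed
    then show "AE x in lborel. norm (f x * x ^ k) \<le> norm (f x + f x * x ^ 4)" by simp
  qed measurable
  show "0 \<le> (LBINT x. f x * x ^ 4)" using f(2) by (intro integral_nonneg_AE) auto
  have "\<bar>LBINT x. f x * x ^ 3\<bar> \<le> (LBINT x. \<bar>f x * x ^ 3\<bar>)" by (rule integral_abs_bound)
  also have "\<dots> \<le> (LBINT x. f x * x\<^sup>2 + f x * x ^ 4)"
  proof (rule integral_mono)
    fix x :: real
    \<comment> \<open>\<open>\<bar>x\<bar> \<le> (1 + x\<^sup>2)/2\<close>, multiplied by \<open>x\<^sup>2\<close>\<close>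
    have "0 \<le> (\<bar>x\<bar> - 1)\<^sup>2 * x\<^sup>2 / 2 + (x\<^sup>2 + x ^ 4) / 2" by simp
    moreover have "(\<bar>x\<bar> - 1)\<^sup>2 * x\<^sup>2 / 2 + (x\<^sup>2 + x ^ 4) / 2 = x\<^sup>2 + x ^ 4 - \<bar>x\<bar> ^ 3"
      by (cases "x \<ge> 0") (simp_all add: field_simps eval_nat_numeral)
    ultimately have "\<bar>x\<bar> ^ 3 \<le> x\<^sup>2 + x ^ 4" by linarith
    from mult_left_mono[OF this f(2)[of x]]
    show "\<bar>f x * x ^ 3\<bar> \<le> f x * x\<^sup>2 + f x * x ^ 4"
      using f(2)[of x] by (simp add: abs_mult power_abs distrib_left)
  qed (use i[of 2] i[of 3] i[of 4] in auto)
  also have "\<dots> \<le> 1 + B" using i[of 2] i[of 4] m by simp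
  finally show "\<bar>LBINT x. f x * x ^ 3\<bar> \<le> 1 + B" .
qed

lemma char_third_order:
  fixes z \<gamma> :: real
  assumes S: "standardized M B f" and \<gamma>: "\<gamma> = (LBINT x. f x * x ^ 3)"
  shows "norm (char (law f) z - (1 - z\<^sup>2 / 2 - \<i> * (\<gamma> * z ^ 3 / 6))) \<le> B * z ^ 4 / 8"
proof -
  have F: "bounded_density M f" and m: "(LBINT x. f x * x) = 0" "(LBINT x. f x * x\<^sup>2) = 1" "(LBINT x. f x * x ^ 4) \<le> B"
    using S by (auto simp: standardized_def)
  note f = bounded_densityD[OF F]
  note [measurable] = f(1)
  interpret f: real_distribution "law f" by (rule real_distribution_law[OF F])
  define m4 where "m4 = (LBINT x. f x * x ^ 4)"
  have m4: "0 \<le> m4" "m4 \<le> B" using standardized_moments(2)[OF S] m by (auto simp: m4_def)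
  have E: "f.expectation (\<lambda>x. x ^ k) = (LBINT x. f x * x ^ k)" for k
    using f(1,2) by (subst integral_law) auto
  have E4: "f.expectation (\<lambda>x. x ^ 4) = m4"
    using E[of 4] by (simp only: m4_def)
  have "norm (char (law f) z - (\<Sum>k\<le>4. ((\<i> * z) ^ k / fact k) * f.expectation (\<lambda>x. x ^ k)))
      \<le> (2 * \<bar>z\<bar> ^ 4 / fact 4) * f.expectation (\<lambda>x. \<bar>x\<bar> ^ 4)"
    by (rule f.char_approx1) (use standardized_moments(1)[OF S] f(1,2) in \<open>simp add: integrable_law\<close>)
  also have "\<dots> = z ^ 4 * m4 / 12" by (simp add: E4 fact_numeral)
  also have "(\<Sum>k\<le>4. ((\<i> * z) ^ k / fact k) * f.expectation (\<lambda>x. x ^ k))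
     = 1 - z\<^sup>2 / 2 - \<i> * (\<gamma> * z ^ 3 / 6) + z ^ 4 * m4 / 24"
    using f.prob_space m f(5) unfolding E
    by (simp add: numeral_eq_Suc fact_numeral \<gamma> m4_def power_mult_distrib algebra_simps)
  finally have 1: "norm (char (law f) z - (1 - z\<^sup>2 / 2 - \<i> * (\<gamma> * z ^ 3 / 6) + z ^ 4 * m4 / 24)) \<le> z ^ 4 * m4 / 12" .
  have 2: "norm (complex_of_real (z ^ 4 * m4 / 24)) = z ^ 4 * m4 / 24"
    using m4(1) by (simp only: norm_of_real) simp
  have "norm (char (law f) z - (1 - z\<^sup>2 / 2 - \<i> * (\<gamma> * z ^ 3 / 6))) \<le> z ^ 4 * m4 / 12 + z ^ 4 * m4 / 24"
    using norm_triangle_mono[OF 1 eq_refl[OF 2]] by (simp add: algebra_simps)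
  also have "\<dots> = m4 * z ^ 4 / 8" by simp
  also have "\<dots> \<le> B * z ^ 4 / 8" using m4 by (intro divide_right_mono mult_right_mono) auto
  finally show ?thesis .
qed

text \<open>
  The comparison is with \<open>exp w\<close>, where \<open>w\<close> collects the first three cumulants, rather than with the
  Taylor polynomial: the cubic term of \<open>w\<close> is purely imaginary, so the \<open>n\<close>-th power of \<open>exp w\<close> has
  exact Gaussian size.
\<close>
lemma char_vs_exponential:
  fixes z \<gamma> :: real
  assumes S: "standardized M B f" and \<gamma>: "\<gamma> = (LBINT x. f x * x ^ 3)" and z: "\<bar>z\<bar> \<le> 1"
  shows "norm (char (law f) z - exp (- z\<^sup>2 / 2 - \<i> * (\<gamma> * z ^ 3 / 6))) \<le> 3 * (1 + B)\<^sup>2 * z ^ 4"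
proof -
  have B: "0 \<le> B" using S standardized_moments(2)[OF S] by (auto simp: standardized_def)
  have g: "\<bar>\<gamma>\<bar> \<le> 1 + B" using standardized_moments(3)[OF S] \<gamma> by simp
  define w where "w = - z\<^sup>2 / 2 - \<i> * (\<gamma> * z ^ 3 / 6)"
  have Rew: "Re w = - z\<^sup>2 / 2" by (simp add: w_def)
  have z2: "z\<^sup>2 \<le> 1" using z by (simp add: abs_square_le_1)
  have "norm w \<le> norm (complex_of_real (- z\<^sup>2 / 2)) + norm (\<i> * complex_of_real (\<gamma> * z ^ 3 / 6))"
    unfolding w_def using norm_triangle_ineq4[of "complex_of_real (- z\<^sup>2 / 2)" "\<i> * complex_of_real (\<gamma> * z ^ 3 / 6)"] by simp
  also have "\<dots> = z\<^sup>2 / 2 + \<bar>\<gamma>\<bar> * \<bar>z\<bar> ^ 3 / 6"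
    by (simp only: norm_mult norm_of_real norm_ii) (simp add: abs_mult power_abs)
  also have "\<dots> \<le> z\<^sup>2 / 2 + (1 + B) * z\<^sup>2 / 6"
  proof -
    have "\<bar>z\<bar> ^ 3 \<le> \<bar>z\<bar>\<^sup>2" using z by (intro power_decreasing) auto
    then show ?thesis using g B by (intro add_left_mono divide_right_mono mult_mono) auto
  qed
  also have "\<dots> \<le> (1 + B) * z\<^sup>2"
  proof -
    have "(1 + B) * z\<^sup>2 = z\<^sup>2 + B * z\<^sup>2" "0 \<le> B * z\<^sup>2" "0 \<le> z\<^sup>2"
      using B by (simp_all add: distrib_right)
    then show ?thesis by linarith
  qed
  finally have nw: "norm w \<le> (1 + B) * z\<^sup>2" .
  have "norm (exp w - (\<Sum>k\<le>1. w ^ k / fact k)) \<le> exp \<bar>Re w\<bar> * norm w ^ Suc 1 / fact 1"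
    by (rule Taylor_exp)
  also have "\<dots> = exp (z\<^sup>2 / 2) * (norm w)\<^sup>2" by (simp add: Rew power2_eq_square)
  also have "\<dots> \<le> 2 * ((1 + B) * z\<^sup>2)\<^sup>2"
  proof (intro mult_mono power_mono nw)
    have "exp (z\<^sup>2 / 2) \<le> exp (1 / 2)" using z2 by simp
    also have "\<dots> \<le> 2" using exp_bound_half[of "1 / 2 :: real"] by simp
    finally show "exp (z\<^sup>2 / 2) \<le> 2" .
  qed auto
  also have "(\<Sum>k\<le>1. w ^ k / fact k) = 1 - z\<^sup>2 / 2 - \<i> * (\<gamma> * z ^ 3 / 6)"
    by (simp add: w_def)
  finally have 1: "norm (exp w - (1 - z\<^sup>2 / 2 - \<i> * (\<gamma> * z ^ 3 / 6))) \<le> 2 * (1 + B)\<^sup>2 * z ^ 4"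
    by (simp add: power_mult_distrib mult.assoc flip: power_mult)
  have "norm (char (law f) z - exp w) \<le> B * z ^ 4 / 8 + 2 * (1 + B)\<^sup>2 * z ^ 4"
    using norm_triangle_mono[OF char_third_order[OF S \<gamma>, of z] 1[unfolded norm_minus_commute[of "exp w"]]]
    by simp
  also have "\<dots> = (B / 8 + 2 * (1 + B)\<^sup>2) * z ^ 4" by (simp add: algebra_simps)
  also have "\<dots> \<le> (3 * (1 + B)\<^sup>2) * z ^ 4"
    using B by (intro mult_right_mono) (auto simp: power2_eq_square algebra_simps)
  finally show ?thesis by (simp add: w_def)
qed

lemma char_gaussian_bound:
  fixes z :: real
  assumes S: "standardized M B f" and z: "\<bar>z\<bar> \<le> 1 / (4 * (1 + B))"
  shows "norm (char (law f) z) \<le> exp (- z\<^sup>2 / 4)"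
proof -
  define \<gamma> where "\<gamma> = (LBINT x. f x * x ^ 3)"
  have B: "0 \<le> B" using S standardized_moments(2)[OF S] by (auto simp: standardized_def)
  have g: "\<bar>\<gamma>\<bar> \<le> 1 + B" using standardized_moments(3)[OF S] \<gamma>_def by simp
  have "1 / (4 * (1 + B)) \<le> 1" using B by simp
  then have z1: "\<bar>z\<bar> \<le> 1" using z by linarith
  then have z2: "z\<^sup>2 \<le> 1" by (simp add: abs_square_le_1)
  have zz: "(1 + B) * \<bar>z\<bar> ^ 3 \<le> z\<^sup>2 / 4"
  proof -
    have "(1 + B) * \<bar>z\<bar> \<le> 1 / 4" using z B by (simp add: field_simps)
    from mult_right_mono[OF this zero_le_power2[of "\<bar>z\<bar>"]] show ?thesis
      by (simp add: power3_eq_cube power2_eq_square mult.assoc)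
  qed
  define c where "c = 1 - z\<^sup>2 / 2 - \<i> * (\<gamma> * z ^ 3 / 6)"
  have "norm c \<le> norm (complex_of_real (1 - z\<^sup>2 / 2)) + norm (\<i> * complex_of_real (\<gamma> * z ^ 3 / 6))"
    unfolding c_def using norm_triangle_ineq4[of "complex_of_real (1 - z\<^sup>2 / 2)" "\<i> * complex_of_real (\<gamma> * z ^ 3 / 6)"] by simp
  also have "\<dots> = \<bar>1 - z\<^sup>2 / 2\<bar> + \<bar>\<gamma>\<bar> * \<bar>z\<bar> ^ 3 / 6"
    by (simp only: norm_mult norm_of_real norm_ii) (simp add: abs_mult power_abs)
  also have "\<dots> \<le> 1 - z\<^sup>2 / 2 + (1 + B) * \<bar>z\<bar> ^ 3 / 6"
    using z2 g by (intro add_mono divide_right_mono mult_right_mono) auto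
  finally have c: "norm c \<le> 1 - z\<^sup>2 / 2 + (1 + B) * \<bar>z\<bar> ^ 3 / 6" .
  have "norm (char (law f) z) \<le> norm (char (law f) z - c) + norm c"
    using norm_triangle_ineq[of "char (law f) z - c" c] by simp
  also have "\<dots> \<le> B * z ^ 4 / 8 + (1 - z\<^sup>2 / 2 + (1 + B) * \<bar>z\<bar> ^ 3 / 6)"
    using char_third_order[OF S \<gamma>_def, of z] c unfolding c_def by (rule add_mono)
  also have "B * z ^ 4 / 8 \<le> (1 + B) * \<bar>z\<bar> ^ 3 / 8"
  proof -
    have "\<bar>z\<bar> ^ 4 \<le> \<bar>z\<bar> ^ 3" using z1 by (intro power_decreasing) auto
    then have "B * \<bar>z\<bar> ^ 4 \<le> (1 + B) * \<bar>z\<bar> ^ 3" using B by (intro mult_mono) auto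
    then show ?thesis by simp
  qed
  also have "(1 + B) * \<bar>z\<bar> ^ 3 / 8 + (1 - z\<^sup>2 / 2 + (1 + B) * \<bar>z\<bar> ^ 3 / 6) \<le> 1 + (- z\<^sup>2 / 4)"
  proof -
    have "0 \<le> (1 + B) * \<bar>z\<bar> ^ 3" using B by simp
    with zz show ?thesis by linarith
  qed
  also have "\<dots> \<le> exp (- z\<^sup>2 / 4)" by (rule exp_ge_add_one_self)
  finally show ?thesis by simp
qed

text \<open>The telescoping estimate for \<open>a^n - b^n\<close>, with the decay of the common bound \<open>r\<close> retained.\<close>
lemma norm_power_diff_le:
  fixes a b :: complex
  assumes "r > 0" "norm a \<le> r" "norm b \<le> r"
  shows "norm (a ^ n - b ^ n) \<le> n * norm (a - b) * r ^ (n - 1)"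
proof (cases n)
  case (Suc m)
  have "norm ((a / r) ^ n - (b / r) ^ n) \<le> n * norm (a / r - b / r)"
    using assms by (intro norm_power_diff) (auto simp: norm_divide)
  also have "(a / r) ^ n - (b / r) ^ n = (a ^ n - b ^ n) / complex_of_real (r ^ n)"
    by (simp add: power_divide diff_divide_distrib)
  also have "norm \<dots> = norm (a ^ n - b ^ n) / r ^ n"
    using assms by (simp add: norm_divide norm_power)
  also have "a / r - b / r = (a - b) / complex_of_real r" by (simp add: diff_divide_distrib)
  also have "norm \<dots> = norm (a - b) / r" using assms by (simp add: norm_divide)
  finally have "norm (a ^ n - b ^ n) \<le> n * (norm (a - b) / r) * r ^ n"
    using assms by (simp add: pos_divide_le_eq)
  then show ?thesis using assms Suc by simp
qed simp

section \<open>Edgeworth expansion uniformly over standardized densities\<close>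

text \<open>
  An integrable function that, up to a constant factor, dominates \<open>n\<close> times the error in the central
  region and \<open>n\<close> times the Edgeworth transform outside it; \<open>1/8\<close> is what remains of the
  exponent \<open>1/4\<close> when the power \<open>n - 1\<close> is estimated by \<open>n/2\<close>.
\<close>
definition gauss_majorant :: "real \<Rightarrow> real" where
  "gauss_majorant \<theta> = (\<theta>\<^sup>2 + \<theta> ^ 4 + \<theta> ^ 6) * exp (- \<theta>\<^sup>2 / 8)"

lemma integrable_gauss_majorant: "integrable lborel gauss_majorant"
proof -
  have "integrable lborel (\<lambda>z::real. z\<^sup>2 * exp (- (1/2 * z)\<^sup>2 / 2) + z ^ 4 * exp (- (1/2 * z)\<^sup>2 / 2) + z ^ 6 * exp (- (1/2 * z)\<^sup>2 / 2))"
    by (intro Bochner_Integration.integrable_add integrable_power_gaussian) auto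
  then show ?thesis
    by (simp add: gauss_majorant_def[abs_def] power_divide algebra_simps)
qed

text \<open>
  With \<open>z = \<theta>/\<surd>n\<close>, replacing \<open>(\<xi> z)^n\<close> by \<open>exp (n w)\<close> costs \<open>n O(z^4) = O(\<theta>^4/n)\<close> times a Gaussian, by
  telescoping. Next, \<open>exp (n w) = exp (-\<theta>\<^sup>2/2) exp (-i y)\<close> with \<open>y = \<gamma> \<theta>^3/(6 \<surd>n)\<close>, and linearizing the
  second factor costs \<open>y\<^sup>2/2 = O(\<theta>^6/n)\<close>.
\<close>
lemma edgeworth_central:
  fixes \<theta> \<gamma> :: real
  assumes S: "standardized M B f" and \<gamma>: "\<gamma> = (LBINT x. f x * x ^ 3)" and n: "n \<ge> 2"
    and \<theta>: "\<bar>\<theta>\<bar> \<le> sqrt n / (4 * (1 + B))"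
  shows "norm (char (law f) (\<theta> / sqrt n) ^ n - edgeworth_transform (\<gamma> / (6 * sqrt n)) \<theta>)
     \<le> 16 * (1 + B) ^ 3 / n * gauss_majorant \<theta>"
proof -
  have B: "0 \<le> B" using S standardized_moments(2)[OF S] by (auto simp: standardized_def)
  have g: "\<bar>\<gamma>\<bar> \<le> 1 + B" using standardized_moments(3)[OF S] \<gamma> by simp
  define r where "r = sqrt (real n)"
  have r: "r > 0" "r * r = n" using n by (auto simp: r_def)
  define z where "z = \<theta> / r"
  have \<theta>z: "\<theta> = z * r" using r by (simp add: z_def)
  have zd: "\<bar>z\<bar> \<le> 1 / (4 * (1 + B))" using \<theta> r B by (simp add: z_def r_def field_simps)
  have "1 / (4 * (1 + B)) \<le> 1" using B by simp
  then have z1: "\<bar>z\<bar> \<le> 1" using zd by linarith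
  have nz2: "n * z\<^sup>2 = \<theta>\<^sup>2" using r by (simp add: \<theta>z power_mult_distrib power2_eq_square)
  have nz3: "n * z ^ 3 = \<theta> ^ 3 / r" using r by (simp add: \<theta>z power_mult_distrib power3_eq_cube)
  have nz4: "n * z ^ 4 = \<theta> ^ 4 / n"
  proof -
    have "\<theta> ^ 4 = z ^ 4 * (r * r) * (r * r)" by (simp add: \<theta>z power_mult_distrib eval_nat_numeral)
    then show ?thesis using n by (simp add: r(2))
  qed
  define w where "w = - z\<^sup>2 / 2 - \<i> * (\<gamma> * z ^ 3 / 6)"
  define \<xi> where "\<xi> = char (law f) z"
  define \<kappa> where "\<kappa> = exp (- z\<^sup>2 / 4)"
  have a: "norm \<xi> \<le> \<kappa>" unfolding \<xi>_def \<kappa>_def by (rule char_gaussian_bound[OF S zd])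
  have b: "norm (exp w) \<le> \<kappa>" by (simp add: w_def \<kappa>_def norm_exp_eq_Re)
  have "norm (\<xi> ^ n - exp w ^ n) \<le> n * norm (\<xi> - exp w) * \<kappa> ^ (n - 1)"
    by (rule norm_power_diff_le[OF _ a b]) (simp add: \<kappa>_def)
  also have "\<dots> \<le> n * (3 * (1 + B)\<^sup>2 * z ^ 4) * exp (- \<theta>\<^sup>2 / 8)"
  proof (intro mult_mono mult_nonneg_nonneg)
    show "norm (\<xi> - exp w) \<le> 3 * (1 + B)\<^sup>2 * z ^ 4"
      unfolding \<xi>_def w_def by (rule char_vs_exponential[OF S \<gamma> z1])
    have "real n / 2 \<le> real (n - 1)" using n by linarith
    then have "real n / 2 * (z\<^sup>2 / 4) \<le> real (n - 1) * (z\<^sup>2 / 4)" by (rule mult_right_mono) simp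
    then have "real (n - 1) * (- z\<^sup>2 / 4) \<le> - \<theta>\<^sup>2 / 8" using nz2 by simp
    then show "\<kappa> ^ (n - 1) \<le> exp (- \<theta>\<^sup>2 / 8)"
      unfolding \<kappa>_def exp_of_nat_mult[symmetric] by simp
  qed (auto simp: \<kappa>_def)
  also have "n * (3 * (1 + B)\<^sup>2 * z ^ 4) * exp (- \<theta>\<^sup>2 / 8) = 3 * (1 + B)\<^sup>2 * (n * z ^ 4) * exp (- \<theta>\<^sup>2 / 8)"
    by (simp only: mult_ac)
  also have "\<dots> = 3 * (1 + B)\<^sup>2 / n * (\<theta> ^ 4 * exp (- \<theta>\<^sup>2 / 8))"
    unfolding nz4 by simp
  finally have 1: "norm (\<xi> ^ n - exp w ^ n) \<le> 3 * (1 + B)\<^sup>2 / n * (\<theta> ^ 4 * exp (- \<theta>\<^sup>2 / 8))" .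
  define y where "y = \<gamma> / (6 * r) * \<theta> ^ 3"
  have vn: "exp w ^ n = of_real (exp (- \<theta>\<^sup>2 / 2)) * iexp (- y)"
  proof -
    have "of_nat n * w = complex_of_real (- (n * z\<^sup>2) / 2) - \<i> * complex_of_real (\<gamma> * (n * z ^ 3) / 6)"
      unfolding w_def by (simp add: algebra_simps)
    also have "\<dots> = complex_of_real (- \<theta>\<^sup>2 / 2) + \<i> * complex_of_real (- y)"
      unfolding nz2 nz3 y_def by simp
    finally have "exp (of_nat n * w) = exp (complex_of_real (- \<theta>\<^sup>2 / 2)) * iexp (- y)"
      by (simp only: exp_add)
    then show ?thesis by (simp only: exp_of_nat_mult exp_of_real)
  qed
  have "norm (iexp (- y) - (\<Sum>k\<le>1. (\<i> * complex_of_real (- y)) ^ k / fact k)) \<le> \<bar>- y\<bar> ^ Suc 1 / fact (Suc 1)"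
    by (rule iexp_approx1)
  then have "norm (iexp (- y) - (1 - \<i> * of_real y)) \<le> y\<^sup>2 / 2"
    by (simp add: power2_eq_square)
  then have "exp (- \<theta>\<^sup>2 / 2) * norm (iexp (- y) - (1 - \<i> * of_real y)) \<le> exp (- \<theta>\<^sup>2 / 2) * (y\<^sup>2 / 2)"
    by (intro mult_left_mono) auto
  moreover have "exp w ^ n - edgeworth_transform (\<gamma> / (6 * r)) \<theta> = of_real (exp (- \<theta>\<^sup>2 / 2)) * (iexp (- y) - (1 - \<i> * of_real y))"
    unfolding vn edgeworth_transform_def y_def by (simp add: algebra_simps)
  ultimately have "norm (exp w ^ n - edgeworth_transform (\<gamma> / (6 * r)) \<theta>) \<le> exp (- \<theta>\<^sup>2 / 2) * (y\<^sup>2 / 2)"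
    by (simp only: norm_mult norm_of_real abs_exp_cancel)
  also have "y\<^sup>2 = \<gamma>\<^sup>2 * \<theta> ^ 6 / (36 * n)"
    using r by (simp add: y_def power_mult_distrib power_divide power2_eq_square[of r] flip: power_mult)
  also have "exp (- \<theta>\<^sup>2 / 2) * (\<gamma>\<^sup>2 * \<theta> ^ 6 / (36 * n) / 2) \<le> exp (- \<theta>\<^sup>2 / 8) * ((1 + B)\<^sup>2 * \<theta> ^ 6 / n / 1)"
  proof (intro mult_mono frac_le)
    show "\<gamma>\<^sup>2 \<le> (1 + B)\<^sup>2" using power_mono[OF g, of 2] by simp
  qed (use n in auto)
  finally have 2: "norm (exp w ^ n - edgeworth_transform (\<gamma> / (6 * r)) \<theta>) \<le> (1 + B)\<^sup>2 / n * (\<theta> ^ 6 * exp (- \<theta>\<^sup>2 / 8))"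
    by (simp add: mult_ac)
  have "norm (\<xi> ^ n - edgeworth_transform (\<gamma> / (6 * r)) \<theta>)
     \<le> 3 * (1 + B)\<^sup>2 / n * (\<theta> ^ 4 * exp (- \<theta>\<^sup>2 / 8)) + (1 + B)\<^sup>2 / n * (\<theta> ^ 6 * exp (- \<theta>\<^sup>2 / 8))"
    using norm_triangle_mono[OF 1 2] by simp
  also have "\<dots> \<le> 16 * (1 + B) ^ 3 / n * (\<theta> ^ 4 * exp (- \<theta>\<^sup>2 / 8)) + 16 * (1 + B) ^ 3 / n * (\<theta> ^ 6 * exp (- \<theta>\<^sup>2 / 8))"
  proof -
    have "(1 + B)\<^sup>2 \<le> (1 + B) ^ 3" using B by (intro power_increasing) auto
    moreover have "0 \<le> (1 + B) ^ 3" using B by simp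
    ultimately have "3 * (1 + B)\<^sup>2 \<le> 16 * (1 + B) ^ 3" "(1 + B)\<^sup>2 \<le> 16 * (1 + B) ^ 3" by linarith+
    then show ?thesis by (intro add_mono mult_right_mono divide_right_mono) auto
  qed
  also have "\<dots> \<le> 16 * (1 + B) ^ 3 / n * gauss_majorant \<theta>"
    using B unfolding distrib_left[symmetric] gauss_majorant_def
    by (intro mult_left_mono) (auto simp: algebra_simps)
  finally show ?thesis by (simp add: \<xi>_def z_def r_def)
qed

text \<open>
  Outside the central region all factors of \<open>\<xi>^n\<close> but two are estimated by \<open>\<eta>\<close>; the remaining square is
  integrable by the Plancherel bound. The Edgeworth transform gains its factor \<open>1/n\<close> from
  \<open>1 \<le> 16 (1 + B)\<^sup>2 \<theta>\<^sup>2 / n\<close>.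
\<close>
lemma edgeworth_tail:
  fixes \<theta> \<gamma> \<eta> :: real
  assumes S: "standardized M B f" and \<gamma>: "\<gamma> = (LBINT x. f x * x ^ 3)" and n: "n \<ge> 2"
    and \<theta>: "\<bar>\<theta>\<bar> \<ge> sqrt n / (4 * (1 + B))" and \<eta>: "norm (char (law f) (\<theta> / sqrt n)) \<le> \<eta>"
  shows "norm (char (law f) (\<theta> / sqrt n) ^ n - edgeworth_transform (\<gamma> / (6 * sqrt n)) \<theta>)
     \<le> \<eta> ^ (n - 2) * (norm (char (law f) (\<theta> / sqrt n)))\<^sup>2 + 16 * (1 + B) ^ 3 / n * gauss_majorant \<theta>"
proof -
  have B: "0 \<le> B" using S standardized_moments(2)[OF S] by (auto simp: standardized_def)
  have g: "\<bar>\<gamma>\<bar> \<le> 1 + B" using standardized_moments(3)[OF S] \<gamma> by simp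
  define \<xi> where "\<xi> = char (law f) (\<theta> / sqrt n)"
  have "norm (\<xi> ^ n) = norm \<xi> ^ (n - 2) * (norm \<xi>)\<^sup>2"
    using n by (metis le_add_diff_inverse2 norm_power power_add)
  also have "\<dots> \<le> \<eta> ^ (n - 2) * (norm \<xi>)\<^sup>2"
    using \<eta> by (intro mult_right_mono power_mono) (auto simp: \<xi>_def)
  finally have 1: "norm (\<xi> ^ n) \<le> \<eta> ^ (n - 2) * (norm \<xi>)\<^sup>2" .
  define c where "c = \<gamma> / (6 * sqrt n)"
  have c: "\<bar>c\<bar> \<le> 1 + B"
  proof -
    have "1 \<le> sqrt n" using n by simp
    then have "1 \<le> 6 * sqrt n" by linarith
    then have "\<bar>\<gamma>\<bar> / (6 * sqrt n) \<le> \<bar>\<gamma>\<bar> / 1" using n by (intro divide_left_mono) auto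
    then show ?thesis using g by (simp add: c_def abs_mult)
  qed
  have "norm (edgeworth_transform c \<theta>) = exp (- \<theta>\<^sup>2 / 2) * norm (1 - \<i> * complex_of_real (c * \<theta> ^ 3))"
    unfolding edgeworth_transform_def norm_mult by simp
  also have "norm (1 - \<i> * complex_of_real (c * \<theta> ^ 3)) \<le> 1 + \<bar>c\<bar> * \<bar>\<theta>\<bar> ^ 3"
    using norm_triangle_ineq4[of 1 "\<i> * complex_of_real (c * \<theta> ^ 3)"]
    by (simp only: norm_mult norm_of_real norm_ii norm_one) (simp add: abs_mult power_abs)
  also have "\<dots> \<le> (1 + B) * (1 + \<bar>\<theta>\<bar> ^ 3)"
    using mult_right_mono[OF c, of "\<bar>\<theta>\<bar> ^ 3"] B by (simp add: algebra_simps)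
  also have "\<dots> \<le> (16 * (1 + B)\<^sup>2 * \<theta>\<^sup>2 / n) * ((1 + B) * (1 + \<bar>\<theta>\<bar> ^ 3))"
  proof -
    have "(sqrt n / (4 * (1 + B)))\<^sup>2 \<le> \<bar>\<theta>\<bar>\<^sup>2" using \<theta> B by (intro power_mono) auto
    then have "real n / (16 * (1 + B)\<^sup>2) \<le> \<theta>\<^sup>2"
      unfolding power_divide power_mult_distrib by simp
    then have "real n \<le> 16 * (1 + B)\<^sup>2 * \<theta>\<^sup>2"
      using B by (subst (asm) pos_divide_le_eq) (auto simp: mult.commute add_nonneg_eq_0_iff)
    then have "1 \<le> 16 * (1 + B)\<^sup>2 * \<theta>\<^sup>2 / n"
      using n by simp
    from mult_right_mono[OF this, of "(1 + B) * (1 + \<bar>\<theta>\<bar> ^ 3)"] B show ?thesis by simp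
  qed
  also have "exp (- \<theta>\<^sup>2 / 2) * ((16 * (1 + B)\<^sup>2 * \<theta>\<^sup>2 / n) * ((1 + B) * (1 + \<bar>\<theta>\<bar> ^ 3)))
     = 16 * (1 + B) ^ 3 / n * ((\<theta>\<^sup>2 * (1 + \<bar>\<theta>\<bar> ^ 3)) * exp (- \<theta>\<^sup>2 / 2))"
    by (simp add: power2_eq_square power3_eq_cube)
  also have "\<dots> \<le> 16 * (1 + B) ^ 3 / n * gauss_majorant \<theta>"
    unfolding gauss_majorant_def
  proof (intro mult_left_mono mult_mono)
    have "0 \<le> (\<bar>\<theta>\<bar> - 1)\<^sup>2 * \<theta> ^ 4 / 2 + (\<theta> ^ 4 + \<theta> ^ 6) / 2" by simp
    moreover have "(\<bar>\<theta>\<bar> - 1)\<^sup>2 * \<theta> ^ 4 / 2 + (\<theta> ^ 4 + \<theta> ^ 6) / 2 = \<theta> ^ 4 + \<theta> ^ 6 - \<theta>\<^sup>2 * \<bar>\<theta>\<bar> ^ 3"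
      by (cases "\<theta> \<ge> 0") (simp_all add: field_simps eval_nat_numeral)
    ultimately show "\<theta>\<^sup>2 * (1 + \<bar>\<theta>\<bar> ^ 3) \<le> \<theta>\<^sup>2 + \<theta> ^ 4 + \<theta> ^ 6" by (simp add: distrib_left)
  qed (use B n in auto)
  finally have 2: "norm (edgeworth_transform c \<theta>) \<le> 16 * (1 + B) ^ 3 / n * gauss_majorant \<theta>" by simp
  have "norm (\<xi> ^ n - edgeworth_transform c \<theta>) \<le> norm (\<xi> ^ n) + norm (edgeworth_transform c \<theta>)"
    by (rule norm_triangle_ineq4)
  also note add_mono[OF 1 2]
  finally show ?thesis unfolding \<xi>_def c_def .
qed

lemma inverse_fourier_scale:
  assumes "r > 0"
  shows "r * inverse_fourier \<xi> (r * x) = inverse_fourier (\<lambda>\<theta>. \<xi> (\<theta> / r)) x"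
proof -
  have "(CLBINT z. iexp (- (z * (r * x))) * \<xi> z)
      = \<bar>1 / r\<bar> *\<^sub>R (CLBINT \<theta>. iexp (- ((0 + 1 / r * \<theta>) * (r * x))) * \<xi> (0 + 1 / r * \<theta>))"
    using assms by (intro lborel_integral_real_affine) auto
  also have "(CLBINT \<theta>. iexp (- ((0 + 1 / r * \<theta>) * (r * x))) * \<xi> (0 + 1 / r * \<theta>)) = (CLBINT \<theta>. iexp (- (\<theta> * x)) * \<xi> (\<theta> / r))"
    using assms by (intro Bochner_Integration.integral_cong) auto
  finally show ?thesis
    using assms by (simp add: inverse_fourier_def scaleR_conv_of_real)
qed

lemma inverse_fourier_diff_le:
  assumes "integrable lborel A" "integrable lborel C"
  shows "\<bar>Re (inverse_fourier A x) - Re (inverse_fourier C x)\<bar> \<le> (LBINT z. norm (A z - C z)) / (2 * pi)"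
proof -
  have "inverse_fourier A x - inverse_fourier C x = 1 / (2 * pi) * (CLBINT z. iexp (- (z * x)) * A z - iexp (- (z * x)) * C z)"
    using integrable_iexp_mult[OF assms(1)] integrable_iexp_mult[OF assms(2)]
    by (simp add: inverse_fourier_def right_diff_distrib diff_divide_distrib)
  moreover have "norm (CLBINT z. iexp (- (z * x)) * A z - iexp (- (z * x)) * C z) \<le> (LBINT z. norm (A z - C z))"
    by (rule order_trans[OF integral_norm_bound])
      (simp add: norm_mult flip: right_diff_distrib)
  ultimately have "norm (inverse_fourier A x - inverse_fourier C x) \<le> (LBINT z. norm (A z - C z)) / (2 * pi)"
    by (simp add: norm_mult norm_divide divide_right_mono)
  then show ?thesis
    using abs_Re_le_cmod[of "inverse_fourier A x - inverse_fourier C x"] by simp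
qed

text \<open>
  The factor \<open>\<surd>n\<close> in front makes \<open>b \<longlonglongrightarrow> 0\<close> say that the error is \<open>o(1/\<surd>n)\<close>. The rate \<open>b\<close> depends on
  the class only, so \<open>f\<close> may vary with \<open>n\<close>.
\<close>
theorem edgeworth_expansion_uniform:
  fixes M B :: real
  assumes M: "M > 0" and B: "B \<ge> 0"
  obtains b :: "nat \<Rightarrow> real" where "b \<longlonglongrightarrow> 0"
    "\<And>f n x. standardized M B f \<Longrightarrow> n \<ge> 3 \<Longrightarrow>
       sqrt n * \<bar>sqrt n * conv_power f n (sqrt n * x) -
         std_normal_density x * (1 + (LBINT x. f x * x ^ 3) / (6 * sqrt n) * (x ^ 3 - 3 * x))\<bar> \<le> b n"
proof -
  have \<delta>: "1 / (4 * (1 + B)) > 0" using B by simp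
  obtain \<eta> where \<eta>: "0 \<le> \<eta>" "\<eta> < 1"
    "\<And>f z. bounded_density M f \<Longrightarrow> integrable lborel (\<lambda>x. f x * x\<^sup>2) \<Longrightarrow> (LBINT x. f x * x\<^sup>2) = 1 \<Longrightarrow>
       1 / (4 * (1 + B)) \<le> \<bar>z\<bar> \<Longrightarrow> norm (char (law f) z) \<le> \<eta>"
    by (rule char_bounded_away_from_one[OF M \<delta>]) (rule that; assumption)
  define G where "G = (LBINT \<theta>. gauss_majorant \<theta>)"
  define C where "C = 16 * (1 + B) ^ 3"
  have C: "C \<ge> 0" using B by (simp add: C_def)
  define b where "b n = C * G / (2 * pi) * (1 / sqrt n) + M * (n * \<eta> ^ (n - 2))" for n :: nat
  have "b \<longlonglongrightarrow> 0"
  proof -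
    have "(\<lambda>n::nat. real (n + 2) * \<eta> ^ n) \<longlonglongrightarrow> 0"
      using tendsto_add[OF powser_times_n_limit_0[of \<eta>] tendsto_mult_right_zero[OF LIMSEQ_power_zero[of \<eta>], of 2]] \<eta>
      by (simp add: distrib_right add.commute)
    then have "(\<lambda>n::nat. real (n + 2) * \<eta> ^ ((n + 2) - 2)) \<longlonglongrightarrow> 0" by simp
    then have 1: "(\<lambda>n::nat. real n * \<eta> ^ (n - 2)) \<longlonglongrightarrow> 0"
      by (rule LIMSEQ_offset)
    have 2: "(\<lambda>n::nat. 1 / sqrt n) \<longlonglongrightarrow> 0"
      by (intro tendsto_divide_0[OF tendsto_const] filterlim_at_top_imp_at_infinity filterlim_compose[OF sqrt_at_top filterlim_real_sequentially])
    have "b \<longlonglongrightarrow> C * G / (2 * pi) * 0 + M * 0"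
      unfolding b_def by (intro tendsto_intros 1 2)
    then show ?thesis by simp
  qed
  moreover have "sqrt n * \<bar>sqrt n * conv_power f n (sqrt n * x) -
         std_normal_density x * (1 + (LBINT x. f x * x ^ 3) / (6 * sqrt n) * (x ^ 3 - 3 * x))\<bar> \<le> b n"
    if S: "standardized M B f" and n: "n \<ge> 3" for f n x
  proof -
    have F: "bounded_density M f" and v: "(LBINT x. f x * x\<^sup>2) = 1"
      using S by (auto simp: standardized_def)
    interpret f: real_distribution "law f" by (rule real_distribution_law[OF F])
    define r where "r = sqrt (real n)"
    have r: "r > 0" "r * r = n" using n by (auto simp: r_def)
    define \<gamma> where "\<gamma> = (LBINT x. f x * x ^ 3)"
    define A where "A \<theta> = char (law f) (\<theta> / r) ^ n" for \<theta>
    define E where "E = edgeworth_transform (\<gamma> / (6 * r))"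
    define P where "P \<theta> = (norm (char (law f) (\<theta> / r)))\<^sup>2" for \<theta>
    have Ai: "integrable lborel A"
      using lborel_integrable_real_affine[OF integrable_char_power[OF F, of n], of "1 / r" 0] n r
      by (simp add: A_def[abs_def])
    have Pi: "integrable lborel P"
      using lborel_integrable_real_affine[OF plancherel_bound(1)[OF F], of "1 / r" 0] r
      by (simp add: P_def[abs_def])
    have Ei: "integrable lborel E" unfolding E_def by (rule edgeworth_transform_inverse)
    have PI: "(LBINT \<theta>. P \<theta>) \<le> r * (2 * pi * M)"
    proof -
      have "(LBINT z. (norm (char (law f) z))\<^sup>2) = \<bar>1 / r\<bar> *\<^sub>R (LBINT \<theta>. (norm (char (law f) (0 + 1 / r * \<theta>)))\<^sup>2)"
        using r by (intro lborel_integral_real_affine) auto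
      then have "(LBINT \<theta>. P \<theta>) = r * (LBINT z. (norm (char (law f) z))\<^sup>2)"
        using r by (simp add: P_def)
      then show ?thesis using plancherel_bound(2)[OF F] r by simp
    qed
    have pt: "norm (A \<theta> - E \<theta>) \<le> \<eta> ^ (n - 2) * P \<theta> + C / n * gauss_majorant \<theta>" for \<theta>
    proof (cases "\<bar>\<theta>\<bar> \<le> r / (4 * (1 + B))")
      case True
      then have "norm (A \<theta> - E \<theta>) \<le> C / n * gauss_majorant \<theta>"
        using edgeworth_central[OF S \<gamma>_def, of n \<theta>] n by (simp add: A_def E_def r_def C_def)
      moreover have "0 \<le> \<eta> ^ (n - 2) * P \<theta>" using \<eta> by (simp add: P_def)
      ultimately show ?thesis by linarith
    next
      case False
      then have "1 / (4 * (1 + B)) \<le> \<bar>\<theta> / r\<bar>" using r B by (simp add: field_simps)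
      then have "norm (char (law f) (\<theta> / r)) \<le> \<eta>"
        using \<eta>(3)[OF F _ v] standardized_moments(1)[OF S, of 2] by simp
      then show ?thesis
        using edgeworth_tail[OF S \<gamma>_def, of n \<theta> \<eta>] n False by (simp add: A_def E_def r_def C_def P_def)
    qed
    have "(LBINT \<theta>. norm (A \<theta> - E \<theta>)) \<le> (LBINT \<theta>. \<eta> ^ (n - 2) * P \<theta> + C / n * gauss_majorant \<theta>)"
      by (intro integral_mono pt integrable_norm Bochner_Integration.integrable_diff Bochner_Integration.integrable_add
          integrable_mult_right Ai Ei Pi integrable_gauss_majorant)
    also have "\<dots> = \<eta> ^ (n - 2) * (LBINT \<theta>. P \<theta>) + C / n * G"
      using Pi integrable_gauss_majorant by (simp add: G_def)
    also have "\<dots> \<le> \<eta> ^ (n - 2) * (r * (2 * pi * M)) + C / n * G"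
      using PI \<eta> by (intro add_right_mono mult_left_mono) auto
    finally have L: "(LBINT \<theta>. norm (A \<theta> - E \<theta>)) \<le> \<eta> ^ (n - 2) * (r * (2 * pi * M)) + C / n * G" .
    have "r * conv_power f n (r * x) = Re (r * inverse_fourier (\<lambda>z. char (law f) z ^ n) (r * x))"
      by (simp add: conv_power_inversion[OF F n])
    also have "\<dots> = Re (inverse_fourier A x)"
      by (subst inverse_fourier_scale[OF r(1)]) (simp add: A_def[abs_def])
    finally have "\<bar>r * conv_power f n (r * x) - std_normal_density x * (1 + \<gamma> / (6 * r) * (x ^ 3 - 3 * x))\<bar>
       = \<bar>Re (inverse_fourier A x) - Re (inverse_fourier E x)\<bar>"
      unfolding E_def edgeworth_transform_inverse(2) by (simp only: Re_complex_of_real)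
    also have "\<dots> \<le> (LBINT z. norm (A z - E z)) / (2 * pi)"
      by (rule inverse_fourier_diff_le[OF Ai Ei])
    also have "\<dots> \<le> (\<eta> ^ (n - 2) * (r * (2 * pi * M)) + C / n * G) / (2 * pi)"
      by (intro divide_right_mono L) simp
    finally have "r * \<bar>r * conv_power f n (r * x) - std_normal_density x * (1 + \<gamma> / (6 * r) * (x ^ 3 - 3 * x))\<bar>
      \<le> r * ((\<eta> ^ (n - 2) * (r * (2 * pi * M)) + C / n * G) / (2 * pi))"
      using r by (intro mult_left_mono) auto
    also have "\<dots> = b n"
    proof -
      have "real n = r * r" using r by simp
      then show ?thesis unfolding b_def r_def[symmetric] using r(1) by (simp add: field_simps)
    qed
    finally show ?thesis by (simp add: r_def \<gamma>_def)
  qed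
  ultimately show ?thesis by (rule that)
qed

section \<open>Standardized densities below a Laplace profile\<close>

lemma has_bochner_integral_abs_power_exp:
  "has_bochner_integral lborel (\<lambda>x::real. \<bar>x\<bar> ^ k * exp (- \<bar>x\<bar>)) (2 * fact k)"
proof -
  have "has_bochner_integral lborel (\<lambda>x::real. indicator {0..} x *\<^sub>R (\<bar>x\<bar> ^ k * exp (- \<bar>x\<bar>))) (fact k)"
  proof (rule has_bochner_integral_nn_integral)
    have "(\<integral>\<^sup>+x. ennreal (indicator {0..} x *\<^sub>R (\<bar>x\<bar> ^ k * exp (- \<bar>x\<bar>))) \<partial>lborel)
      = (\<integral>\<^sup>+x. ennreal (x^k * exp (-x)) * indicator {0 ..} x \<partial>lborel)"
      by (intro nn_integral_cong) (auto simp: indicator_def)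
    then show "(\<integral>\<^sup>+x. ennreal (indicator {0..} x *\<^sub>R (\<bar>x\<bar> ^ k * exp (- \<bar>x\<bar>))) \<partial>lborel) = ennreal (fact k)"
      by (simp add: nn_intergal_power_times_exp_Ici)
  qed auto
  from has_bochner_integral_even_function[OF this] show ?thesis by simp
qed

lemma has_bochner_integral_laplace_moment:
  fixes b \<kappa> :: real
  assumes "\<kappa> > 0"
  shows "has_bochner_integral lborel (\<lambda>x. \<bar>x - b\<bar> ^ k * exp (- \<kappa> * \<bar>x - b\<bar>)) (2 * fact k / \<kappa> ^ Suc k)"
proof -
  have "has_bochner_integral lborel (\<lambda>x. \<bar>- \<kappa> * b + \<kappa> * x\<bar> ^ k * exp (- \<bar>- \<kappa> * b + \<kappa> * x\<bar>)) ((2 * fact k) /\<^sub>R \<bar>\<kappa>\<bar>)"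
    using has_bochner_integral_abs_power_exp[of k] assms
    by (subst (asm) lborel_has_bochner_integral_real_affine_iff[where c=\<kappa> and t="- \<kappa> * b"]) auto
  also have "(\<lambda>x. \<bar>- \<kappa> * b + \<kappa> * x\<bar> ^ k * exp (- \<bar>- \<kappa> * b + \<kappa> * x\<bar>)) = (\<lambda>x. \<kappa> ^ k * (\<bar>x - b\<bar> ^ k * exp (- \<kappa> * \<bar>x - b\<bar>)))"
  proof
    fix x
    have "\<bar>- \<kappa> * b + \<kappa> * x\<bar> = \<kappa> * \<bar>x - b\<bar>"
      using assms by (simp add: abs_mult flip: right_diff_distrib)
    then show "\<bar>- \<kappa> * b + \<kappa> * x\<bar> ^ k * exp (- \<bar>- \<kappa> * b + \<kappa> * x\<bar>) = \<kappa> ^ k * (\<bar>x - b\<bar> ^ k * exp (- \<kappa> * \<bar>x - b\<bar>))"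
      by (simp add: power_mult_distrib)
  qed
  finally have "has_bochner_integral lborel (\<lambda>x. (1 / \<kappa> ^ k) * (\<kappa> ^ k * (\<bar>x - b\<bar> ^ k * exp (- \<kappa> * \<bar>x - b\<bar>)))) ((1 / \<kappa> ^ k) * ((2 * fact k) /\<^sub>R \<bar>\<kappa>\<bar>))"
    by (intro has_bochner_integral_mult_right)
  then show ?thesis using assms by (simp add: field_simps)
qed

lemma power4_add_le: fixes x y :: real shows "(x + y) ^ 4 \<le> 8 * (x ^ 4 + y ^ 4)"
proof -
  have sq: "(u + v)\<^sup>2 \<le> 2 * (u\<^sup>2 + v\<^sup>2)" for u v :: real
    using zero_le_power2[of "u - v"] by (simp add: power2_eq_square algebra_simps)
  have "(x + y) ^ 4 = ((x + y)\<^sup>2)\<^sup>2" by simp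
  also have "\<dots> \<le> (2 * (x\<^sup>2 + y\<^sup>2))\<^sup>2" by (intro power_mono sq) simp
  also have "\<dots> = 4 * (x\<^sup>2 + y\<^sup>2)\<^sup>2" unfolding power_mult_distrib by simp
  also have "\<dots> \<le> 4 * (2 * ((x\<^sup>2)\<^sup>2 + (y\<^sup>2)\<^sup>2))" by (intro mult_left_mono sq) simp
  finally show ?thesis by simp
qed

text \<open>
  A density below \<open>m\<close> leaves mass at least \<open>1/2\<close> outside the interval of half-length \<open>1/(4m)\<close>, so its
  second moment cannot be much smaller than \<open>1/m\<^sup>2\<close>.
\<close>
lemma bounded_density_scale_le:
  fixes m :: real
  assumes F: "bounded_density m f" and m: "m > 0" and i2: "integrable lborel (\<lambda>x. f x * x\<^sup>2)" and v: "(LBINT x. f x * x\<^sup>2) = 1"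
  shows "1 \<le> 32 * m\<^sup>2"
proof -
  note f = bounded_densityD[OF F]
  note [measurable] = f(1)
  define r where "r = 1 / (4 * m)"
  have r: "r > 0" using m by (simp add: r_def)
  have ii: "integrable lborel (\<lambda>x. f x * indicator {-r..r} x)"
    by (rule Bochner_Integration.integrable_bound[OF f(4)]) (auto simp: f indicator_def)
  have "(LBINT x. f x * indicator {-r..r} x) \<le> (LBINT x. m * indicator {-r..r} x)"
    using f r by (intro integral_mono ii) (auto intro!: mult_right_mono)
  also have "\<dots> = 1 / 2" using r m by (simp add: r_def)
  finally have P: "(LBINT x. f x * indicator {-r..r} x) \<le> 1 / 2" .
  have "r\<^sup>2 * (1 / 2) \<le> r\<^sup>2 * (1 - (LBINT x. f x * indicator {-r..r} x))"
    using P by (intro mult_left_mono) auto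
  also have "\<dots> = (LBINT x. r\<^sup>2 * (f x - f x * indicator {-r..r} x))"
    using f ii by simp
  also have "\<dots> \<le> (LBINT x. f x * x\<^sup>2)"
  proof (intro integral_mono i2)
    fix x
    show "r\<^sup>2 * (f x - f x * indicator {-r..r} x) \<le> f x * x\<^sup>2"
    proof (cases "x \<in> {-r..r}")
      case False
      then have "r\<^sup>2 \<le> \<bar>x\<bar>\<^sup>2" using r by (intro power_mono) auto
      from mult_right_mono[OF this f(2)[of x]] False show ?thesis by (simp add: mult.commute)
    qed (simp add: f)
  qed (intro integrable_mult_right Bochner_Integration.integrable_diff f(4) ii)
  finally have "r\<^sup>2 \<le> 2" using v by simp
  then show ?thesis using m by (simp add: r_def power_divide power_mult_distrib field_simps)
qed

text \<open>
  The location \<open>b\<close> and the scale \<open>1/\<kappa>\<close> do not enter the constants. The profile gives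
  \<open>1 + b\<^sup>2 = \<integral>(x - b)\<^sup>2 f x dx \<le> 4 K / \<kappa>\<^sup>2\<close>, which bounds \<open>\<kappa>\<close> from above and \<open>\<bar>b\<bar>\<close> in units of \<open>1/\<kappa>\<close>; unit
  variance and the height \<open>K \<kappa>\<close> bound \<open>\<kappa>\<close> from below.
\<close>
lemma standardized_of_laplace_bound:
  fixes K \<kappa> b :: real
  assumes F: "f \<in> borel_measurable borel" "\<And>x. 0 \<le> f x" "integrable lborel f" "(LBINT x. f x) = 1"
    and m: "(LBINT x. f x * x) = 0" "(LBINT x. f x * x\<^sup>2) = 1"
    and K: "K > 0" and \<kappa>: "\<kappa> > 0"
    and le: "\<And>x. f x \<le> K * \<kappa> * exp (- \<kappa> * \<bar>x - b\<bar>)"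
  shows "standardized (K * (1 + 4 * K)) (1024 * K ^ 4 * (384 * K + 128 * K\<^sup>2)) f"
proof -
  note [measurable] = F(1)
  have dom: "f x * \<bar>x - b\<bar> ^ k \<le> K * \<kappa> * (\<bar>x - b\<bar> ^ k * exp (- \<kappa> * \<bar>x - b\<bar>))" for x k
    using mult_right_mono[OF le[of x], of "\<bar>x - b\<bar> ^ k"] by (simp add: mult_ac)
  have ci: "integrable lborel (\<lambda>x. f x * \<bar>x - b\<bar> ^ k)"
    and cl: "(LBINT x. f x * \<bar>x - b\<bar> ^ k) \<le> K * (2 * fact k) / \<kappa> ^ k" for k
  proof -
    have h: "has_bochner_integral lborel (\<lambda>x. K * \<kappa> * (\<bar>x - b\<bar> ^ k * exp (- \<kappa> * \<bar>x - b\<bar>))) (K * \<kappa> * (2 * fact k / \<kappa> ^ Suc k))"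
      by (intro has_bochner_integral_mult_right has_bochner_integral_laplace_moment \<kappa>)
    then have hi: "integrable lborel (\<lambda>x. K * \<kappa> * (\<bar>x - b\<bar> ^ k * exp (- \<kappa> * \<bar>x - b\<bar>)))"
      by (simp only: has_bochner_integral_iff)
    show ci: "integrable lborel (\<lambda>x. f x * \<bar>x - b\<bar> ^ k)"
    proof (rule Bochner_Integration.integrable_bound[OF hi])
      show "AE x in lborel. norm (f x * \<bar>x - b\<bar> ^ k) \<le> norm (K * \<kappa> * (\<bar>x - b\<bar> ^ k * exp (- \<kappa> * \<bar>x - b\<bar>)))"
        using dom F(2) K \<kappa> by (intro AE_I2) (simp add: abs_mult)
    qed measurable
    have "(LBINT x. f x * \<bar>x - b\<bar> ^ k) \<le> K * \<kappa> * (2 * fact k / \<kappa> ^ Suc k)"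
      using integral_mono[OF ci hi dom] has_bochner_integral_integral_eq[OF h] by simp
    then show "(LBINT x. f x * \<bar>x - b\<bar> ^ k) \<le> K * (2 * fact k) / \<kappa> ^ k"
      using \<kappa> by simp
  qed
  have i1: "integrable lborel (\<lambda>x. f x * x)"
  proof (rule Bochner_Integration.integrable_bound)
    show "integrable lborel (\<lambda>x. f x * \<bar>x - b\<bar> ^ 1 + \<bar>b\<bar> * f x)" using ci[of 1] F(3) by simp
    have "\<bar>f x * x\<bar> \<le> f x * \<bar>x - b\<bar> ^ 1 + \<bar>b\<bar> * f x" for x
    proof -
      have "f x * \<bar>x\<bar> \<le> f x * (\<bar>x - b\<bar> + \<bar>b\<bar>)" using F(2) by (intro mult_left_mono) auto
      then show ?thesis using F(2)[of x] by (simp add: abs_mult algebra_simps)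
    qed
    then show "AE x in lborel. norm (f x * x) \<le> norm (f x * \<bar>x - b\<bar> ^ 1 + \<bar>b\<bar> * f x)"
      using F(2) by (intro AE_I2) (auto intro: order_trans[OF _ abs_ge_self])
  qed measurable
  have i2: "integrable lborel (\<lambda>x. f x * x\<^sup>2)"
    using m(2) not_integrable_integral_eq by fastforce
  have "1 + b\<^sup>2 = (LBINT x. f x * x\<^sup>2 - 2 * b * (f x * x) + b\<^sup>2 * f x)"
    using i1 i2 F m by simp
  also have "\<dots> = (LBINT x. f x * \<bar>x - b\<bar> ^ 2)"
    by (intro Bochner_Integration.integral_cong) (auto simp: power2_eq_square algebra_simps)
  also have "\<dots> \<le> 4 * K / \<kappa>\<^sup>2" using cl[of 2] by (simp add: mult.commute)
  finally have var: "1 + b\<^sup>2 \<le> 4 * K / \<kappa>\<^sup>2" .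
  have "1 \<le> 4 * K / \<kappa>\<^sup>2" using var zero_le_power2[of b] by linarith
  then have \<kappa>2: "\<kappa>\<^sup>2 \<le> 4 * K" using \<kappa> by (simp add: field_simps)
  have "\<kappa> \<le> 1 + \<kappa>\<^sup>2" using abs_power_le_one_plus[of 1 2 \<kappa>] \<kappa> by simp
  then have "K * \<kappa> \<le> K * (1 + 4 * K)" using \<kappa>2 K by (intro mult_left_mono) auto
  moreover have f\<kappa>: "f x \<le> K * \<kappa>" for x
  proof -
    have "K * \<kappa> * exp (- \<kappa> * \<bar>x - b\<bar>) \<le> K * \<kappa> * 1"
      using K \<kappa> by (intro mult_left_mono) auto
    then show ?thesis using le[of x] by simp
  qed
  ultimately have "f x \<le> K * (1 + 4 * K)" for x using order_trans by blast
  then have bd: "bounded_density (K * (1 + 4 * K)) f" using F by (simp add: bounded_density_def)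
  have "bounded_density (K * \<kappa>) f" using F f\<kappa> by (simp add: bounded_density_def)
  then have "1 \<le> 32 * (K * \<kappa>)\<^sup>2"
    using bounded_density_scale_le[OF _ _ i2 m(2), of "K * \<kappa>"] K \<kappa> by simp
  then have "1 / \<kappa>\<^sup>2 \<le> 32 * K\<^sup>2"
    using \<kappa> by (simp add: pos_divide_le_eq power_mult_distrib mult_ac)
  then have "(1 / \<kappa>\<^sup>2)\<^sup>2 \<le> (32 * K\<^sup>2)\<^sup>2" by (intro power_mono) auto
  then have \<kappa>4: "1 / \<kappa> ^ 4 \<le> 1024 * K ^ 4" by (simp add: power_divide power_mult_distrib flip: power_mult)
  have "b\<^sup>2 \<le> 4 * K / \<kappa>\<^sup>2" using var by simp
  then have "(b\<^sup>2)\<^sup>2 \<le> (4 * K / \<kappa>\<^sup>2)\<^sup>2" by (intro power_mono) auto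
  then have b4: "b ^ 4 \<le> 16 * K\<^sup>2 / \<kappa> ^ 4" by (simp add: power_divide power_mult_distrib flip: power_mult)
  have p4: "f x * x ^ 4 \<le> 8 * (f x * \<bar>x - b\<bar> ^ 4) + 8 * b ^ 4 * f x" for x
    using mult_left_mono[OF power4_add_le[of "x - b" b] F(2)[of x]] by (simp add: algebra_simps)
  have i4': "integrable lborel (\<lambda>x. 8 * (f x * \<bar>x - b\<bar> ^ 4) + 8 * b ^ 4 * f x)"
    by (intro Bochner_Integration.integrable_add integrable_mult_right ci F(3))
  have i4: "integrable lborel (\<lambda>x. f x * x ^ 4)"
  proof (rule Bochner_Integration.integrable_bound[OF i4'])
    have "\<bar>f x * x ^ 4\<bar> \<le> 8 * (f x * \<bar>x - b\<bar> ^ 4) + 8 * b ^ 4 * f x" for x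
      using p4[of x] F(2)[of x] by simp
    then show "AE x in lborel. norm (f x * x ^ 4) \<le> norm (8 * (f x * \<bar>x - b\<bar> ^ 4) + 8 * b ^ 4 * f x)"
      by (intro AE_I2) (metis abs_ge_self order_trans real_norm_def)
  qed measurable
  have "(LBINT x. f x * x ^ 4) \<le> (LBINT x. 8 * (f x * \<bar>x - b\<bar> ^ 4) + 8 * b ^ 4 * f x)"
    by (rule integral_mono[OF i4 i4' p4])
  also have "\<dots> = 8 * (LBINT x. f x * \<bar>x - b\<bar> ^ 4) + 8 * b ^ 4"
    by (subst Bochner_Integration.integral_add) (use ci[of 4] F in auto)
  also have "\<dots> \<le> 8 * (K * (2 * fact 4) / \<kappa> ^ 4) + 8 * (16 * K\<^sup>2 / \<kappa> ^ 4)"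
    using cl[of 4] b4 by linarith
  also have "\<dots> = (1 / \<kappa> ^ 4) * (384 * K + 128 * K\<^sup>2)"
    by (simp add: fact_numeral add_divide_distrib)
  also have "\<dots> \<le> 1024 * K ^ 4 * (384 * K + 128 * K\<^sup>2)"
    using \<kappa>4 K by (intro mult_right_mono) auto
  finally have "(LBINT x. f x * x ^ 4) \<le> 1024 * K ^ 4 * (384 * K + 128 * K\<^sup>2)" .
  then show ?thesis using bd i4 m by (simp add: standardized_def)
qed

section \<open>Exponential decay of log-concave functions\<close>

text \<open>
  Let \<open>H = exp (-f x0)\<close> be the maximum and \<open>z\<close> the point at distance \<open>r = e W/H\<close> from \<open>x0\<close> towards \<open>x\<close>.
  The function \<open>exp (-f)\<close> is at least \<open>exp (-f z)\<close> between \<open>x0\<close> and \<open>z\<close>, so \<open>r exp (-f z) \<le> W\<close>, that is, \<open>f\<close> has grown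
  by at least \<open>1\<close> over the distance \<open>r\<close>. By convexity it keeps growing at least at the rate \<open>1/r\<close>.
\<close>
lemma log_concave_decay:
  fixes f :: "real \<Rightarrow> real"
  assumes conv: "convex_on {0..} f" and int: "set_integrable lborel {0..} (\<lambda>x. exp (- f x))"
    and W: "W = (LBINT x:{0..}. exp (- f x))" "W > 0"
    and x0: "0 \<le> x0" and min: "\<And>x. 0 \<le> x \<Longrightarrow> f x0 \<le> f x" and x: "0 \<le> x"
  defines "r \<equiv> exp 1 * W / exp (- f x0)"
  shows "exp (- f x) \<le> exp 1 * exp (- f x0) * exp (- \<bar>x - x0\<bar> / r)"
proof -
  have r: "r > 0" using W by (simp add: r_def)
  show ?thesis
  proof (cases "\<bar>x - x0\<bar> \<le> r")
    case True
    then have "\<bar>x - x0\<bar> / r \<le> 1" using r by simp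
    then show ?thesis using min[OF x] by (simp flip: exp_add)
  next
    case False
    define y where "y = \<bar>x - x0\<bar>"
    have y: "y > r" "y > 0" using False r by (auto simp: y_def)
    define z where "z = (1 - r / y) *\<^sub>R x0 + (r / y) *\<^sub>R x"
    have ry: "0 \<le> r / y" "r / y \<le> 1" using y r by auto
    have z0: "0 \<le> z" unfolding z_def real_scaleR_def using ry x x0 by (intro add_nonneg_nonneg mult_nonneg_nonneg) auto
    have fz: "f z \<le> (1 - r / y) * f x0 + (r / y) * f x"
      unfolding z_def using convex_onD[OF conv ry, of x0 x] x x0 by simp
    have zx: "\<bar>z - x0\<bar> = r"
    proof -
      have "z - x0 = (r / y) * (x - x0)" by (simp add: z_def algebra_simps diff_divide_distrib)
      then have "\<bar>z - x0\<bar> = (r / y) * y" using r y by (simp add: abs_mult y_def)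
      then show ?thesis using y by simp
    qed
    define I where "I = closed_segment x0 z"
    have I0: "I \<subseteq> {0..}" using x0 z0 by (auto simp: I_def closed_segment_eq_real_ivl split: if_splits)
    have [measurable]: "I \<in> sets borel" by (simp add: I_def closed_segment_eq_real_ivl)
    have Im: "measure lborel I = r" "emeasure lborel I < \<infinity>"
      using zx by (auto simp: I_def closed_segment_eq_real_ivl split: if_splits)
    have le: "f u \<le> f z" if uI: "u \<in> I" for u
    proof -
      obtain \<mu> where \<mu>: "0 \<le> \<mu>" "\<mu> \<le> 1" "u = (1 - \<mu>) *\<^sub>R x0 + \<mu> *\<^sub>R z"
        using uI unfolding I_def in_segment by blast
      have "f u \<le> (1 - \<mu>) * f x0 + \<mu> * f z"
        unfolding \<mu>(3) using convex_onD[OF conv \<mu>(1,2), of x0 z] x0 z0 by simp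
      also have "\<dots> \<le> (1 - \<mu>) * f z + \<mu> * f z"
        using \<mu> min[OF z0] by (intro add_right_mono mult_left_mono) auto
      finally show ?thesis by (simp add: algebra_simps)
    qed
    have "r * exp (- f z) = (LBINT u. indicator I u * exp (- f z))"
      using Im by simp
    also have "\<dots> \<le> (LBINT u. indicator {0..} u *\<^sub>R exp (- f u))"
    proof (rule integral_mono)
      show "integrable lborel (\<lambda>u. indicator I u * exp (- f z))" using Im by simp
      show "integrable lborel (\<lambda>u. indicator {0..} u *\<^sub>R exp (- f u))" using int by (simp add: set_integrable_def)
      show "indicator I u * exp (- f z) \<le> indicator {0..} u *\<^sub>R exp (- f u)" for u
        using le[of u] I0 by (auto simp: indicator_def)
    qed
    also have "\<dots> = W" using W(1) by (simp add: set_lebesgue_integral_def)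
    finally have "exp (- f z) \<le> W / r" using r by (simp add: field_simps)
    also have "\<dots> = exp (- f x0 - 1)"
      using W(2) by (simp add: r_def exp_diff)
    finally have "f x0 + 1 \<le> f z" by simp
    with fz have "1 \<le> (r / y) * (f x - f x0)" by (simp add: algebra_simps)
    then have "y / r \<le> f x - f x0" using y r by (simp add: field_simps)
    then have "exp (- f x) \<le> exp (- f x0) * exp (- y / r)" by (simp flip: exp_add)
    also have "\<dots> \<le> exp 1 * (exp (- f x0) * exp (- y / r))" by simp
    finally show ?thesis by (simp add: y_def mult.assoc)
  qed
qed

text \<open>
  The previous bound in the form of a Laplace profile: with \<open>\<kappa> = 1/r\<close> the prefactor is
  \<open>e H = e\<^sup>2 \<kappa> W\<close>.
\<close>
lemma log_concave_laplace_bound: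
  fixes f :: "real \<Rightarrow> real"
  assumes conv: "convex_on {0..} f" and cont: "continuous_on {0..} f" and lim: "filterlim f at_top at_top"
    and int: "set_integrable lborel {0..} (\<lambda>x. exp (- f x))" and W: "0 < (LBINT x:{0..}. exp (- f x))"
  obtains x0 \<kappa> where "\<kappa> > 0"
    "\<And>x. 0 \<le> x \<Longrightarrow> exp (- f x) \<le> exp 2 * \<kappa> * (LBINT x:{0..}. exp (- f x)) * exp (- \<kappa> * \<bar>x - x0\<bar>)"
proof -
  obtain R where R: "\<And>x. x \<ge> R \<Longrightarrow> f 0 \<le> f x"
    using lim[unfolded filterlim_at_top] by (auto simp: eventually_at_top_linorder)
  have "\<exists>x\<in>{0..max 0 R}. \<forall>y\<in>{0..max 0 R}. f x \<le> f y"
    by (intro continuous_attains_inf continuous_on_subset[OF cont]) auto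
  then obtain x0 where x0: "0 \<le> x0" "\<And>y. 0 \<le> y \<Longrightarrow> y \<le> max 0 R \<Longrightarrow> f x0 \<le> f y" by auto
  have min: "f x0 \<le> f x" if "0 \<le> x" for x
  proof (cases "x \<le> max 0 R")
    case False
    then have "f 0 \<le> f x" by (intro R) auto
    then show ?thesis using x0(2)[of 0] by auto
  qed (use x0(2) that in auto)
  define W where "W = (LBINT x:{0..}. exp (- f x))"
  define \<kappa> where "\<kappa> = exp (- f x0) / (exp 1 * W)"
  have W0: "W > 0" using W by (simp add: W_def)
  show ?thesis
  proof (rule that)
    show "\<kappa> > 0" using W0 by (simp add: \<kappa>_def)
    fix x :: real assume "0 \<le> x"
    have "exp 2 * \<kappa> * W = exp 1 * exp (- f x0)"
    proof -
      have "exp 2 = exp 1 * exp (1::real)" by (simp flip: exp_add)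
      then show ?thesis using W0 by (simp add: \<kappa>_def)
    qed
    moreover have "- \<bar>x - x0\<bar> / (exp 1 * W / exp (- f x0)) = - \<kappa> * \<bar>x - x0\<bar>"
      by (simp add: \<kappa>_def)
    ultimately show "exp (- f x) \<le> exp 2 * \<kappa> * (LBINT x:{0..}. exp (- f x)) * exp (- \<kappa> * \<bar>x - x0\<bar>)"
      using log_concave_decay[OF conv int W_def W0 x0(1) min \<open>0 \<le> x\<close>] by (simp add: W_def)
  qed
qed

section \<open>Exponential tilting and its cumulants\<close>

lemma integral_pos_of_pos:
  fixes u :: "real \<Rightarrow> real"
  assumes int: "integrable lborel u" and nn: "\<And>x. 0 \<le> u x" and pos: "\<And>x. 0 \<le> x \<Longrightarrow> x \<noteq> a \<Longrightarrow> 0 < u x"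
  shows "0 < (LBINT x. u x)"
proof (rule ccontr)
  assume "\<not> ?thesis"
  moreover have "0 \<le> (LBINT x. u x)" using nn by (intro Bochner_Integration.integral_nonneg)
  ultimately have "(LBINT x. u x) = 0" by linarith
  then have ae: "AE x in lborel. u x = 0"
    using integral_nonneg_eq_0_iff_AE[OF int] nn by auto
  define b where "b = max 0 a"
  have "AE x in lborel. indicator {b<..b + 1} x = (0::real)"
    using ae
  proof eventually_elim
    case (elim x)
    then show ?case using pos[of x] by (auto simp: b_def indicator_def)
  qed
  then have "(LBINT x. indicator {b<..b + 1} x) = (0::real)"
    by (rule integral_eq_zero_AE)
  then show False by simp
qed

text \<open>
  A function on the half line that decays faster than every exponential, so that all of its tilted
  moments are finite.
\<close>
locale superexponential_density =
  fixes p :: "real \<Rightarrow> real"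
  assumes p_meas [measurable]: "p \<in> borel_measurable borel"
    and p_neg: "x < 0 \<Longrightarrow> p x = 0"
    and p_pos: "0 \<le> x \<Longrightarrow> 0 < p x"
    and p_decay: "\<exists>C. \<forall>x\<ge>0. p x \<le> C * exp (- t * x)"
begin

lemma p_nonneg: "0 \<le> p x"
  using p_neg[of x] p_pos[of x] by (cases "x < 0") auto

definition moment :: "nat \<Rightarrow> real \<Rightarrow> real" where
  "moment k t = (LBINT x. x ^ k * exp (t * x) * p x)"

lemma integrable_moment: "integrable lborel (\<lambda>x. x ^ k * exp (t * x) * p x)"
proof -
  obtain C where C: "\<And>x. x \<ge> 0 \<Longrightarrow> p x \<le> C * exp (- (t + 1) * x)"
    using p_decay[of "t + 1"] by blast
  have C0: "0 \<le> C" using C[of 0] p_pos[of 0] by simp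
  have "integrable lborel (\<lambda>x::real. C * (\<bar>x\<bar> ^ k * exp (- \<bar>x\<bar>)))"
    using has_bochner_integral_abs_power_exp[of k] by (intro integrable_mult_right) (simp only: has_bochner_integral_iff)
  then show ?thesis
  proof (rule Bochner_Integration.integrable_bound)
    have "norm (x ^ k * exp (t * x) * p x) \<le> norm (C * (\<bar>x\<bar> ^ k * exp (- \<bar>x\<bar>)))" for x
    proof (cases "x < 0")
      case False
      then have "exp (t * x) * p x \<le> exp (t * x) * (C * exp (- (t + 1) * x))"
        using C[of x] by (intro mult_left_mono) auto
      also have "\<dots> = C * exp (- x)" by (simp add: algebra_simps flip: exp_add)
      finally have "x ^ k * (exp (t * x) * p x) \<le> x ^ k * (C * exp (- x))"
        using False by (intro mult_left_mono) auto
      then show ?thesis using False C0 p_nonneg[of x] by (simp add: abs_mult mult_ac)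
    qed (simp add: p_neg)
    then show "AE x in lborel. norm (x ^ k * exp (t * x) * p x) \<le> norm (C * (\<bar>x\<bar> ^ k * exp (- \<bar>x\<bar>)))"
      by (intro AE_I2)
  qed measurable
qed

text \<open>
  Differentiation under the integral sign in quantitative form, from
  \<open>\<bar>exp (h x) - 1 - h x\<bar> \<le> h\<^sup>2 x\<^sup>2 exp x\<close> for \<open>x \<ge> 0\<close>.
\<close>
lemma moment_taylor:
  assumes h: "\<bar>h\<bar> \<le> 1"
  shows "\<bar>moment k (t + h) - moment k t - h * moment (Suc k) t\<bar> \<le> h\<^sup>2 * moment (k + 2) (t + 1)"
proof -
  let ?m = "\<lambda>k t x. x ^ k * exp (t * x) * p x"
  have "moment k (t + h) - moment k t - h * moment (Suc k) t = (LBINT x. ?m k (t + h) x - ?m k t x - h * ?m (Suc k) t x)"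
  proof -
    have "(LBINT x. ?m k (t + h) x - ?m k t x - h * ?m (Suc k) t x) = (LBINT x. ?m k (t + h) x - ?m k t x) - (LBINT x. h * ?m (Suc k) t x)"
      by (rule Bochner_Integration.integral_diff) (intro Bochner_Integration.integrable_diff integrable_mult_right integrable_moment)+
    also have "(LBINT x. ?m k (t + h) x - ?m k t x) = (LBINT x. ?m k (t + h) x) - (LBINT x. ?m k t x)"
      by (rule Bochner_Integration.integral_diff) (intro integrable_moment)+
    finally show ?thesis unfolding moment_def integral_mult_right_zero by simp
  qed
  then have "\<bar>moment k (t + h) - moment k t - h * moment (Suc k) t\<bar> = \<bar>LBINT x. ?m k (t + h) x - ?m k t x - h * ?m (Suc k) t x\<bar>"
    by (rule arg_cong)
  also have "\<dots> \<le> (LBINT x. \<bar>?m k (t + h) x - ?m k t x - h * ?m (Suc k) t x\<bar>)"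
    by (rule integral_abs_bound)
  also have "\<dots> \<le> (LBINT x. h\<^sup>2 * ?m (k + 2) (t + 1) x)"
  proof (rule integral_mono)
    fix x :: real
    show "\<bar>?m k (t + h) x - ?m k t x - h * ?m (Suc k) t x\<bar> \<le> h\<^sup>2 * ?m (k + 2) (t + 1) x"
    proof (cases "x < 0")
      case False
      have "\<bar>exp (h * x) - (\<Sum>i\<le>1. (h * x) ^ i / fact i)\<bar> \<le> exp \<bar>h * x\<bar> * (\<bar>h * x\<bar> ^ Suc 1) / fact 1"
        using Taylor_exp_field[of "h * x" 1] by simp
      then have "\<bar>exp (h * x) - 1 - h * x\<bar> \<le> exp \<bar>h * x\<bar> * (h\<^sup>2 * x\<^sup>2)"
        by (simp add: power2_eq_square algebra_simps)
      also have "\<dots> \<le> exp x * (h\<^sup>2 * x\<^sup>2)"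
        using h False mult_right_mono[of "\<bar>h\<bar>" 1 x] by (intro mult_right_mono) (auto simp: abs_mult)
      finally have *: "\<bar>exp (h * x) - 1 - h * x\<bar> \<le> exp x * (h\<^sup>2 * x\<^sup>2)" .
      have "\<bar>?m k (t + h) x - ?m k t x - h * ?m (Suc k) t x\<bar> = (x ^ k * exp (t * x) * p x) * \<bar>exp (h * x) - 1 - h * x\<bar>"
      proof -
        have "?m k (t + h) x - ?m k t x - h * ?m (Suc k) t x = (x ^ k * exp (t * x) * p x) * (exp (h * x) - 1 - h * x)"
          by (simp add: distrib_right exp_add algebra_simps)
        then show ?thesis using False p_nonneg by (simp add: abs_mult)
      qed
      also have "\<dots> \<le> (x ^ k * exp (t * x) * p x) * (exp x * (h\<^sup>2 * x\<^sup>2))"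
        using False p_nonneg by (intro mult_left_mono *) auto
      also have "\<dots> = h\<^sup>2 * ?m (k + 2) (t + 1) x"
        by (simp add: distrib_left distrib_right exp_add power_add power2_eq_square mult_ac)
      finally show ?thesis .
    qed (simp add: p_neg)
  qed (intro integrable_abs Bochner_Integration.integrable_diff integrable_mult_right integrable_moment)+
  also have "\<dots> = h\<^sup>2 * moment (k + 2) (t + 1)" by (simp add: moment_def)
  finally show ?thesis .
qed

lemma moment_deriv: "(moment k has_real_derivative moment (Suc k) t) (at t)"
  unfolding DERIV_def
proof (rule LIM_zero_cancel, rule Lim_null_comparison)
  show "\<forall>\<^sub>F h in at 0. norm ((moment k (t + h) - moment k t) / h - moment (Suc k) t) \<le> \<bar>h\<bar> * moment (k + 2) (t + 1)"
    unfolding eventually_at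
  proof (intro exI[of _ 1] conjI ballI impI)
    fix h :: real assume "h \<noteq> 0 \<and> dist h 0 < 1"
    then have h: "h \<noteq> 0" "\<bar>h\<bar> \<le> 1" by auto
    have "norm ((moment k (t + h) - moment k t) / h - moment (Suc k) t) = \<bar>moment k (t + h) - moment k t - h * moment (Suc k) t\<bar> / \<bar>h\<bar>"
      using h by (simp add: diff_divide_distrib flip: abs_divide)
    also have "\<dots> \<le> h\<^sup>2 * moment (k + 2) (t + 1) / \<bar>h\<bar>"
      by (intro divide_right_mono moment_taylor h) simp
    also have "\<dots> = \<bar>h\<bar> * moment (k + 2) (t + 1)"
      using h by (simp add: power2_eq_square field_simps)
    finally show "norm ((moment k (t + h) - moment k t) / h - moment (Suc k) t) \<le> \<bar>h\<bar> * moment (k + 2) (t + 1)" .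
  qed simp
  show "((\<lambda>h. \<bar>h\<bar> * moment (k + 2) (t + 1)) \<longlongrightarrow> 0) (at 0)"
    by (rule tendsto_eq_intros | simp)+
qed

lemma moment0_pos: "0 < moment 0 t"
  unfolding moment_def
  by (rule integral_pos_of_pos[OF integrable_moment[of 0 t]]) (auto simp: p_nonneg p_pos)

lemma mgf_eq: "mgf p t = moment 0 t"
  unfolding mgf_def moment_def set_lebesgue_integral_def
  by (intro Bochner_Integration.integral_cong) (auto simp: indicator_def p_neg not_le)

lemma tilt_mean_eq: "tilt_mean p t = moment 1 t / moment 0 t"
proof -
  have "((\<lambda>t. ln (moment 0 t)) has_real_derivative moment 1 t / moment 0 t) (at t)"
    using moment0_pos[of t] moment_deriv[of 0 t] by (auto intro!: derivative_eq_intros)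
  then show ?thesis unfolding tilt_mean_def mgf_eq by (rule DERIV_imp_deriv)
qed

definition variance :: "real \<Rightarrow> real" where
  "variance t = moment 2 t / moment 0 t - (tilt_mean p t)\<^sup>2"

lemma tilt_mean_deriv: "(tilt_mean p has_real_derivative variance t) (at t)"
proof -
  have "((\<lambda>t. moment 1 t / moment 0 t) has_real_derivative (moment 2 t * moment 0 t - moment 1 t * moment 1 t) / (moment 0 t * moment 0 t)) (at t)"
    using moment0_pos[of t] moment_deriv[of 0 t] moment_deriv[of 1 t]
    by (intro DERIV_divide) (auto simp: numeral_2_eq_2)
  also have "(moment 2 t * moment 0 t - moment 1 t * moment 1 t) / (moment 0 t * moment 0 t) = variance t"
    using moment0_pos[of t] by (simp add: variance_def tilt_mean_eq power2_eq_square field_simps)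
  finally show ?thesis by (simp add: tilt_mean_eq[abs_def])
qed

lemma tilt_sd_eq: "tilt_sd p t = sqrt (variance t)"
  unfolding tilt_sd_def DERIV_imp_deriv[OF tilt_mean_deriv] ..

lemma tilt_mu3_eq:
  "tilt_mu3 p t = moment 3 t / moment 0 t - 3 * tilt_mean p t * (moment 2 t / moment 0 t) + 2 * tilt_mean p t ^ 3"
proof -
  have "tilt_mu3 p t = deriv (deriv (tilt_mean p)) t"
    by (simp add: tilt_mu3_def tilt_mean_def numeral_3_eq_3)
  also have "deriv (tilt_mean p) = variance"
    using DERIV_imp_deriv[OF tilt_mean_deriv] by (simp add: fun_eq_iff)
  also have "deriv variance t = (moment 3 t * moment 0 t - moment 2 t * moment 1 t) / (moment 0 t * moment 0 t) - 2 * tilt_mean p t * variance t"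
  proof (rule DERIV_imp_deriv)
    have "((\<lambda>t. moment 2 t / moment 0 t) has_real_derivative (moment 3 t * moment 0 t - moment 2 t * moment 1 t) / (moment 0 t * moment 0 t)) (at t)"
      using moment0_pos[of t] moment_deriv[of 0 t] moment_deriv[of 2 t]
      by (intro DERIV_divide) (auto simp: numeral_2_eq_2 numeral_3_eq_3)
    moreover have "((\<lambda>t. (tilt_mean p t)\<^sup>2) has_real_derivative 2 * tilt_mean p t * variance t) (at t)"
      using tilt_mean_deriv[of t] by (auto intro!: derivative_eq_intros)
    ultimately show "(variance has_real_derivative (moment 3 t * moment 0 t - moment 2 t * moment 1 t) / (moment 0 t * moment 0 t) - 2 * tilt_mean p t * variance t) (at t)"
      unfolding variance_def[abs_def] by (intro DERIV_diff) (auto simp: variance_def)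
  qed
  also have "\<dots> = moment 3 t / moment 0 t - 3 * tilt_mean p t * (moment 2 t / moment 0 t) + 2 * tilt_mean p t ^ 3"
    using moment0_pos[of t] by (simp add: variance_def tilt_mean_eq power2_eq_square power3_eq_cube field_simps)
  finally show ?thesis .
qed

lemma tilted_moment: "integrable lborel (\<lambda>x. tilted p t x * x ^ k)" "(LBINT x. tilted p t x * x ^ k) = moment k t / moment 0 t"
proof -
  have eq: "(\<lambda>x. tilted p t x * x ^ k) = (\<lambda>x. (x ^ k * exp (t * x) * p x) / moment 0 t)"
    by (auto simp: tilted_def mgf_eq mult_ac)
  show "integrable lborel (\<lambda>x. tilted p t x * x ^ k)" "(LBINT x. tilted p t x * x ^ k) = moment k t / moment 0 t"
    unfolding eq using integrable_moment[of k t] by (simp_all add: moment_def)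
qed

lemma tilted_nonneg: "0 \<le> tilted p t x"
  using moment0_pos[of t] by (simp add: tilted_def mgf_eq p_nonneg)

lemma tilted_measurable [measurable]: "tilted p t \<in> borel_measurable borel"
  unfolding tilted_def by measurable

lemma tilted_central_moment:
  fixes a :: real
  shows "integrable lborel (\<lambda>x. tilted p t x * (x - a)\<^sup>2)"
    "(LBINT x. tilted p t x * (x - a)) = moment 1 t / moment 0 t - a"
    "(LBINT x. tilted p t x * (x - a)\<^sup>2) = moment 2 t / moment 0 t - 2 * a * (moment 1 t / moment 0 t) + a\<^sup>2"
    "(LBINT x. tilted p t x * (x - a) ^ 3) = moment 3 t / moment 0 t - 3 * a * (moment 2 t / moment 0 t) + 3 * a\<^sup>2 * (moment 1 t / moment 0 t) - a ^ 3"
proof -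
  let ?u = "\<lambda>k x. tilted p t x * x ^ k"
  note m = tilted_moment[of t]
  have m0: "moment 0 t / moment 0 t = 1" using moment0_pos[of t] by simp
  have e1: "(\<lambda>x. tilted p t x * (x - a)) = (\<lambda>x. ?u 1 x - a * ?u 0 x)" by (simp add: algebra_simps)
  have e2: "(\<lambda>x. tilted p t x * (x - a)\<^sup>2) = (\<lambda>x. ?u 2 x - 2 * a * ?u 1 x + a\<^sup>2 * ?u 0 x)"
    by (simp add: fun_eq_iff algebra_simps power2_eq_square)
  have e3: "(\<lambda>x. tilted p t x * (x - a) ^ 3) = (\<lambda>x. ?u 3 x - 3 * a * ?u 2 x + 3 * a\<^sup>2 * ?u 1 x - a ^ 3 * ?u 0 x)"
    by (simp add: fun_eq_iff algebra_simps power2_eq_square power3_eq_cube)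
  show "integrable lborel (\<lambda>x. tilted p t x * (x - a)\<^sup>2)"
    unfolding e2
    by (intro Bochner_Integration.integrable_diff Bochner_Integration.integrable_add integrable_mult_right m)
  show "(LBINT x. tilted p t x * (x - a)) = moment 1 t / moment 0 t - a"
    unfolding e1
    by (subst Bochner_Integration.integral_diff, (intro integrable_mult_right m)+) (simp only: integral_mult_right_zero m m0 mult_1_right)
  have "(LBINT x. ?u 2 x - 2 * a * ?u 1 x) = moment 2 t / moment 0 t - 2 * a * (moment 1 t / moment 0 t)"
    by (subst Bochner_Integration.integral_diff, (intro integrable_mult_right m)+) (simp only: integral_mult_right_zero m)
  then show "(LBINT x. tilted p t x * (x - a)\<^sup>2) = moment 2 t / moment 0 t - 2 * a * (moment 1 t / moment 0 t) + a\<^sup>2"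
    unfolding e2
    by (subst Bochner_Integration.integral_add, (intro Bochner_Integration.integrable_diff integrable_mult_right m)+) (simp only: integral_mult_right_zero m m0 mult_1_right)
  have "(LBINT x. ?u 3 x - 3 * a * ?u 2 x) = moment 3 t / moment 0 t - 3 * a * (moment 2 t / moment 0 t)"
    by (subst Bochner_Integration.integral_diff, (intro integrable_mult_right m)+) (simp only: integral_mult_right_zero m)
  then have "(LBINT x. ?u 3 x - 3 * a * ?u 2 x + 3 * a\<^sup>2 * ?u 1 x) = moment 3 t / moment 0 t - 3 * a * (moment 2 t / moment 0 t) + 3 * a\<^sup>2 * (moment 1 t / moment 0 t)"
    by (subst Bochner_Integration.integral_add, (intro Bochner_Integration.integrable_diff integrable_mult_right m)+) (simp only: integral_mult_right_zero m)
  then show "(LBINT x. tilted p t x * (x - a) ^ 3) = moment 3 t / moment 0 t - 3 * a * (moment 2 t / moment 0 t) + 3 * a\<^sup>2 * (moment 1 t / moment 0 t) - a ^ 3"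
    unfolding e3
    by (subst Bochner_Integration.integral_diff, (intro Bochner_Integration.integrable_diff Bochner_Integration.integrable_add integrable_mult_right m)+) (simp only: integral_mult_right_zero m m0 mult_1_right)
qed

lemma variance_pos: "0 < variance t"
proof -
  have "variance t = (LBINT x. tilted p t x * (x - tilt_mean p t)\<^sup>2)"
    unfolding tilted_central_moment variance_def by (simp add: tilt_mean_eq power2_eq_square)
  also have "0 < \<dots>"
  proof (rule integral_pos_of_pos[where a="tilt_mean p t"])
    show "0 < tilted p t x * (x - tilt_mean p t)\<^sup>2" if "0 \<le> x" "x \<noteq> tilt_mean p t" for x
      using that moment0_pos[of t] p_pos[of x] by (simp add: tilted_def mgf_eq)
  qed (simp_all add: tilted_central_moment tilted_nonneg)
  finally show ?thesis .
qed

lemma tilt_mean_mono: "s \<le> t \<Longrightarrow> tilt_mean p s \<le> tilt_mean p t"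
  by (rule DERIV_nonneg_imp_nondecreasing) (use tilt_mean_deriv variance_pos in \<open>auto intro: less_imp_le\<close>)

lemma normalized_tilted_integral:
  fixes u :: "real \<Rightarrow> real"
  assumes a: "a = tilt_mean p t"
  shows "integrable lborel (\<lambda>x. normalized_tilted p a t x * u x) \<longleftrightarrow> integrable lborel (\<lambda>y. tilted p t y * u ((y - a) / tilt_sd p t))"
    "(LBINT x. normalized_tilted p a t x * u x) = (LBINT y. tilted p t y * u ((y - a) / tilt_sd p t))"
proof -
  define s where "s = tilt_sd p t"
  have s: "s > 0" using variance_pos[of t] by (simp add: s_def tilt_sd_eq)
  have eq: "(\<lambda>x. normalized_tilted p a t x * u x) = (\<lambda>x. s * (tilted p t (a + s * x) * u ((a + s * x - a) / s)))"
    using s by (simp add: normalized_tilted_def s_def add.commute mult.assoc)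
  show "integrable lborel (\<lambda>x. normalized_tilted p a t x * u x) \<longleftrightarrow> integrable lborel (\<lambda>y. tilted p t y * u ((y - a) / tilt_sd p t))"
    unfolding eq using s lborel_integrable_real_affine_iff[of s "\<lambda>y. tilted p t y * u ((y - a) / s)" a]
    by (simp add: s_def)
  show "(LBINT x. normalized_tilted p a t x * u x) = (LBINT y. tilted p t y * u ((y - a) / tilt_sd p t))"
    unfolding eq using s lborel_integral_real_affine[of s "\<lambda>y. tilted p t y * u ((y - a) / s)" a]
    by (simp add: s_def)
qed

lemma normalized_tilted_moments:
  assumes a: "a = tilt_mean p t"
  defines "f \<equiv> normalized_tilted p a t"
  shows "f \<in> borel_measurable borel" "0 \<le> f x" "integrable lborel f" "(LBINT x. f x) = 1"
    "(LBINT x. f x * x) = 0" "(LBINT x. f x * x\<^sup>2) = 1"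
    "(LBINT x. f x * x ^ 3) = tilt_mu3 p t / tilt_sd p t ^ 3"
proof -
  define s where "s = tilt_sd p t"
  have s: "s > 0" "s\<^sup>2 = variance t" using variance_pos[of t] by (simp_all add: s_def tilt_sd_eq)
  note I = normalized_tilted_integral[OF a, folded f_def s_def]
  note m = tilted_central_moment[of t a]
  have m1: "moment 1 t / moment 0 t = a" by (simp add: a tilt_mean_eq)
  have m0: "moment 0 t / moment 0 t = 1" using moment0_pos[of t] by simp
  show "f \<in> borel_measurable borel" unfolding f_def normalized_tilted_def by measurable
  show "0 \<le> f x" unfolding f_def normalized_tilted_def using s(1) tilted_nonneg by (simp add: s_def)
  show "integrable lborel f" using I(1)[of "\<lambda>_. 1"] tilted_moment(1)[of t 0] by simp
  show "(LBINT x. f x) = 1" using I(2)[of "\<lambda>_. 1"] tilted_moment(2)[of t 0] m0 by simp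
  show "(LBINT x. f x * x) = 0" using I(2)[of "\<lambda>x. x"] m(2) m1 by simp
  have "(LBINT x. f x * x\<^sup>2) = (LBINT y. tilted p t y * (y - a)\<^sup>2) / s\<^sup>2"
    using I(2)[of "\<lambda>x. x\<^sup>2"] by (simp add: power_divide)
  also have "(LBINT y. tilted p t y * (y - a)\<^sup>2) = s\<^sup>2"
    unfolding m(3) m1 s(2) variance_def a[symmetric] by (simp add: power2_eq_square)
  finally show "(LBINT x. f x * x\<^sup>2) = 1" using s(1) by simp
  have "(LBINT x. f x * x ^ 3) = (LBINT y. tilted p t y * (y - a) ^ 3) / s ^ 3"
    using I(2)[of "\<lambda>x. x ^ 3"] by (simp add: power_divide)
  also have "(LBINT y. tilted p t y * (y - a) ^ 3) = tilt_mu3 p t"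
    unfolding m(4) m1 tilt_mu3_eq a[symmetric] by (simp add: power2_eq_square power3_eq_cube)
  finally show "(LBINT x. f x * x ^ 3) = tilt_mu3 p t / tilt_sd p t ^ 3" by (simp add: s_def)
qed

text \<open>
  A Laplace profile is preserved under affine changes of variable, with location and scale transformed
  and \<open>K\<close> unchanged. Hence a bound on the tilted density at its own scale suffices.
\<close>
lemma normalized_tilted_standardized:
  assumes a: "a = tilt_mean p t" and K: "K > 0" and \<kappa>: "\<kappa> > 0"
    and le: "\<And>y. tilted p t y \<le> K * \<kappa> * exp (- \<kappa> * \<bar>y - x0\<bar>)"
  shows "standardized (K * (1 + 4 * K)) (1024 * K ^ 4 * (384 * K + 128 * K\<^sup>2)) (normalized_tilted p a t)"
proof -
  define s where "s = tilt_sd p t"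
  have s: "s > 0" using variance_pos[of t] by (simp add: s_def tilt_sd_eq)
  note m = normalized_tilted_moments[OF a]
  show ?thesis
  proof (rule standardized_of_laplace_bound[OF m(1-6) K, of "s * \<kappa>" "(x0 - a) / s"])
    show "0 < s * \<kappa>" using s \<kappa> by simp
    fix x
    have "\<bar>s * x + a - x0\<bar> = s * \<bar>x - (x0 - a) / s\<bar>"
    proof -
      have "s * x + a - x0 = s * (x - (x0 - a) / s)" using s by (simp add: field_simps)
      then show ?thesis using s by (simp add: abs_mult)
    qed
    then show "normalized_tilted p a t x \<le> K * (s * \<kappa>) * exp (- (s * \<kappa>) * \<bar>x - (x0 - a) / s\<bar>)"
      using mult_left_mono[OF le[of "s * x + a"], of s] s
      by (simp add: normalized_tilted_def s_def mult_ac)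
  qed
qed

end

section \<open>Tilted densities of approximately log-concave functions\<close>

context superexponential_density
begin

text \<open>
  The comparison function \<open>w x = exp (t x - G x)\<close> is log-concave. The upper bound on \<open>p\<close> holds on the whole
  half line and the lower bound only on \<open>[X, \<infinity>)\<close>. For \<open>t \<ge> T\<close> one has \<open>w x \<le> w (x + X)\<close>
  on \<open>[0, X]\<close>, so \<open>[X, \<infinity>)\<close> carries at least half of the integral \<open>W\<close> of \<open>w\<close>, and \<open>mgf p t \<ge> c2 W / 2\<close>.
  The resulting constant does not depend on \<open>t\<close>.
\<close>
lemma tilted_laplace_bound:
  fixes G :: "real \<Rightarrow> real"
  assumes conv: "convex_on UNIV G" and G_decay: "\<And>t. \<exists>C. \<forall>x\<ge>0. exp (- G x) \<le> C * exp (- t * x)"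
    and X: "X > 0" and upper: "\<And>x. 0 \<le> x \<Longrightarrow> p x \<le> c1 * exp (- G x)"
    and lower: "\<And>x. X \<le> x \<Longrightarrow> c2 * exp (- G x) \<le> p x" and c: "c1 > 0" "c2 > 0"
    and slope: "\<And>x. 0 \<le> x \<Longrightarrow> x \<le> X \<Longrightarrow> G (x + X) - G x \<le> T * X" and t: "t \<ge> T"
  obtains x0 \<kappa> where "\<kappa> > 0" "\<And>y. tilted p t y \<le> (2 * exp 2 * c1 / c2) * \<kappa> * exp (- \<kappa> * \<bar>y - x0\<bar>)"
proof -
  define f where "f x = G x - t * x" for x
  define w where "w x = exp (- f x)" for x
  have w_eq: "w x = exp (t * x) * exp (- G x)" for x
    by (simp add: w_def f_def flip: exp_add)
  have G_cont: "continuous_on UNIV G" using conv by (intro convex_on_continuous) auto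
  have f_cont: "continuous_on S f" for S
    unfolding f_def by (intro continuous_intros continuous_on_subset[OF G_cont]) auto
  have [measurable]: "f \<in> borel_measurable borel" by (intro borel_measurable_continuous_onI f_cont)
  have [measurable]: "w \<in> borel_measurable borel" unfolding w_def by measurable
  have f_conv: "convex_on {0..} f"
  proof (rule convex_onI)
    fix u x y :: real assume "0 < u" "u < 1" "x \<in> {0..}" "y \<in> {0..}"
    then show "f ((1 - u) *\<^sub>R x + u *\<^sub>R y) \<le> (1 - u) * f x + u * f y"
      using convex_onD[OF conv, of u x y] by (simp add: f_def algebra_simps)
  qed auto
  obtain C where C: "\<And>x. x \<ge> 0 \<Longrightarrow> exp (- G x) \<le> C * exp (- (t + 1) * x)"
    using G_decay[of "t + 1"] by blast
  have "0 < C" using less_le_trans[OF exp_gt_zero C[of 0]] by simp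
  have wC: "w x \<le> C * exp (- x)" if "x \<ge> 0" for x
  proof -
    have "w x \<le> exp (t * x) * (C * exp (- (t + 1) * x))"
      unfolding w_eq using C[OF that] by (intro mult_left_mono) auto
    also have "\<dots> = C * exp (- x)" by (simp add: algebra_simps flip: exp_add)
    finally show ?thesis .
  qed
  have f_lim: "filterlim f at_top at_top"
  proof (rule filterlim_at_top_mono)
    show "filterlim (\<lambda>x. - ln C + x) at_top at_top"
      by (rule filterlim_tendsto_add_at_top[OF tendsto_const filterlim_ident])
    show "\<forall>\<^sub>F x in at_top. - ln C + x \<le> f x"
      using eventually_ge_at_top[of 0]
    proof eventually_elim
      case (elim x)
      have "exp (- f x) \<le> exp (ln C + - x)"
        using wC[OF elim] \<open>0 < C\<close> unfolding w_def exp_add by (simp only: exp_ln)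
      then have "- f x \<le> ln C + - x" by (simp only: exp_le_cancel_iff)
      then show ?case by simp
    qed
  qed
  have expi: "integrable lborel (\<lambda>x::real. C * (\<bar>x\<bar> ^ 0 * exp (- \<bar>x\<bar>)))"
    using has_bochner_integral_abs_power_exp[of 0] by (intro integrable_mult_right) (simp only: has_bochner_integral_iff)
  have wi: "integrable lborel (\<lambda>x. indicator {a..} x * w x)" if "0 \<le> a" for a
  proof (rule Bochner_Integration.integrable_bound[OF expi])
    show "AE x in lborel. norm (indicator {a..} x * w x) \<le> norm (C * (\<bar>x\<bar> ^ 0 * exp (- \<bar>x\<bar>)))"
      using wC that \<open>0 < C\<close> by (intro AE_I2) (auto simp: indicator_def w_def)
  qed measurable
  define W where "W = (LBINT x. indicator {0..} x * w x)"
  define WX where "WX = (LBINT x. indicator {X..} x * w x)"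
  have W0: "0 < W"
    unfolding W_def by (rule integral_pos_of_pos[OF wi, where a=0]) (auto simp: w_def indicator_def)
  have W2: "W \<le> 2 * WX"
  proof -
    have shift_eq: "(\<lambda>x. indicator {X..} (X + 1 * x) * w (X + 1 * x)) = (\<lambda>x. indicator {0..} x * w (x + X))"
      by (auto simp: indicator_def fun_eq_iff add.commute)
    have si: "integrable lborel (\<lambda>x. indicator {0..} x * w (x + X))"
      using lborel_integrable_real_affine[OF wi[of X], of 1 X] X unfolding shift_eq by simp
    have "WX = (LBINT x. indicator {0..} x * w (x + X))"
      unfolding WX_def using lborel_integral_real_affine[of 1 "\<lambda>x. indicator {X..} x * w x" X] unfolding shift_eq by simp
    moreover have "W \<le> (LBINT x. indicator {0..} x * w (x + X) + indicator {X..} x * w x)"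
      unfolding W_def
    proof (rule integral_mono)
      show "integrable lborel (\<lambda>x. indicator {0..} x * w (x + X) + indicator {X..} x * w x)"
        using si wi[of X] X by simp
      fix x :: real
      show "indicator {0..} x * w x \<le> indicator {0..} x * w (x + X) + indicator {X..} x * w x"
      proof (cases "0 \<le> x \<and> x < X")
        case True
        have "T * X \<le> t * X" using t X by simp
        then have "f (x + X) \<le> f x" using slope[of x] True unfolding f_def distrib_left by linarith
        then show ?thesis using True by (simp add: w_def)
      next
        case False
        then show ?thesis using X by (auto simp: w_def indicator_def)
      qed
    qed (use wi in simp)
    moreover have "(LBINT x. indicator {0..} x * w (x + X) + indicator {X..} x * w x)
       = (LBINT x. indicator {0..} x * w (x + X)) + WX"
      unfolding WX_def using si wi[of X] X by simp
    ultimately show ?thesis by simp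
  qed
  have mgf_ge: "c2 * WX \<le> mgf p t"
  proof -
    have "c2 * WX = (LBINT x. c2 * (indicator {X..} x * w x))" by (simp add: WX_def)
    also have "\<dots> \<le> (LBINT x. x ^ 0 * exp (t * x) * p x)"
    proof (rule integral_mono)
      show "integrable lborel (\<lambda>x. c2 * (indicator {X..} x * w x))" using wi[of X] X by simp
      fix x
      show "c2 * (indicator {X..} x * w x) \<le> x ^ 0 * exp (t * x) * p x"
      proof (cases "X \<le> x")
        case True
        have "exp (t * x) * (c2 * exp (- G x)) \<le> exp (t * x) * p x"
          using lower[OF True] by (intro mult_left_mono) auto
        then show ?thesis using True by (simp add: w_eq mult_ac)
      qed (simp add: p_nonneg)
    qed (rule integrable_moment)
    finally show ?thesis by (simp add: mgf_eq moment_def)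
  qed
  have mgf_W: "c2 * W / 2 \<le> mgf p t"
  proof -
    have "c2 * W \<le> c2 * (2 * WX)" using W2 c by (intro mult_left_mono) auto
    then show ?thesis using mgf_ge by linarith
  qed
  have int: "set_integrable lborel {0..} (\<lambda>x. exp (- f x))"
    using wi[of 0] by (simp add: set_integrable_def w_def)
  have WW: "(LBINT x:{0..}. exp (- f x)) = W"
    by (simp add: W_def set_lebesgue_integral_def w_def)
  have Wpos: "0 < (LBINT x:{0..}. exp (- f x))" unfolding WW by (rule W0)
  obtain x0 \<kappa> where \<kappa>: "\<kappa> > 0" and
    b: "\<And>x. 0 \<le> x \<Longrightarrow> exp (- f x) \<le> exp 2 * \<kappa> * W * exp (- \<kappa> * \<bar>x - x0\<bar>)"
    using log_concave_laplace_bound[OF f_conv f_cont f_lim int Wpos] unfolding WW by metis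
  show ?thesis
  proof (rule that[OF \<kappa>])
    fix y
    show "tilted p t y \<le> (2 * exp 2 * c1 / c2) * \<kappa> * exp (- \<kappa> * \<bar>y - x0\<bar>)"
    proof (cases "0 \<le> y")
      case True
      have "exp (t * y) * p y \<le> exp (t * y) * (c1 * exp (- G y))"
        using upper[OF True] by (intro mult_left_mono) auto
      also have "\<dots> = c1 * w y" by (simp add: w_eq)
      also have "\<dots> \<le> c1 * (exp 2 * \<kappa> * W * exp (- \<kappa> * \<bar>y - x0\<bar>))"
        unfolding w_def using b[OF True] c by (intro mult_left_mono) auto
      finally have "tilted p t y \<le> c1 * (exp 2 * \<kappa> * W * exp (- \<kappa> * \<bar>y - x0\<bar>)) / (c2 * W / 2)"
        unfolding tilted_def using mgf_W c W0 \<kappa>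
        by (intro frac_le) (auto intro!: mult_nonneg_nonneg)
      also have "\<dots> = (2 * exp 2 * c1 / c2) * \<kappa> * exp (- \<kappa> * \<bar>y - x0\<bar>)"
        using W0 c by simp
      finally show ?thesis .
    next
      case False
      then show ?thesis using c \<kappa> by (simp add: tilted_def p_neg)
    qed
  qed
qed

end

section \<open>Monotonicity of \<open>h\<close> and convexity of \<open>g\<close>\<close>

text \<open>
  The logarithmic derivative of \<open>x powr \<beta> * l x\<close> is \<open>(\<beta> + \<epsilon> x) / x\<close>, which is eventually positive since
  \<open>\<epsilon>\<close> tends to \<open>0\<close>.
\<close>
lemma class_R_eventually_mono:
  assumes "h \<in> class_R \<beta>" "\<beta> > 0"
  obtains X where "X > 0" "\<And>x y. X \<le> x \<Longrightarrow> x \<le> y \<Longrightarrow> h x \<le> h y"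
proof -
  obtain l \<epsilon> \<epsilon>1 \<epsilon>2 where R: "R0_rep l \<epsilon> \<epsilon>1 \<epsilon>2" and ev: "\<forall>\<^sub>F x in at_top. h x = x powr \<beta> * l x"
    using assms(1) unfolding class_R_def by blast
  have d: "\<And>x. x \<ge> 1 \<Longrightarrow> (\<epsilon> has_real_derivative \<epsilon>1 x) (at x within {1..})"
    and lim: "(\<epsilon> \<longlongrightarrow> 0) at_top" and l: "\<And>x. x \<ge> 1 \<Longrightarrow> l x = exp (integral {1..x} (\<lambda>u. \<epsilon> u / u))"
    using R by (auto simp: R0_rep_def)
  have cont: "continuous_on {1..} (\<lambda>u. \<epsilon> u / u)"
  proof (intro continuous_on_divide continuous_on_id)
    show "continuous_on {1..} \<epsilon>"
      using d by (auto simp: continuous_on_eq_continuous_within intro: DERIV_continuous)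
  qed auto
  have "\<forall>\<^sub>F x in at_top. - \<beta> < \<epsilon> x" using lim assms(2) by (intro order_tendstoD) auto
  with ev have "\<forall>\<^sub>F x in at_top. h x = x powr \<beta> * l x \<and> - \<beta> < \<epsilon> x" by (rule eventually_conj)
  then obtain N where N: "\<And>x. x \<ge> N \<Longrightarrow> h x = x powr \<beta> * l x \<and> - \<beta> < \<epsilon> x"
    unfolding eventually_at_top_linorder by blast
  define X where "X = max N 2"
  show ?thesis
  proof (rule that)
    show "X > 0" by (simp add: X_def)
    fix x y assume xy: "X \<le> x" "x \<le> y"
    define \<Psi> where "\<Psi> v = \<beta> * ln v + integral {1..v} (\<lambda>u. \<epsilon> u / u)" for v
    have h: "h v = exp (\<Psi> v)" if "X \<le> v" for v
      using N[of v] l[of v] that by (simp add: \<Psi>_def X_def powr_def exp_add)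
    have "\<Psi> x \<le> \<Psi> y"
    proof (rule DERIV_nonneg_imp_nondecreasing[OF xy(2)])
      fix v assume v: "x \<le> v" "v \<le> y"
      have v2: "2 \<le> v" "N \<le> v" using v xy by (auto simp: X_def)
      have "((\<lambda>v. integral {1..v} (\<lambda>u. \<epsilon> u / u)) has_real_derivative \<epsilon> v / v) (at v within {1..v + 1})"
        using v2 by (intro integral_has_real_derivative continuous_on_subset[OF cont]) auto
      moreover have "at v within {1..v + 1} = at v" using v2 by (intro at_within_Icc_at) auto
      ultimately have "(\<Psi> has_real_derivative \<beta> * (1 / v) + \<epsilon> v / v) (at v)"
        unfolding \<Psi>_def using v2 by (auto intro!: derivative_eq_intros)
      moreover have "0 \<le> \<beta> * (1 / v) + \<epsilon> v / v"
        using N[of v] v2 by (simp flip: add_divide_distrib)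
      ultimately show "\<exists>D. (\<Psi> has_real_derivative D) (at v) \<and> 0 \<le> D" by blast
    qed
    then show "h x \<le> h y" using h[of x] h[of y] xy by simp
  qed
qed

lemma class_RR_eventually_mono:
  assumes "h \<in> class_RR"
  obtains X where "X > 0" "\<And>x y. X \<le> x \<Longrightarrow> x \<le> y \<Longrightarrow> h x \<le> h y"
proof -
  consider \<beta> where "\<beta> > 0" "h \<in> class_R \<beta>" | "strict_mono_on {0<..} h"
    using assms by (auto simp: class_RR_def class_R_infinity_def)
  then show ?thesis
  proof cases
    case 1
    then show ?thesis using class_R_eventually_mono that by metis
  next
    case 2
    show ?thesis
    proof (rule that[of 1])
      fix x y :: real assume "1 \<le> x" "x \<le> y"
      then show "h x \<le> h y"
        using strict_mono_onD[OF 2, of x y] by (cases "x = y") auto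
    qed simp
  qed
qed

lemma superlinear_derivative_unbounded:
  fixes g h :: "real \<Rightarrow> real"
  assumes g: "filterlim (\<lambda>x. g x / x) at_top at_top"
    and d: "\<And>x. x > 0 \<Longrightarrow> (g has_real_derivative h x) (at x)" and X: "X > 0"
  obtains x where "X \<le> x" "1 \<le> h x"
proof (rule ccontr)
  assume "\<not> thesis"
  then have lt: "h x < 1" if "X \<le> x" for x using \<open>X \<le> x\<close> not_le \<open>\<not> thesis\<close> \<open>\<And>x. \<lbrakk>X \<le> x; 1 \<le> h x\<rbrakk> \<Longrightarrow> thesis\<close> by blast
  have bd: "g x / x \<le> \<bar>g X\<bar> / X + 1" if x: "X < x" for x
  proof -
    obtain z where z: "X < z" "z < x" "g x - g X = (x - X) * h z"
      using MVT2[OF x, of g h] d X by auto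
    have "(x - X) * h z \<le> (x - X) * 1" using z x lt[of z] by (intro mult_left_mono) auto
    then have "g x - g X \<le> x - X" using z(3) by simp
    then have "g x \<le> \<bar>g X\<bar> + x" using X by linarith
    then have "g x / x \<le> (\<bar>g X\<bar> + x) / x" using x X by (intro divide_right_mono) auto
    also have "\<dots> = \<bar>g X\<bar> / x + 1" using x X by (simp add: add_divide_distrib)
    also have "\<dots> \<le> \<bar>g X\<bar> / X + 1" using x X by (intro add_right_mono divide_left_mono) auto
    finally show ?thesis .
  qed
  have "\<forall>\<^sub>F x in at_top. \<bar>g X\<bar> / X + 1 < g x / x"
    using g by (simp add: filterlim_at_top_dense)
  with eventually_gt_at_top[of X] have "\<forall>\<^sub>F x::real in at_top. False"
    by eventually_elim (use bd in \<open>auto simp: not_le[symmetric]\<close>)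
  then show False by simp
qed

text \<open>
  On \<open>[0, X)\<close> the function \<open>g\<close> need not be convex, and \<open>p\<close> is only known to be bounded; there \<open>p\<close> is below
  a multiple of \<open>exp (-G)\<close> for every continuation \<open>G\<close> bounded on \<open>[0, X)\<close>, and the tangent keeps \<open>G\<close> convex. The
  extension to the whole line makes convexity imply continuity on \<open>[0, \<infinity>)\<close>, including the endpoint.
\<close>
definition tangent_extension :: "real \<Rightarrow> (real \<Rightarrow> real) \<Rightarrow> (real \<Rightarrow> real) \<Rightarrow> real \<Rightarrow> real" where
  "tangent_extension X g h x = (if X \<le> x then g x else g X + h X * (x - X))"

text \<open>
  Convexity in the form of a supporting line at every point, which can be checked separately on the two
  sides of \<open>X\<close>; at a point \<open>x < X\<close> the slope is \<open>h X\<close>.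
\<close>
lemma tangent_extension_supporting_line:
  fixes g h :: "real \<Rightarrow> real"
  assumes d: "\<And>x. X \<le> x \<Longrightarrow> (g has_real_derivative h x) (at x)"
    and mono: "\<And>x y. X \<le> x \<Longrightarrow> x \<le> y \<Longrightarrow> h x \<le> h y"
  shows "h (max X x) * (y - x) \<le> tangent_extension X g h y - tangent_extension X g h x"
proof -
  have sup: "h u * (v - u) \<le> g v - g u" if uv: "X \<le> u" "X \<le> v" for u v
  proof (cases u v rule: linorder_cases)
    case less
    obtain z where z: "u < z" "z < v" "g v - g u = (v - u) * h z"
      using MVT2[OF less, of g h] d uv by auto
    then show ?thesis using mono[of u z] uv less by (simp add: mult.commute mult_left_mono)
  next
    case greater
    obtain z where z: "v < z" "z < u" "g u - g v = (u - v) * h z"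
      using MVT2[OF greater, of g h] d uv by auto
    have "(u - v) * h z \<le> (u - v) * h u" using mono[of z u] uv z greater by (intro mult_left_mono) auto
    then show ?thesis using z by (simp add: algebra_simps)
  qed simp
  show ?thesis
  proof (cases "X \<le> x"; cases "X \<le> y")
    assume "X \<le> x" "X \<le> y"
    then show ?thesis using sup[of x y] by (simp add: tangent_extension_def max_absorb2)
  next
    assume a: "X \<le> x" "\<not> X \<le> y"
    have "h x * (X - x) \<le> g X - g x" using sup[of x X] a by simp
    moreover have "h x * (y - X) \<le> h X * (y - X)" using mono[of X x] a by (intro mult_right_mono_neg) auto
    ultimately show ?thesis using a by (simp add: tangent_extension_def max_absorb2 algebra_simps)
  next
    assume a: "\<not> X \<le> x" "X \<le> y"
    have "h X * (y - X) \<le> g y - g X" using sup[of X y] a by simp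
    then show ?thesis using a by (simp add: tangent_extension_def max_absorb1 algebra_simps)
  next
    assume a: "\<not> X \<le> x" "\<not> X \<le> y"
    then show ?thesis by (simp add: tangent_extension_def max_absorb1 algebra_simps)
  qed
qed

lemma tangent_extension_decay:
  fixes g h :: "real \<Rightarrow> real"
  assumes conv: "convex_on UNIV (tangent_extension X g h)" and g: "filterlim (\<lambda>x. g x / x) at_top at_top"
  shows "\<exists>C. \<forall>x\<ge>0. exp (- tangent_extension X g h x) \<le> C * exp (- t * x)"
proof -
  let ?G = "tangent_extension X g h"
  have cont: "continuous_on UNIV ?G" using conv by (intro convex_on_continuous) auto
  have "\<forall>\<^sub>F x in at_top. t \<le> g x / x" using g by (simp add: filterlim_at_top)
  then obtain R0 where R0: "\<And>x. x \<ge> R0 \<Longrightarrow> t \<le> g x / x" unfolding eventually_at_top_linorder by blast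
  define R where "R = max 1 (max R0 X)"
  have "\<exists>x\<in>{0..R}. \<forall>y\<in>{0..R}. exp (- ?G y + t * y) \<le> exp (- ?G x + t * x)"
    by (intro continuous_attains_sup continuous_intros continuous_on_subset[OF cont]) (auto simp: R_def)
  then obtain x0 where x0: "\<And>y. 0 \<le> y \<Longrightarrow> y \<le> R \<Longrightarrow> exp (- ?G y + t * y) \<le> exp (- ?G x0 + t * x0)"
    by (metis atLeastAtMost_iff)
  show ?thesis
  proof (intro exI[of _ "exp (- ?G x0 + t * x0) + 1"] allI impI)
    fix x :: real assume x: "0 \<le> x"
    have "exp (- ?G x + t * x) \<le> exp (- ?G x0 + t * x0) + 1"
    proof (cases "x \<le> R")
      case True
      then show ?thesis using x0[OF x True] by linarith
    next
      case False
      then have "1 \<le> x" "X \<le> x" "t \<le> g x / x" using R0[of x] by (auto simp: R_def)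
      then have "t * x \<le> ?G x" by (simp add: tangent_extension_def field_simps)
      then have "exp (- ?G x + t * x) \<le> 1" by simp
      then show ?thesis using exp_ge_zero[of "- ?G x0 + t * x0"] by linarith
    qed
    from mult_right_mono[OF this, of "exp (- t * x)"]
    show "exp (- ?G x) \<le> (exp (- ?G x0 + t * x0) + 1) * exp (- t * x)"
      by (simp flip: exp_add)
  qed
qed

section \<open>Edgeworth expansion under tilting\<close>

theorem theorem4p1:
  fixes p g q h :: "real \<Rightarrow> real" and c \<theta> :: real and a t :: "nat \<Rightarrow> real"
  assumes p_form: "\<And>x. p x = (if x \<ge> 0 then c * exp (- (g x - q x)) else 0)"
    and c_pos: "c > 0"
    and p_meas: "p \<in> borel_measurable borel"
    and p_prob: "prob_space (density lborel (\<lambda>x. ennreal (p x)))"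
    and p_bounded: "\<exists>M. \<forall>x. p x \<le> M"
    and g_pos: "\<And>x. x \<ge> 0 \<Longrightarrow> g x > 0"
    and g_superlinear: "filterlim (\<lambda>x. g x / x) at_top at_top"
    and h_deriv: "\<And>x. x > 0 \<Longrightarrow> (g has_real_derivative h x) (at x)"
    and h_class: "h \<in> class_RR"
    and \<theta>_pos: "\<theta> > 0"
    and q_small: "\<forall>\<^sub>F x in at_top. \<forall>v\<ge>0. \<bar>v - x\<bar> < \<theta> * x \<longrightarrow> \<bar>q v\<bar> \<le> 1 / (x * sqrt (h x))"
    and a_lim: "filterlim a at_top sequentially"
    and t_sol: "\<forall>\<^sub>F n in sequentially. tilt_mean p (t n) = a n"
  shows "uniform_limit UNIV
    (\<lambda>n x. sqrt (real n) *
       (rho p (a n) (t n) n x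
        - std_normal_density x *
            (1 + tilt_mu3 p (t n) / (6 * sqrt (real n) * tilt_sd p (t n) ^ 3) * (x ^ 3 - 3 * x))))
    (\<lambda>x. 0) sequentially"
proof -
  obtain X0 where X0: "X0 > 0" "\<And>x y. X0 \<le> x \<Longrightarrow> x \<le> y \<Longrightarrow> h x \<le> h y"
    using class_RR_eventually_mono[OF h_class] by metis
  obtain X1 where X1: "X0 \<le> X1" "1 \<le> h X1"
    using superlinear_derivative_unbounded[OF g_superlinear h_deriv X0(1)] by metis
  obtain N where N: "\<And>x v. N \<le> x \<Longrightarrow> 0 \<le> v \<Longrightarrow> \<bar>v - x\<bar> < \<theta> * x \<Longrightarrow> \<bar>q v\<bar> \<le> 1 / (x * sqrt (h x))"
    using q_small unfolding eventually_at_top_linorder by blast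
  \<comment> \<open>Beyond \<open>X\<close>, \<open>h\<close> is nondecreasing and at least \<open>1\<close>, and the condition on \<open>q\<close>, read at \<open>v = x\<close>, gives \<open>\<bar>q\<bar> \<le> 1\<close>.\<close>
  define X where "X = max 1 (max X1 N)"
  have X: "1 \<le> X" "X0 \<le> X" "X1 \<le> X" "N \<le> X" using X1 by (auto simp: X_def)
  have h_mono: "h x \<le> h y" if "X \<le> x" "x \<le> y" for x y using X0(2)[of x y] that X by linarith
  have h1: "1 \<le> h x" if "X \<le> x" for x using X0(2)[of X1 x] X1 X that by linarith
  have q1: "\<bar>q x\<bar> \<le> 1" if "X \<le> x" for x
  proof -
    have "\<bar>q x\<bar> \<le> 1 / (x * sqrt (h x))" using N[of x x] that X \<theta>_pos by simp
    also have "\<dots> \<le> 1 / 1"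
    proof (intro divide_left_mono)
      have "1 * 1 \<le> x * sqrt (h x)" using that X h1[OF that] by (intro mult_mono) auto
      then show "1 \<le> x * sqrt (h x)" by simp
    qed (use that X h1[OF that] in auto)
    finally show ?thesis by simp
  qed
  define G where "G = tangent_extension X g h"
  have dX: "(g has_real_derivative h x) (at x)" if "X \<le> x" for x using h_deriv[of x] that X by simp
  have line: "h (max X x) * (y - x) \<le> G y - G x" for x y
    unfolding G_def by (rule tangent_extension_supporting_line[OF dX h_mono])
  have G_conv: "convex_on UNIV G"
    by (rule pos_convex_function[where f'="\<lambda>x. h (max X x)"]) (use line in auto)
  have G_decay: "\<exists>C. \<forall>x\<ge>0. exp (- G x) \<le> C * exp (- t * x)" for t
    using tangent_extension_decay[OF G_conv[unfolded G_def] g_superlinear] by (simp add: G_def)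
  obtain M where M: "\<And>x. p x \<le> M" using p_bounded by blast
  \<comment> \<open>The second summand serves \<open>[0, X]\<close>, where \<open>G \<le> g X\<close>.\<close>
  define c1 where "c1 = c * exp 1 + \<bar>M\<bar> * exp (g X)"
  define c2 where "c2 = c * exp (- 1)"
  have c12: "c1 > 0" "c2 > 0" using c_pos by (auto simp: c1_def c2_def add_pos_nonneg)
  have upper: "p x \<le> c1 * exp (- G x)" if x: "0 \<le> x" for x
  proof (cases "X \<le> x")
    case True
    have "p x = c * exp (q x) * exp (- g x)"
      using p_form[of x] x by (simp flip: exp_add)
    also have "\<dots> \<le> c * exp 1 * exp (- g x)"
      using q1[OF True] c_pos by (intro mult_right_mono mult_left_mono) auto
    also have "\<dots> \<le> c1 * exp (- g x)" by (intro mult_right_mono) (auto simp: c1_def)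
    finally show ?thesis using True by (simp add: G_def tangent_extension_def)
  next
    case False
    have "h X * (x - X) \<le> 0" using False h1[of X] by (intro mult_nonneg_nonpos) auto
    then have "G x \<le> g X" using False by (simp add: G_def tangent_extension_def)
    then have "1 \<le> exp (g X) * exp (- G x)" by (simp flip: exp_add)
    then have "\<bar>M\<bar> * 1 \<le> \<bar>M\<bar> * (exp (g X) * exp (- G x))" by (intro mult_left_mono) auto
    also have "\<dots> \<le> c1 * exp (- G x)" using c_pos by (simp add: c1_def distrib_right)
    finally show ?thesis using M[of x] by simp
  qed
  have lower: "c2 * exp (- G x) \<le> p x" if x: "X \<le> x" for x
  proof -
    have "c * exp (- 1) * exp (- g x) \<le> c * exp (q x) * exp (- g x)"
      using q1[OF x] c_pos by (intro mult_right_mono mult_left_mono) auto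
    also have "\<dots> = p x" using p_form[of x] x X by (simp flip: exp_add)
    finally show ?thesis using x by (simp add: c2_def G_def tangent_extension_def)
  qed
  interpret superexponential_density p
  proof
    show "p \<in> borel_measurable borel" by (rule p_meas)
    show "x < 0 \<Longrightarrow> p x = 0" "0 \<le> x \<Longrightarrow> 0 < p x" for x using p_form[of x] c_pos by auto
    fix t
    obtain C where C: "\<And>x. x \<ge> 0 \<Longrightarrow> exp (- G x) \<le> C * exp (- t * x)" using G_decay by blast
    have "p x \<le> (c1 * C) * exp (- t * x)" if "0 \<le> x" for x
    proof -
      have "c1 * exp (- G x) \<le> c1 * (C * exp (- t * x))"
        using C[OF that] c12 by (intro mult_left_mono) auto
      then show ?thesis using upper[OF that] unfolding mult.assoc by (rule order_trans[rotated])
    qed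
    then show "\<exists>C. \<forall>x\<ge>0. p x \<le> C * exp (- t * x)" by blast
  qed
  define T where "T = h (2 * X)"
  have slope: "G (x + X) - G x \<le> T * X" if "0 \<le> x" "x \<le> X" for x
  proof -
    have "G (x + X) - G x \<le> h (x + X) * X" using line[of "x + X" x] that X by (simp add: max_absorb2)
    also have "\<dots> \<le> T * X" unfolding T_def using that X by (intro mult_right_mono h_mono) auto
    finally show ?thesis .
  qed
  define K where "K = 2 * exp 2 * c1 / c2"
  have K: "K > 0" using c12 by (simp add: K_def)
  define M' where "M' = K * (1 + 4 * K)"
  define B where "B = 1024 * K ^ 4 * (384 * K + 128 * K\<^sup>2)"
  have MB: "M' > 0" "B \<ge> 0" using K by (auto simp: M'_def B_def add_pos_pos)
  have std: "standardized M' B (normalized_tilted p b u)" if b: "b = tilt_mean p u" and u: "T \<le> u" for b u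
  proof -
    have "0 < X" using X by simp
    then obtain x0 \<kappa> where "\<kappa> > 0" "\<And>y. tilted p u y \<le> K * \<kappa> * exp (- \<kappa> * \<bar>y - x0\<bar>)"
      using tilted_laplace_bound[OF G_conv G_decay _ upper lower c12 slope u] unfolding K_def by metis
    then show ?thesis
      unfolding M'_def B_def by (intro normalized_tilted_standardized[OF b K])
  qed
  obtain e :: "nat \<Rightarrow> real" where e: "e \<longlonglongrightarrow> 0"
    "\<And>f n x. standardized M' B f \<Longrightarrow> n \<ge> 3 \<Longrightarrow>
       sqrt n * \<bar>sqrt n * conv_power f n (sqrt n * x) -
         std_normal_density x * (1 + (LBINT x. f x * x ^ 3) / (6 * sqrt n) * (x ^ 3 - 3 * x))\<bar> \<le> e n"
    by (rule edgeworth_expansion_uniform[OF MB]) (rule that; assumption)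
  have "\<forall>\<^sub>F n in sequentially. tilt_mean p T < a n"
    using a_lim by (simp add: filterlim_at_top_dense)
  with t_sol have tT: "\<forall>\<^sub>F n in sequentially. tilt_mean p (t n) = a n \<and> T \<le> t n"
    by eventually_elim (metis linear not_le tilt_mean_mono)
  show ?thesis
  proof (rule uniform_limitI)
    fix \<epsilon> :: real assume "\<epsilon> > 0"
    then have "\<forall>\<^sub>F n in sequentially. e n < \<epsilon>" using e(1) by (intro order_tendstoD)
    with tT eventually_ge_at_top[of 3]
    show "\<forall>\<^sub>F n in sequentially. \<forall>x\<in>UNIV. dist (sqrt (real n) *
       (rho p (a n) (t n) n x
        - std_normal_density x *
            (1 + tilt_mu3 p (t n) / (6 * sqrt (real n) * tilt_sd p (t n) ^ 3) * (x ^ 3 - 3 * x)))) 0 < \<epsilon>"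
    proof eventually_elim
      case (elim n)
      then have a: "a n = tilt_mean p (t n)" by simp
      show ?case
      proof
        fix x :: real
        have "sqrt n * \<bar>sqrt n * conv_power (normalized_tilted p (a n) (t n)) n (sqrt n * x) -
          std_normal_density x * (1 + (tilt_mu3 p (t n) / tilt_sd p (t n) ^ 3) / (6 * sqrt n) * (x ^ 3 - 3 * x))\<bar> < \<epsilon>"
          using e(2)[OF std[OF a], of n x] elim unfolding normalized_tilted_moments(7)[OF a] by simp
        moreover
        have "(tilt_mu3 p (t n) / tilt_sd p (t n) ^ 3) / (6 * sqrt n) = tilt_mu3 p (t n) / (6 * sqrt (real n) * tilt_sd p (t n) ^ 3)"
          by (simp add: mult.commute)
        then have "(tilt_mu3 p (t n) / tilt_sd p (t n) ^ 3) / (6 * sqrt n) * (x ^ 3 - 3 * x) = tilt_mu3 p (t n) / (6 * sqrt (real n) * tilt_sd p (t n) ^ 3) * (x ^ 3 - 3 * x)"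
          by simp
        ultimately show "dist (sqrt (real n) *
       (rho p (a n) (t n) n x
        - std_normal_density x *
            (1 + tilt_mu3 p (t n) / (6 * sqrt (real n) * tilt_sd p (t n) ^ 3) * (x ^ 3 - 3 * x)))) 0 < \<epsilon>"
          by (simp add: rho_def abs_mult dist_real_def del: times_divide_eq_left times_divide_eq_right divide_divide_eq_left)
      qed
    qed
  qed
qed

end
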